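(* For all sufficiently large $\mathcal{E}>0$ there exists a unique solution $u_* \in \check{H}^2_{\rm per}(\mathbb{T})$ with $u_*'(0)<0$ of the constrained maximization problem $$\max_{u \in H^2_{\rm per}(\mathbb{T})} R(u) \quad \text{subject to} \quad E(u) = \mathcal{E},$$ and it satisfies $$u_*(x) = 4k\,(2x - \tanh(kx)) + \mathcal{O}_{L^\infty}(k^2 e^{-k}) \quad \text{as } k \to \infty,$$ where the parameter $k>0$ (depending on $\mathcal{E}$, with $k\to\infty$ as $\mathcal{E}\to\infty$) determines the leading order expansions $$K(u_* ) = \tfrac{8}{3}k^2 + \mathcal{O}(k), \qquad E(u_* ) = \tfrac{32}{3}k^3 + \mathcal{O}(k^2), \qquad R(u_* ) = \tfrac{256}{5}k^5 + \mathcal{O}(k^4)$$ as $k\to\infty$.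
   Context: $\mathbb{T} = [-\frac12,\frac12]$ is the unit circle (endpoints identified, periodic boundary conditions); functions are real-valued. $H^2_{\rm per}(\mathbb{T})$ is the Sobolev space of $1$-periodic functions and $\check{H}^2_{\rm per}(\mathbb{T})$ is its restriction to odd functions. For functions $u$ on $\mathbb{T}$, $$K(u) = \frac12\int_{\mathbb{T}} u^2\,dx, \qquad E(u) = \frac12 \int_{\mathbb{T}} u_x^2\,dx, \qquad R(u) = -\int_{\mathbb{T}} (u_{xx}^2 + u_x^3)\,dx.$$ $A = \mathcal{O}_{L^\infty}(B)$ means $\|A\|_{L^\infty(\mathbb{T})} = \mathcal{O}(B)$; $\mathcal{O}$ for error terms means bounded in absolute value by a constant times the indicated quantity in the indicated limit. *)

theory Defs
  imports
    "HOL-Analysis.Analysis"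
    "HOL-Library.Landau_Symbols"
    "HOL-Library.Going_To_Filter"
begin

abbreviation Tcircle :: "real set" where
  "Tcircle \<equiv> {-1/2..1/2}"

definition per1 :: "(real \<Rightarrow> real) \<Rightarrow> bool" where
  "per1 f \<longleftrightarrow> (\<forall>x. f (x + 1) = f x)"

definition test_fun :: "(real \<Rightarrow> real) \<Rightarrow> bool" where
  "test_fun \<phi> \<longleftrightarrow> per1 \<phi> \<and> (\<forall>j x. (deriv ^^ j) \<phi> differentiable (at x))"

definition L2_T :: "(real \<Rightarrow> real) set" where
  "L2_T = {f. set_borel_measurable lborel Tcircle f \<and>
              set_integrable lborel Tcircle (\<lambda>x. (f x)\<^sup>2)}"

text \<open>The weak (distributional) derivative of order \<open>j\<close> on the circle: the test functions
  are the smooth 1-periodic functions, so no boundary terms occur.\<close>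
definition is_weak_deriv :: "nat \<Rightarrow> (real \<Rightarrow> real) \<Rightarrow> (real \<Rightarrow> real) \<Rightarrow> bool" where
  "is_weak_deriv j u g \<longleftrightarrow> g \<in> L2_T \<and>
     (\<forall>\<phi>. test_fun \<phi> \<longrightarrow>
        (LINT x:Tcircle|lborel. u x * (deriv ^^ j) \<phi> x)
          = (-1) ^ j * (LINT x:Tcircle|lborel. g x * \<phi> x))"

text \<open>Weak derivatives are unique up to null sets; \<open>weak_deriv\<close> picks a representative, and is
  only used under integrals.\<close>
definition weak_deriv :: "nat \<Rightarrow> (real \<Rightarrow> real) \<Rightarrow> real \<Rightarrow> real" where
  "weak_deriv j u = (SOME g. is_weak_deriv j u g)"

text \<open>The Sobolev space \<open>H\<^sup>2\<close> of 1-periodic functions. A class modulo null sets in this space has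
  exactly one continuous representative (which is even continuously differentiable); the elements
  below are these representatives, so that equality of functions is equality in the Sobolev space
  and point values of \<open>u\<close> and its first derivative make sense.\<close>
definition H2_per :: "(real \<Rightarrow> real) set" where
  "H2_per = {u. per1 u \<and> continuous_on UNIV u \<and> u \<in> L2_T \<and>
                (\<exists>g. is_weak_deriv 1 u g) \<and> (\<exists>h. is_weak_deriv 2 u h)}"

definition H2_per_odd :: "(real \<Rightarrow> real) set" where
  "H2_per_odd = {u \<in> H2_per. \<forall>x. u (- x) = - u x}"

definition K_fun :: "(real \<Rightarrow> real) \<Rightarrow> real" where
  "K_fun u = 1/2 * (LINT x:Tcircle|lborel. (u x)\<^sup>2)"

definition E_fun :: "(real \<Rightarrow> real) \<Rightarrow> real" where
  "E_fun u = 1/2 * (LINT x:Tcircle|lborel. (weak_deriv 1 u x)\<^sup>2)"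

definition R_fun :: "(real \<Rightarrow> real) \<Rightarrow> real" where
  "R_fun u = - (LINT x:Tcircle|lborel. (weak_deriv 2 u x)\<^sup>2 + (weak_deriv 1 u x) ^ 3)"

definition is_constrained_max :: "real \<Rightarrow> (real \<Rightarrow> real) \<Rightarrow> bool" where
  "is_constrained_max \<E> u \<longleftrightarrow> u \<in> H2_per \<and> E_fun u = \<E> \<and>
     (\<forall>v \<in> H2_per. E_fun v = \<E> \<longrightarrow> R_fun v \<le> R_fun u)"

definition odd_maximizer :: "real \<Rightarrow> (real \<Rightarrow> real) \<Rightarrow> bool" where
  "odd_maximizer \<E> u \<longleftrightarrow> is_constrained_max \<E> u \<and> u \<in> H2_per_odd \<and>
     (\<exists>D<0. (u has_real_derivative D) (at 0))"

text \<open>\<open>A = O(B)\<close> in the supremum norm along the filter \<open>F\<close>, for a family \<open>A p\<close> of functions on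
  the circle; the almost-everywhere bound says that the \<open>L\<^sup>\<infinity>\<close> norm of \<open>A p\<close> is
  at most \<open>C * \<bar>B p\<bar>\<close>.\<close>
definition bigo_Linf :: "'p filter \<Rightarrow> ('p \<Rightarrow> real \<Rightarrow> real) \<Rightarrow> ('p \<Rightarrow> real) \<Rightarrow> bool" where
  "bigo_Linf F A B \<longleftrightarrow>
     (\<exists>C. \<forall>\<^sub>F p in F. AE x\<in>Tcircle in lborel. \<bar>A p x\<bar> \<le> C * \<bar>B p\<bar>)"

end

(*
  In terms of w = u_x one minimizes the integral of w_x^2 + w^3 over functions of mean zero with
  prescribed L^2 norm.  The functional is coercive on the constraint set; along a minimizing
  sequence Arzela-Ascoli gives uniform convergence of w, and the parallelogram law makes the
  derivatives Cauchy in L^2, so a minimizer exists.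

  A minimizer is smooth and solves w'' = 3/2 w^2 + beta w + gamma.  Up to affine changes of x and w, a
  nonconstant periodic solution is determined by one modulus in (0,1), and the lattice sum
  S_L(y) = sum_j sech^2(y - j L) gives a solution -4 S_L whose modulus takes every value in (0,1) as
  L varies: it is continuous in L and tends to 0 and 1 at the two ends.  Stretching w(x/n) lowers the
  functional, so a minimizer has minimal period 1, and therefore it is a translate of
  w_k(x) = 8 k - 4 k^2 S_k(k x).

  Integrating the differential equation gives an explicit formula for E as a function of k, which is
  eventually strictly increasing.  Hence k is unique for large E, and oddness of u with u'(0) < 0 fixes
  the translation, because w_k(1/2) > 0.  The expansions follow from sech^2 y <= S_k(y), with an
  exponentially small difference.
*)

theory Submission
  imports Defs "HOL-Complex_Analysis.Great_Picard" "HOL-Probability.Probability_Measure"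
    "HOL-Real_Asymp.Real_Asymp" "HOL-Library.Nat_Bijection"
begin

section \<open>Sobolev functions on the circle\<close>

text \<open>Period and energy of a cnoidal wave are usually elliptic integrals in the modulus, which
  makes monotonicity in a parameter hard to read off. Periodizing \<open>sech2\<close> avoids them:
  the product of two translates of \<open>sech2\<close> is a linear combination of these translates
  and of a difference of \<open>tanh\<close>. The square of the lattice sum can therefore be
  resummed, and telescoping leaves a quadratic relation whose coefficients \<open>cnA L\<close>,
  \<open>cnB L\<close> do not depend on the point. This makes the lattice sum a solution, and it
  later gives the energy as a cubic polynomial in \<open>k\<close> plus a rapidly decaying series.
  The price is that the series does not show, for small \<open>L\<close>, that the sum is
  nonconstant, that \<open>L\<close> is its minimal period, or where its extrema lie. These facts
  come from the differential equation instead: solutions \<open>f\<close> and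
  \<open>c + a * f\<close> with \<open>a\<close> other than 0 and 1 must be constant, and a
  continuous quantity without zeros keeps the sign that it has at one large \<open>L\<close>.
  Lattice spacing and spatial scale of the maximizer are the same number \<open>k\<close> because 1
  is the minimal period both of the minimizer and of the rescaled lattice sum.\<close>

definition TT :: "real set" where "TT = Tcircle"

text \<open>The period has length one, so this restriction of Lebesgue measure is a probability
  measure: constants integrate to themselves and the mean of a function is its integral.\<close>

definition mT :: "real measure" where
  "mT = restrict_space lborel TT"

lemma TT_iff: "x \<in> TT \<longleftrightarrow> -1/2 \<le> x \<and> x \<le> 1/2"
  by (simp add: TT_def)

lemma compact_TT [simp]: "compact TT"
  by (simp add: TT_def)

lemma TT_lborel [measurable, simp]: "TT \<in> sets lborel" "TT \<in> sets borel"
  by (auto simp: TT_def)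

lemma space_mT: "space mT = TT"
  by (simp add: space_restrict_space mT_def)

lemma prob_space_mT: "prob_space mT"
  by (rule prob_spaceI) (simp add: space_restrict_space emeasure_restrict_space mT_def TT_def)

interpretation mT: prob_space mT
  by (rule prob_space_mT)

lemma set_integrable_T_iff: "set_integrable lborel Tcircle f \<longleftrightarrow> integrable mT f" for f :: "real \<Rightarrow> real"
  unfolding set_integrable_def mT_def TT_def by (subst integrable_restrict_space) auto

lemma set_integral_T_eq: "(LINT x:Tcircle|lborel. f x) = integral\<^sup>L mT f" for f :: "real \<Rightarrow> real"
  unfolding set_lebesgue_integral_def mT_def TT_def by (subst integral_restrict_space) auto

lemma set_measurable_T_iff:
  "set_borel_measurable lborel Tcircle f \<longleftrightarrow> f \<in> borel_measurable mT" for f :: "real \<Rightarrow> real"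
  unfolding set_borel_measurable_def mT_def TT_def by (subst borel_measurable_restrict_space_iff) auto

lemma L2_T_iff: "f \<in> L2_T \<longleftrightarrow> f \<in> borel_measurable mT \<and> integrable mT (\<lambda>x. (f x)\<^sup>2)"
  unfolding L2_T_def mem_Collect_eq set_integrable_T_iff set_measurable_T_iff ..

lemma continuous_measurable_mT:
  fixes f :: "real \<Rightarrow> real"
  assumes "continuous_on TT f"
  shows "f \<in> borel_measurable mT"
proof -
  have "f \<in> borel_measurable (restrict_space borel TT)"
    by (rule borel_measurable_continuous_on_restrict[OF assms])
  then show ?thesis
    unfolding mT_def measurable_def by (simp add: sets_restrict_space space_restrict_space)
qed

lemma bounded_integrable_mT:
  fixes f :: "real \<Rightarrow> real"
  assumes "f \<in> borel_measurable mT" "\<And>x. x \<in> TT \<Longrightarrow> \<bar>f x\<bar> \<le> B"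
  shows "integrable mT f"
  by (rule mT.integrable_const_bound[of _ B]) (use assms in \<open>auto simp: space_mT intro!: AE_I2\<close>)

lemma continuous_bounded_T:
  fixes f :: "real \<Rightarrow> real"
  assumes "continuous_on TT f"
  obtains B where "B > 0" "\<And>x. x \<in> TT \<Longrightarrow> \<bar>f x\<bar> \<le> B"
proof -
  have "compact (f ` TT)"
    using assms by (intro compact_continuous_image) auto
  then obtain B where "\<forall>y\<in>f ` TT. norm y \<le> B"
    using compact_imp_bounded bounded_iff by blast
  then show thesis
    by (intro that[of "\<bar>B\<bar> + 1"]) force+
qed

lemma continuous_integrable_mT:
  fixes f :: "real \<Rightarrow> real"
  assumes "continuous_on TT f"
  shows "integrable mT f"
proof -
  obtain B where "\<And>x. x \<in> TT \<Longrightarrow> \<bar>f x\<bar> \<le> B"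
    using continuous_bounded_T[OF assms] by metis
  then show ?thesis
    by (intro bounded_integrable_mT continuous_measurable_mT assms)
qed

lemma integrable_mult_continuous_mT:
  fixes f g :: "real \<Rightarrow> real"
  assumes "integrable mT f" "continuous_on TT g"
  shows "integrable mT (\<lambda>x. f x * g x)"
proof -
  obtain B where B: "B > 0" "\<And>x. x \<in> TT \<Longrightarrow> \<bar>g x\<bar> \<le> B"
    using continuous_bounded_T[OF assms(2)] by metis
  have [measurable]: "g \<in> borel_measurable mT" "f \<in> borel_measurable mT"
    using assms continuous_measurable_mT by auto
  show ?thesis
  proof (rule Bochner_Integration.integrable_bound[of _ "\<lambda>x. B * f x"])
    show "AE x in mT. norm (f x * g x) \<le> norm (B * f x)"
      using B by (intro AE_I2) (auto simp: space_mT abs_mult mult.commute[of B] intro!: mult_left_mono)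
  qed (use assms in auto)
qed

lemma L2_imp_integrable:
  assumes "h \<in> L2_T" shows "integrable mT h"
proof (rule Bochner_Integration.integrable_bound[of _ "\<lambda>x. 1 + (h x)\<^sup>2"])
  show "AE x in mT. norm (h x) \<le> norm (1 + (h x)\<^sup>2)"
  proof (intro AE_I2)
    fix x
    have "0 \<le> (\<bar>h x\<bar> - 1)\<^sup>2" by simp
    then show "norm (h x) \<le> norm (1 + (h x)\<^sup>2)"
      by (simp add: power2_eq_square algebra_simps)
  qed
qed (use assms in \<open>auto simp: L2_T_iff\<close>)

lemma continuous_L2:
  assumes "continuous_on TT f" shows "f \<in> L2_T"
  unfolding L2_T_iff using assms
  by (auto intro!: continuous_measurable_mT continuous_integrable_mT continuous_intros)

lemma L2_lincomb:
  assumes "f \<in> L2_T" "g \<in> L2_T"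
  shows "(\<lambda>x. a * f x + b * g x) \<in> L2_T" "integrable mT (\<lambda>x. f x * g x)"
proof -
  have m[measurable]: "f \<in> borel_measurable mT" "g \<in> borel_measurable mT"
    and i: "integrable mT (\<lambda>x. (f x)\<^sup>2)" "integrable mT (\<lambda>x. (g x)\<^sup>2)"
    using assms by (auto simp: L2_T_iff)
  show fg: "integrable mT (\<lambda>x. f x * g x)"
  proof (rule Bochner_Integration.integrable_bound[of _ "\<lambda>x. (f x)\<^sup>2 + (g x)\<^sup>2"])
    show "AE x in mT. norm (f x * g x) \<le> norm ((f x)\<^sup>2 + (g x)\<^sup>2)"
    proof (intro AE_I2)
      fix x
      have "0 \<le> (\<bar>f x\<bar> - \<bar>g x\<bar>)\<^sup>2" by simp
      then have "2 * \<bar>f x * g x\<bar> \<le> (f x)\<^sup>2 + (g x)\<^sup>2"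
        by (simp add: power2_diff abs_mult)
      then show "norm (f x * g x) \<le> norm ((f x)\<^sup>2 + (g x)\<^sup>2)" by simp
    qed
  qed (use i in auto)
  have "(\<lambda>x. (a * f x + b * g x)\<^sup>2) = (\<lambda>x. a\<^sup>2 * (f x)\<^sup>2 + b\<^sup>2 * (g x)\<^sup>2 + (2 * a * b) * (f x * g x))"
    by (auto simp: power2_eq_square algebra_simps)
  then show "(\<lambda>x. a * f x + b * g x) \<in> L2_T"
    unfolding L2_T_iff using i fg by auto
qed

lemma AE_mT_neq: "AE t in mT. t \<noteq> (x::real)"
  using AE_lborel_singleton[of x] unfolding mT_def by (subst AE_restrict_space_iff) auto

text \<open>The integral from -1/2 to \<open>x\<close> is written as an integral over the whole
  period against the indicator of \<open>{..x}\<close>. Primitives keep this form throughout,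
  because it is the one to which Fubini applies directly.\<close>

lemma integral_mT_FTC:
  fixes F f :: "real \<Rightarrow> real"
  assumes "\<And>x. (F has_real_derivative f x) (at x)" "continuous_on UNIV f" "x \<in> TT"
  shows "(LINT t|mT. indicat_real {..x} t * f t) = F x - F (-1/2)"
proof -
  have "(LINT t|mT. indicat_real {..x} t * f t) = (LINT t|lborel. indicat_real {-1/2..x} t * f t)"
    using assms(3)
    unfolding mT_def by (subst integral_restrict_space)
       (auto intro!: Bochner_Integration.integral_cong simp: indicator_def TT_iff)
  also have "\<dots> = F x - F (-1/2)"
    using assms unfolding TT_iff
    by (subst integral_FTC_Icc[where F=F, simplified, of "-1/2" x f])
       (auto intro: continuous_on_subset simp: has_real_derivative_iff_has_vector_derivative
          intro: has_vector_derivative_at_within)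
  finally show ?thesis .
qed

lemma integral_mT_FTC':
  fixes F f :: "real \<Rightarrow> real"
  assumes "\<And>x. (F has_real_derivative f x) (at x)" "continuous_on UNIV f"
  shows "(LINT t|mT. f t) = F (1/2) - F (-1/2)"
proof -
  have "(LINT t|mT. f t) = (LINT t|mT. indicat_real {..1/2} t * f t)"
    by (intro Bochner_Integration.integral_cong) (auto simp: space_mT TT_iff)
  then show ?thesis using integral_mT_FTC[OF assms, of "1/2"] by (simp add: TT_iff)
qed

text \<open>Integration by parts for primitives of merely integrable functions. The two terms
  integrate \<open>h t * g x\<close> over the triangles \<open>t <= x\<close> and
  \<open>x <= t\<close>; together these cover the square, and they overlap only in the diagonal, a
  null set.\<close>

lemma integral_mT_indicator_Fubini:
  fixes g h :: "real \<Rightarrow> real"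
  assumes g: "integrable mT g" and h: "integrable mT h"
  shows "(LINT x|mT. (LINT t|mT. indicat_real {..x} t * h t) * g x) +
         (LINT x|mT. h x * (LINT t|mT. indicat_real {..x} t * g t))
         = integral\<^sup>L mT h * integral\<^sup>L mT g"
proof -
  interpret pair_sigma_finite mT mT
    by (intro pair_sigma_finite.intro mT.sigma_finite_measure_axioms)
  have gm[measurable]: "g \<in> borel_measurable mT" and hm[measurable]: "h \<in> borel_measurable mT"
    using g h by auto
  have idm[measurable]: "(\<lambda>x. x) \<in> borel_measurable mT"
    by (simp add: measurable_restrict_space1 mT_def)
  have ab: "integrable (mT \<Otimes>\<^sub>M mT) (\<lambda>(x, t). h t * g x)"
    by (rule Fubini_integrable) (use g h in \<open>auto simp: abs_mult\<close>)
  have i1: "integrable (mT \<Otimes>\<^sub>M mT) (\<lambda>(x, t). (if t \<le> x then 1 else 0) * h t * g x)"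
    by (rule Bochner_Integration.integrable_bound[OF ab]) auto
  have i2: "integrable (mT \<Otimes>\<^sub>M mT) (\<lambda>(x, t). (if x \<le> t then 1 else 0) * h t * g x)"
    by (rule Bochner_Integration.integrable_bound[OF ab]) auto
  have A: "(LINT x|mT. (LINT t|mT. indicat_real {..x} t * h t) * g x)
    = (LINT x|mT. (LINT t|mT. (if t \<le> x then 1 else 0) * h t * g x))"
    by (auto intro!: Bochner_Integration.integral_cong simp: indicator_def
        simp flip: Bochner_Integration.integral_mult_left_zero)
  have B: "(LINT t|mT. h t * (LINT x|mT. indicat_real {..t} x * g x))
    = (LINT t|mT. (LINT x|mT. (if x \<le> t then 1 else 0) * h t * g x))"
    by (auto intro!: Bochner_Integration.integral_cong simp: indicator_def
        simp flip: Bochner_Integration.integral_mult_right_zero)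
  have B': "\<dots> = (LINT x|mT. (LINT t|mT. (if x \<le> t then 1 else 0) * h t * g x))"
    using Fubini_integral[OF i2] by simp
  have j1: "integrable mT (\<lambda>x. (LINT t|mT. (if t \<le> x then 1 else 0) * h t * g x))"
    using integrable_fst[OF i1] by simp
  have j2: "integrable mT (\<lambda>x. (LINT t|mT. (if x \<le> t then 1 else 0) * h t * g x))"
    using integrable_fst[OF i2] by simp
  have "(LINT t|mT. (if t \<le> x then 1 else 0) * h t * g x) + (LINT t|mT. (if x \<le> t then 1 else 0) * h t * g x)
     = integral\<^sup>L mT h * g x" if x: "x \<in> TT" for x
  proof -
    have k1: "integrable mT (\<lambda>t. (if t \<le> x then 1 else 0) * h t * g x)"
      by (rule Bochner_Integration.integrable_bound[of _ "\<lambda>t. h t * g x"]) (use h in auto)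
    have k2: "integrable mT (\<lambda>t. (if x \<le> t then 1 else 0) * h t * g x)"
      by (rule Bochner_Integration.integrable_bound[of _ "\<lambda>t. h t * g x"]) (use h in auto)
    have "(LINT t|mT. (if t \<le> x then 1 else 0) * h t * g x) + (LINT t|mT. (if x \<le> t then 1 else 0) * h t * g x)
      = (LINT t|mT. (if t \<le> x then 1 else 0) * h t * g x + (if x \<le> t then 1 else 0) * h t * g x)"
      using k1 k2 by simp
    also have "\<dots> = (LINT t|mT. h t * g x)"
    proof (rule integral_cong_AE)
      show "AE t in mT. (if t \<le> x then 1 else 0) * h t * g x + (if x \<le> t then 1 else 0) * h t * g x = h t * g x"
        using AE_mT_neq[of x] by (rule AE_mp) (auto intro!: AE_I2)
    qed measurable
    finally show ?thesis by simp
  qed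
  then have "(LINT x|mT. (LINT t|mT. (if t \<le> x then 1 else 0) * h t * g x) + (LINT t|mT. (if x \<le> t then 1 else 0) * h t * g x))
     = (LINT x|mT. integral\<^sup>L mT h * g x)"
    by (intro Bochner_Integration.integral_cong) (auto simp: space_mT)
  then show ?thesis
    unfolding A B B' using j1 j2 by simp
qed

section \<open>Test functions and the fundamental lemma of the calculus of variations\<close>

text \<open>Trigonometric polynomials; by Stone-Weierstrass there are enough of them among the test functions.\<close>
definition circle_poly :: "(real \<Rightarrow> real) set" where
  "circle_poly = {\<lambda>x. p (cis (2 * pi * x)) |p. real_polynomial_function p}"

text \<open>Induction on the polynomial. In the linear case the derivative of
  \<open>f (cis (2 * pi * x))\<close> is again a linear form of the point on the circle, namely
  \<open>f\<close> composed with multiplication by \<open>2 * pi * \<i>\<close>. Closure under one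
  derivative gives smoothness of all orders.\<close>

lemma circle_poly_deriv:
  assumes "\<phi> \<in> circle_poly"
  shows "\<exists>\<psi>\<in>circle_poly. \<forall>x. (\<phi> has_real_derivative \<psi> x) (at x)"
proof -
  obtain p where p: "real_polynomial_function p" and \<phi>: "\<phi> = (\<lambda>x. p (cis (2 * pi * x)))"
    using assms by (auto simp: circle_poly_def)
  have "\<exists>q. real_polynomial_function q \<and>
      (\<forall>x. ((\<lambda>x. p (cis (2 * pi * x))) has_real_derivative q (cis (2 * pi * x))) (at x))"
    using p
  proof induction
    case (linear f)
    note bl = this
    interpret bounded_linear f by fact
    have "bounded_linear (\<lambda>z. f ((2 * pi * \<i>) * z))"
      by (rule bounded_linear_compose[OF bl]) (rule bounded_linear_mult_right)
    moreover have "((\<lambda>x. f (cis (2 * pi * x))) has_real_derivative f ((2 * pi * \<i>) * cis (2 * pi * x))) (at x)" for x :: real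
      unfolding has_real_derivative_iff_has_vector_derivative
    proof (rule has_vector_derivative)
      show "((\<lambda>x. cis (2 * pi * x)) has_vector_derivative (2 * pi * \<i>) * cis (2 * pi * x)) (at x)"
        unfolding has_vector_derivative_def
        by (rule derivative_eq_intros refl | simp)+ (auto simp: scaleR_conv_of_real algebra_simps)
    qed
    ultimately show ?case by blast
  next
    case (const c)
    show ?case by (intro exI[of _ "\<lambda>_. 0"]) auto
  next
    case (add f g)
    then obtain f' g' where fg: "real_polynomial_function f'" "real_polynomial_function g'"
      "\<And>x. ((\<lambda>x. f (cis (2 * pi * x))) has_real_derivative f' (cis (2 * pi * x))) (at x)"
      "\<And>x. ((\<lambda>x. g (cis (2 * pi * x))) has_real_derivative g' (cis (2 * pi * x))) (at x)"
      by blast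
    show ?case
      by (intro exI[of _ "\<lambda>z. f' z + g' z"] conjI allI DERIV_add fg real_polynomial_function.intros)
  next
    case (mult f g)
    then obtain f' g' where fg: "real_polynomial_function f'" "real_polynomial_function g'"
      "\<And>x. ((\<lambda>x. f (cis (2 * pi * x))) has_real_derivative f' (cis (2 * pi * x))) (at x)"
      "\<And>x. ((\<lambda>x. g (cis (2 * pi * x))) has_real_derivative g' (cis (2 * pi * x))) (at x)"
      by blast
    show ?case
      by (intro exI[of _ "\<lambda>z. f' z * g z + g' z * f z"] conjI allI DERIV_mult fg
          real_polynomial_function.intros mult)
  qed
  then obtain q where "real_polynomial_function q"
      "\<forall>x. ((\<lambda>x. p (cis (2 * pi * x))) has_real_derivative q (cis (2 * pi * x))) (at x)" by blast
  then show ?thesis unfolding \<phi> circle_poly_def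
    by (intro bexI[of _ "\<lambda>x. q (cis (2 * pi * x))"]) auto
qed

lemma test_fun_circle_poly:
  assumes "\<phi> \<in> circle_poly" shows "test_fun \<phi>"
proof -
  have "(deriv ^^ j) \<phi> \<in> circle_poly" for j
  proof (induction j)
    case (Suc j)
    then obtain \<psi> where "\<psi> \<in> circle_poly" "\<forall>x. ((deriv ^^ j) \<phi> has_real_derivative \<psi> x) (at x)"
      using circle_poly_deriv by blast
    then have "(deriv ^^ Suc j) \<phi> = \<psi>" by (auto intro!: ext DERIV_imp_deriv)
    then show ?case using \<open>\<psi> \<in> circle_poly\<close> by simp
  qed (use assms in simp)
  then have "(deriv ^^ j) \<phi> differentiable (at x)" for j x
    using circle_poly_deriv real_differentiable_def by blast
  moreover have "per1 \<phi>"
  proof -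
    have "cis (2 * pi * (x + 1)) = cis (2 * pi * x)" for x
      using cis_mult[of "2 * pi * x" "2 * pi"] by (simp add: distrib_left)
    then show ?thesis using assms by (auto simp: per1_def circle_poly_def)
  qed
  ultimately show ?thesis by (simp add: test_fun_def)
qed

lemma test_funD:
  assumes "test_fun \<phi>"
  shows "((deriv ^^ j) \<phi> has_real_derivative (deriv ^^ Suc j) \<phi> x) (at x)"
    "continuous_on A ((deriv ^^ j) \<phi>)" "per1 ((deriv ^^ j) \<phi>)"
proof -
  show D: "((deriv ^^ j) \<phi> has_real_derivative (deriv ^^ Suc j) \<phi> x) (at x)" for j x
  proof -
    have "(deriv ^^ j) \<phi> differentiable (at x)" using assms by (auto simp: test_fun_def)
    then show ?thesis by (simp add: DERIV_deriv_iff_real_differentiable)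
  qed
  show "continuous_on A ((deriv ^^ j) \<phi>)"
    using D by (intro continuous_at_imp_continuous_on ballI DERIV_isCont)
  show "per1 ((deriv ^^ j) \<phi>)"
  proof (induction j)
    case (Suc j)
    have "((deriv ^^ j) \<phi> has_real_derivative (deriv ^^ Suc j) \<phi> (x + 1)) (at x)" for x
    proof -
      have "((\<lambda>x. (deriv ^^ j) \<phi> (x + 1)) has_real_derivative (deriv ^^ Suc j) \<phi> (x + 1)) (at x)"
        using D[of j "x + 1"] by (simp add: DERIV_shift)
      then show ?thesis using Suc by (simp add: per1_def)
    qed
    then show ?case unfolding per1_def using D DERIV_unique by blast
  qed (use assms in \<open>simp add: test_fun_def\<close>)
qed

lemma test_fun_deriv: "test_fun \<phi> \<Longrightarrow> test_fun (deriv \<phi>)"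
  using test_funD(3)[of \<phi> 1] unfolding test_fun_def
  by (metis One_nat_def funpow_Suc_right funpow_simps_right(1) o_apply id_apply)

lemma test_fun_const: "test_fun (\<lambda>_. c)"
  by (rule test_fun_circle_poly) (auto simp: circle_poly_def intro!: exI[of _ "\<lambda>_. c"])

lemma integrable_mT_closed_arc:
  fixes A :: "complex set"
  assumes "integrable mT f" "closed A"
  shows "integrable mT (\<lambda>x. f x * indicat_real A (cis (2 * pi * x)))"
proof -
  have "(\<lambda>x. cis (2 * pi * x)) \<in> borel_measurable mT"
    unfolding mT_def
    by (intro measurable_restrict_space1) (simp add: borel_measurable_continuous_onI continuous_intros)
  moreover have "indicat_real A \<in> borel_measurable borel"
    by (intro borel_measurable_indicator borel_closed assms(2))
  ultimately have [measurable]: "(\<lambda>x. indicat_real A (cis (2 * pi * x))) \<in> borel_measurable mT"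
    by (rule measurable_compose)
  have [measurable]: "f \<in> borel_measurable mT" using assms by auto
  show ?thesis
    by (rule Bochner_Integration.integrable_bound[OF assms(1)]) (measurable, auto intro!: AE_I2 simp: indicator_def)
qed

text \<open>Orthogonality is enlarged in stages: from trigonometric polynomials to continuous
  functions on the circle (uniform approximation), to closed subsets of the circle (distance
  cutoffs), to half-lines, and to all Borel sets, since half-lines form an intersection-stable
  generator. A density that integrates to 0 over every set vanishes almost everywhere.\<close>

lemma fundamental_lemma:
  assumes f: "integrable mT f" and orth: "\<And>\<psi>. test_fun \<psi> \<Longrightarrow> (LINT x|mT. f x * \<psi> x) = 0"
  shows "AE x in mT. f x = 0"
proof -
  have [measurable]: "f \<in> borel_measurable mT" using f by auto
  have c1: "continuous_on A (\<lambda>x. cis (2 * pi * x))" for A by (intro continuous_intros)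
  have cont: "(LINT x|mT. f x * g (cis (2 * pi * x))) = 0"
    if g: "continuous_on UNIV g" for g :: "complex \<Rightarrow> real"
  proof -
    define N where "N = (LINT x|mT. \<bar>f x\<bar>)"
    have N: "N \<ge> 0" by (auto simp: N_def)
    have cg: "continuous_on TT (\<lambda>x. g (cis (2 * pi * x)))"
      using g by (intro continuous_on_compose2[OF g c1]) auto
    have bd: "\<bar>LINT x|mT. f x * g (cis (2 * pi * x))\<bar> \<le> e" if "e > 0" for e
    proof -
      define d where "d = e / (N + 1)"
      have "d > 0" using that N by (simp add: d_def)
      then obtain p where p: "real_polynomial_function p" "\<And>z. z \<in> sphere 0 1 \<Longrightarrow> \<bar>g z - p z\<bar> < d"
        using Stone_Weierstrass_real_polynomial_function[of "sphere 0 1" g d] g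
        by (metis compact_sphere continuous_on_subset subset_UNIV)
      define \<psi> where "\<psi> x = p (cis (2 * pi * x))" for x
      have "test_fun \<psi>"
        using p by (intro test_fun_circle_poly) (unfold circle_poly_def \<psi>_def, blast)
      then have 0: "(LINT x|mT. f x * \<psi> x) = 0" by (rule orth)
      have cp: "continuous_on TT \<psi>" using test_funD(2)[OF \<open>test_fun \<psi>\<close>, of _ 0] by simp
      have "(LINT x|mT. f x * g (cis (2 * pi * x)))
        = (LINT x|mT. f x * g (cis (2 * pi * x))) - (LINT x|mT. f x * \<psi> x)"
        using 0 by simp
      also have "\<dots> = (LINT x|mT. f x * g (cis (2 * pi * x)) - f x * \<psi> x)"
        using integrable_mult_continuous_mT[OF f cg] integrable_mult_continuous_mT[OF f cp] by simp
      also have "\<bar>\<dots>\<bar> \<le> (LINT x|mT. \<bar>f x\<bar> * d)"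
      proof (rule order_trans[OF integral_abs_bound integral_mono])
        fix x
        have "\<bar>g (cis (2 * pi * x)) - \<psi> x\<bar> \<le> d" using p(2)[of "cis (2 * pi * x)"] by (simp add: \<psi>_def)
        then show "\<bar>f x * g (cis (2 * pi * x)) - f x * \<psi> x\<bar> \<le> \<bar>f x\<bar> * d"
          by (simp add: right_diff_distrib[symmetric] abs_mult mult_left_mono)
      qed (use integrable_mult_continuous_mT[OF f cg] integrable_mult_continuous_mT[OF f cp] f in auto)
      also have "\<dots> = N * d" by (simp add: N_def)
      also have "\<dots> \<le> e" using that N by (simp add: d_def field_simps)
      finally show ?thesis .
    qed
    show ?thesis
    proof (rule ccontr)
      assume "(LINT x|mT. f x * g (cis (2 * pi * x))) \<noteq> 0"
      then show False using bd[of "\<bar>LINT x|mT. f x * g (cis (2 * pi * x))\<bar> / 2"] by linarith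
    qed
  qed
  have arc: "(LINT x|mT. f x * indicat_real A (cis (2 * pi * x))) = 0" if A: "closed A" for A
  proof (cases "A = {}")
    case False
    \<comment> \<open>The cutoff is 1 on \<open>A\<close> and tends to 0 off \<open>A\<close>
      because \<open>A\<close> is closed. The empty set is split off because \<open>infdist\<close>
      to it is 0 by convention.\<close>
    define g where "g n z = max 0 (1 - real n * infdist z A)" for n and z :: complex
    have gc: "continuous_on UNIV (g n)" for n unfolding g_def by (intro continuous_intros)
    have lim: "(\<lambda>n. g n z) \<longlonglongrightarrow> indicat_real A z" for z
    proof (cases "z \<in> A")
      case False
      then have "infdist z A > 0"
        using \<open>A \<noteq> {}\<close> A in_closed_iff_infdist_zero infdist_nonneg by (metis order_less_le)
      then have "\<forall>\<^sub>F n in sequentially. g n z = 0"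
        using reals_Archimedean3 unfolding g_def eventually_sequentially
      proof -
        obtain N :: nat where "1 < real N * infdist z A" using \<open>infdist z A > 0\<close> reals_Archimedean3 by blast
        then have "1 < real n * infdist z A" if "n \<ge> N" for n
          using that \<open>infdist z A > 0\<close> by (smt (verit) mult_right_mono of_nat_mono)
        then show "\<exists>N. \<forall>n\<ge>N. max 0 (1 - real n * infdist z A) = 0" by (intro exI[of _ N]) auto
      qed
      then show ?thesis using False by (auto intro: tendsto_eventually)
    qed (simp add: g_def)
    have m1[measurable]: "(\<lambda>x. g n (cis (2 * pi * x))) \<in> borel_measurable mT" for n
      by (intro continuous_measurable_mT continuous_on_compose2[OF gc c1]) auto
    have m2[measurable]: "(\<lambda>x. f x * indicat_real A (cis (2 * pi * x))) \<in> borel_measurable mT"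
      using integrable_mT_closed_arc[OF f A] by auto
    have "(\<lambda>n. LINT x|mT. f x * g n (cis (2 * pi * x))) \<longlonglongrightarrow>
        (LINT x|mT. f x * indicat_real A (cis (2 * pi * x)))"
    proof (rule integral_dominated_convergence[where w="\<lambda>x. \<bar>f x\<bar>"])
      show "AE x in mT. norm (f x * g n (cis (2 * pi * x))) \<le> \<bar>f x\<bar>" for n
      proof (rule AE_I2)
        fix x
        have "\<bar>g n (cis (2 * pi * x))\<bar> \<le> 1" by (auto simp: g_def infdist_nonneg)
        then show "norm (f x * g n (cis (2 * pi * x))) \<le> \<bar>f x\<bar>"
          using mult_left_mono[of _ 1 "\<bar>f x\<bar>"] by (simp add: abs_mult)
      qed
      show "AE x in mT. (\<lambda>n. f x * g n (cis (2 * pi * x))) \<longlonglongrightarrow> f x * indicat_real A (cis (2 * pi * x))"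
        by (intro AE_I2 tendsto_mult lim tendsto_const)
    qed (use f in auto)
    then show ?thesis using cont[OF gc] by (simp add: LIMSEQ_const_iff)
  qed simp
  \<comment> \<open>The interval stays strictly inside the period: -1/2 and 1/2 have the same image
    on the circle, and only away from them does membership of \<open>cis (2 * pi * x)\<close> in the
    image arc force \<open>x\<close> into \<open>{a..b}\<close>.\<close>
  have arcI: "(LINT x|mT. f x * indicat_real {a..b} x) = 0" if ab: "-1/2 < a" "b < 1/2" for a b
  proof -
    define A where "A = (\<lambda>x. cis (2 * pi * x)) ` {a..b}"
    have "compact A" unfolding A_def by (intro compact_continuous_image c1) auto
    then have "closed A" by (rule compact_imp_closed)
    have "indicat_real A (cis (2 * pi * x)) = indicat_real {a..b} x" if x: "x \<in> TT" for x
    proof -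
      have key: "x \<in> {a..b}" if "y \<in> {a..b}" "cis (2 * pi * x) = cis (2 * pi * y)" for y
      proof -
        have "cis (2 * pi * (x - y)) = 1"
          using that(2) cis_divide[of "2 * pi * x" "2 * pi * y"] by (simp add: right_diff_distrib)
        then have "cos (2 * pi * (x - y)) = 1" by (metis cis.sel(1) one_complex.sel(1))
        then obtain n :: int where "2 * pi * (x - y) = of_int n * 2 * pi"
          using cos_one_2pi_int by blast
        then have "(2 * pi) * (x - y) = (2 * pi) * of_int n" by (simp only: mult.assoc mult.commute mult.left_commute)
        then have "x - y = of_int n" using pi_neq_zero by (metis mult_cancel_left mult_eq_0_iff zero_neq_numeral)
        moreover have "\<bar>x - y\<bar> < 1" using x that(1) ab by (auto simp: TT_iff)
        ultimately have "n = 0" by linarith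
        then show ?thesis using \<open>x - y = of_int n\<close> that(1) by simp
      qed
      have "cis (2 * pi * x) \<in> A \<longleftrightarrow> x \<in> {a..b}"
      proof
        assume "cis (2 * pi * x) \<in> A"
        then show "x \<in> {a..b}" unfolding A_def using key by (elim imageE)
      qed (unfold A_def, rule imageI)
      then show ?thesis unfolding indicator_def by (simp only:)
    qed
    then have "(LINT x|mT. f x * indicat_real {a..b} x) = (LINT x|mT. f x * indicat_real A (cis (2 * pi * x)))"
      by (intro Bochner_Integration.integral_cong) (auto simp: space_mT)
    then show ?thesis using arc[OF \<open>closed A\<close>] by simp
  qed
  have tot: "(LINT x|mT. f x) = 0" using orth[OF test_fun_const[of 1]] by simp
  have idm[measurable]: "(\<lambda>x. x) \<in> borel_measurable mT"
    by (simp add: measurable_restrict_space1 mT_def)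
  have le: "(LINT x|mT. indicat_real {..b} x * f x) = 0" for b
  proof (cases "b < 1/2")
    case True
    \<comment> \<open>The intervals \<open>{a n..b}\<close> exhaust the half-line within the period
      except for the point -1/2, which is a null set.\<close>
    define a where "a n = -1/2 + 1 / (real n + 1)" for n
    have "(\<lambda>n. LINT x|mT. f x * indicat_real {a n..b} x) \<longlonglongrightarrow> (LINT x|mT. f x * indicat_real {..b} x)"
    proof (rule integral_dominated_convergence[where w="\<lambda>x. \<bar>f x\<bar>"])
      have lim: "(\<lambda>n. indicat_real {a n..b} x) \<longlonglongrightarrow> indicat_real {..b} x" if x: "x \<in> TT" "x \<noteq> -1/2" for x
      proof (rule tendsto_eventually)
        have "x > -1/2" using x by (auto simp: TT_iff)
        moreover have "a \<longlonglongrightarrow> -1/2" unfolding a_def by real_asymp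
        ultimately have "\<forall>\<^sub>F n in sequentially. a n < x" by (simp add: order_tendstoD(2))
        then show "\<forall>\<^sub>F n in sequentially. indicat_real {a n..b} x = indicat_real {..b} x"
          by eventually_elim (auto simp: indicator_def)
      qed
      show "AE x in mT. (\<lambda>n. f x * indicat_real {a n..b} x) \<longlonglongrightarrow> f x * indicat_real {..b} x"
      proof (rule AE_mp[OF AE_mT_neq[of "-1/2"]], intro AE_I2 impI tendsto_mult tendsto_const)
        fix x assume "x \<in> space mT" "x \<noteq> -1/2"
        then show "(\<lambda>n. indicat_real {a n..b} x) \<longlonglongrightarrow> indicat_real {..b} x"
          using lim unfolding space_mT by blast
      qed
      have [measurable]: "(\<lambda>x. indicat_real {c..b} x) \<in> borel_measurable mT" "(\<lambda>x. indicat_real {..b} x) \<in> borel_measurable mT" for c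
        unfolding mT_def by (intro measurable_restrict_space1, simp)+
      show "(\<lambda>x. f x * indicat_real {..b} x) \<in> borel_measurable mT"
        "(\<lambda>x. f x * indicat_real {a n..b} x) \<in> borel_measurable mT" for n by measurable
      show "AE x in mT. norm (f x * indicat_real {a n..b} x) \<le> \<bar>f x\<bar>" for n
        by (intro AE_I2) (simp add: indicator_def)
    qed (use f in simp)
    moreover have "(LINT x|mT. f x * indicat_real {a n..b} x) = 0" for n
      using True by (intro arcI) (auto simp: a_def)
    ultimately show ?thesis by (simp add: LIMSEQ_const_iff mult.commute)
  next
    case False
    then have "(LINT x|mT. indicat_real {..b} x * f x) = (LINT x|mT. f x)"
      by (intro Bochner_Integration.integral_cong) (auto simp: space_mT TT_iff)
    then show ?thesis using tot by simp
  qed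
  have im: "integrable mT (\<lambda>x. indicat_real B x * f x)" if "B \<in> sets borel" for B
  proof (rule Bochner_Integration.integrable_bound[OF f])
    have [measurable]: "(\<lambda>x. indicat_real B x) \<in> borel_measurable mT"
      by (rule measurable_compose[OF idm borel_measurable_indicator[OF that]])
    show "(\<lambda>x. indicat_real B x * f x) \<in> borel_measurable mT" by measurable
  qed (auto intro!: AE_I2 simp: indicator_def)
  have all: "(LINT x|mT. indicat_real B x * f x) = 0" if "B \<in> sets borel" for B
  proof -
    have "B \<in> sigma_sets UNIV (range (\<lambda>a::real. {..a}))"
      using that by (subst (asm) borel_eq_atMost) simp
    have stab: "Int_stable (range (\<lambda>a::real. {..a}))"
    proof (rule Int_stableI_image)
      show "\<exists>k\<in>UNIV. {..i} \<inter> {..j} = {..k}" for i j :: real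
        by (rule bexI[of _ "min i j"]) auto
    qed
    from stab Pow_UNIV[THEN equalityD2, THEN subset_trans[OF subset_UNIV]] \<open>B \<in> sigma_sets UNIV (range (\<lambda>a::real. {..a}))\<close> show ?thesis
    proof (induction rule: sigma_sets_induct_disjoint)
      case (basic A) then show ?case using le by auto
    next
      case empty show ?case by simp
    next
      case (compl A)
      then have "A \<in> sets borel" by (subst borel_eq_atMost) simp
      have "(LINT x|mT. indicat_real (UNIV - A) x * f x) = (LINT x|mT. f x - indicat_real A x * f x)"
        by (intro Bochner_Integration.integral_cong) (auto simp: indicator_def)
      then show ?case using tot compl im[OF \<open>A \<in> sets borel\<close>] f by simp
    next
      case (union A)
      have mA: "A i \<in> sets borel" for i using union by (subst borel_eq_atMost) auto
      have [measurable]: "(\<lambda>x. indicat_real (\<Union>i. A i) x * f x) \<in> borel_measurable mT"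
        using im[of "\<Union>i. A i"] mA by auto
      have [measurable]: "(\<lambda>x. indicat_real (\<Union>i<n. A i) x * f x) \<in> borel_measurable mT" for n
        using im[of "\<Union>i<n. A i"] mA by auto
      have "(\<lambda>n. LINT x|mT. indicat_real (\<Union>i<n. A i) x * f x) \<longlonglongrightarrow> (LINT x|mT. indicat_real (\<Union>i. A i) x * f x)"
      proof (rule integral_dominated_convergence[where w="\<lambda>x. \<bar>f x\<bar>"])
        have "(\<lambda>n. indicat_real (\<Union>i<n. A i) x) \<longlonglongrightarrow> indicat_real (\<Union>i. A i) x" for x
          by (rule LIMSEQ_indicator_UN)
        then show "AE x in mT. (\<lambda>n. indicat_real (\<Union>i<n. A i) x * f x) \<longlonglongrightarrow> indicat_real (\<Union>i. A i) x * f x"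
          by (intro AE_I2 tendsto_mult tendsto_const)
        show "AE x in mT. norm (indicat_real (\<Union>i<n. A i) x * f x) \<le> \<bar>f x\<bar>" for n
          by (intro AE_I2) (simp add: indicator_def)
        show "(\<lambda>x. indicat_real (\<Union>i. A i) x * f x) \<in> borel_measurable mT"
          "(\<lambda>x. indicat_real (\<Union>i<n. A i) x * f x) \<in> borel_measurable mT" for n by fact+
      qed (use f in simp)
      moreover have "(LINT x|mT. indicat_real (\<Union>i<n. A i) x * f x) = 0" for n
      proof -
        have "(LINT x|mT. indicat_real (\<Union>i<n. A i) x * f x) = (LINT x|mT. (\<Sum>i<n. indicat_real (A i) x * f x))"
        proof (rule Bochner_Integration.integral_cong)
          fix x
          have "indicat_real (\<Union>i<n. A i) x = (\<Sum>i<n. indicat_real (A i) x)"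
            using union(1) by (intro indicator_UN_disjoint) (auto simp: disjoint_family_on_def)
          then show "indicat_real (\<Union>i<n. A i) x * f x = (\<Sum>i<n. indicat_real (A i) x * f x)"
            by (simp add: sum_distrib_right)
        qed simp
        also have "\<dots> = (\<Sum>i<n. LINT x|mT. indicat_real (A i) x * f x)"
          using im[OF mA] by (intro Bochner_Integration.integral_sum) auto
        finally show ?thesis using union by simp
      qed
      ultimately show ?case by (simp add: LIMSEQ_const_iff)
    qed
  qed
  show ?thesis
  proof (rule mT.density_zero[OF f])
    fix A assume "A \<in> sets mT"
    then have "A \<in> sets borel" by (auto simp: mT_def sets_restrict_space)
    then show "set_lebesgue_integral mT A f = 0"
      using all[of A] by (simp add: set_lebesgue_integral_def)
  qed
qed

lemma continuous_TT_integral_square_0: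
  fixes f :: "real \<Rightarrow> real"
  assumes "continuous_on TT f" "(LINT x|mT. (f x)\<^sup>2) = 0" "x \<in> TT"
  shows "f x = 0"
proof -
  have c: "continuous_on Tcircle (\<lambda>x. (f x)\<^sup>2)" using assms(1) unfolding TT_def by (intro continuous_intros)
  have "integrable mT (\<lambda>x. (f x)\<^sup>2)" using assms(1) by (intro continuous_integrable_mT continuous_intros)
  then have "set_integrable lborel Tcircle (\<lambda>x. (f x)\<^sup>2)" by (simp only: set_integrable_T_iff)
  from set_borel_integral_eq_integral[OF this]
  have "((\<lambda>x. (f x)\<^sup>2) has_integral 0) (cbox (-1/2) (1/2))"
    unfolding set_integral_T_eq assms(2) cbox_interval by (metis integrable_integral)
  then have "(f x)\<^sup>2 = 0"
    using c assms(3) by (intro has_integral_0_cbox_imp_0) (auto simp: TT_iff box_real)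
  then show ?thesis by simp
qed

lemma test_fun_diff_const:
  assumes "test_fun \<psi>" shows "test_fun (\<lambda>x. \<psi> x - c)"
    "deriv (\<lambda>x. \<psi> x - c) = deriv \<psi>"
proof -
  have d: "(\<psi> has_real_derivative deriv \<psi> x) (at x)" for x using test_funD(1)[OF assms, of 0] by simp
  show e: "deriv (\<lambda>x. \<psi> x - c) = deriv \<psi>"
    by (rule ext, rule DERIV_imp_deriv) (use d in \<open>auto intro!: derivative_eq_intros\<close>)
  have "(deriv ^^ j) (\<lambda>x. \<psi> x - c) differentiable (at x)" for j x
  proof (cases j)
    case 0
    have "((\<lambda>x. \<psi> x - c) has_real_derivative deriv \<psi> x - 0) (at x)" using d by (intro DERIV_diff DERIV_const)
    with 0 show ?thesis unfolding real_differentiable_def by auto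
  next
    case (Suc k)
    then have "(deriv ^^ j) (\<lambda>x. \<psi> x - c) = (deriv ^^ j) \<psi>" by (simp add: funpow_Suc_right e del: funpow.simps)
    then show ?thesis using assms by (auto simp: test_fun_def)
  qed
  then show "test_fun (\<lambda>x. \<psi> x - c)" using assms by (auto simp: test_fun_def per1_def)
qed

lemma continuous_antiderivative:
  fixes f :: "real \<Rightarrow> real"
  assumes "continuous_on UNIV f"
  obtains F where "\<And>x. (F has_real_derivative f x) (at x)"
proof -
  have "continuous_on {-(\<bar>x\<bar>+1)..\<bar>x\<bar>+1} f" for x using assms continuous_on_subset by blast
  have vd: "((\<lambda>x. LBINT t=ereal 0..ereal x. f t) has_vector_derivative f x) (at x within {-(\<bar>x\<bar>+1)..\<bar>x\<bar>+1})" for x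
    by (rule interval_integral_FTC2) (use assms continuous_on_subset in auto)
  then have "((\<lambda>x. LBINT t=ereal 0..ereal x. f t) has_real_derivative f x) (at x)" for x
  proof -
    have "at x within {-(\<bar>x\<bar>+1)..\<bar>x\<bar>+1} = at x" by (rule at_within_Icc_at) linarith+
    then show ?thesis using vd[of x] unfolding has_real_derivative_iff_has_vector_derivative by simp
  qed
  then show thesis using that by blast
qed

lemma per1_antiderivative:
  fixes F f :: "real \<Rightarrow> real"
  assumes D: "\<And>x. (F has_real_derivative f x) (at x)" and "continuous_on UNIV f" "per1 f" "(LINT x|mT. f x) = 0"
  shows "per1 F"
proof -
  have "\<exists>c. \<forall>x. F (x + 1) - F x = c"
  proof -
    have "((\<lambda>x. F (x + 1) - F x) has_real_derivative 0) (at x)" for x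
    proof -
      have "((\<lambda>x. F (x + 1)) has_real_derivative f (x + 1)) (at x)"
        using D[of "x + 1"] by (simp add: DERIV_shift)
      from DERIV_diff[OF this D[of x]] show ?thesis using assms(3) by (simp add: per1_def)
    qed
    then have "F (x + 1) - F x = F (0 + 1) - F 0" for x by (rule DERIV_isconst_all[rule_format])
    then show ?thesis by blast
  qed
  then obtain c where c: "\<And>x. F (x + 1) - F x = c" by blast
  have "F (1/2) - F (-1/2) = 0" using integral_mT_FTC'[OF assms(1,2)] assms(4) by simp
  then have "c = 0" using c[of "-1/2"] by simp
  then show ?thesis using c by (simp add: per1_def)
qed

text \<open>A test function of mean zero is the derivative of a test function, so \<open>f\<close>
  is orthogonal to all test functions of mean zero. Hence \<open>f\<close> minus its mean is
  orthogonal to every test function.\<close>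

lemma du_Bois_Reymond:
  assumes f: "integrable mT f" and orth: "\<And>\<phi>. test_fun \<phi> \<Longrightarrow> (LINT x|mT. f x * deriv \<phi> x) = 0"
  shows "AE x in mT. f x = (LINT t|mT. f t)"
proof -
  define c where "c = (LINT t|mT. f t)"
  have "AE x in mT. f x - c = 0"
  proof (rule fundamental_lemma)
    fix \<psi> assume \<psi>: "test_fun \<psi>"
    have \<psi>c: "continuous_on A \<psi>" for A using test_funD(2)[OF \<psi>, of _ 0] by simp
    have i\<psi>: "integrable mT \<psi>" by (intro continuous_integrable_mT \<psi>c)
    have if\<psi>: "integrable mT (\<lambda>x. f x * \<psi> x)" by (intro integrable_mult_continuous_mT f \<psi>c)
    define m where "m = (LINT x|mT. \<psi> x)"
    define \<eta> where "\<eta> x = \<psi> x - m" for x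
    have \<eta>: "test_fun \<eta>" unfolding \<eta>_def using \<psi> by (rule test_fun_diff_const)
    have \<eta>c: "continuous_on A \<eta>" for A using test_funD(2)[OF \<eta>, of _ 0] by simp
    have \<eta>0: "(LINT x|mT. \<eta> x) = 0" unfolding \<eta>_def using i\<psi> by (simp add: m_def mT.prob_space)
    obtain \<phi> where \<phi>: "\<And>x. (\<phi> has_real_derivative \<eta> x) (at x)"
      using continuous_antiderivative[OF \<eta>c] by blast
    have d\<phi>: "deriv \<phi> = \<eta>" using \<phi> by (auto intro: DERIV_imp_deriv)
    have "test_fun \<phi>"
      unfolding test_fun_def
    proof (intro conjI allI)
      show "per1 \<phi>" using per1_antiderivative[OF \<phi> \<eta>c _ \<eta>0] \<eta> by (simp add: test_fun_def)
      show "(deriv ^^ j) \<phi> differentiable at x" for j x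
      proof (cases j)
        case 0 then show ?thesis using \<phi> by (auto simp: real_differentiable_def)
      next
        case (Suc k) then show ?thesis
          using \<eta> by (simp add: funpow_Suc_right d\<phi> test_fun_def del: funpow.simps)
      qed
    qed
    then have "(LINT x|mT. f x * \<eta> x) = 0" using orth d\<phi> by metis
    moreover have "(LINT x|mT. f x * \<eta> x) = (LINT x|mT. f x * \<psi> x - m * f x)"
      by (simp add: \<eta>_def algebra_simps)
    moreover have "\<dots> = (LINT x|mT. f x * \<psi> x) - m * c" using if\<psi> f by (simp add: c_def)
    moreover have "(LINT x|mT. (f x - c) * \<psi> x) = (LINT x|mT. f x * \<psi> x - c * \<psi> x)"
      by (simp add: algebra_simps)
    moreover have "\<dots> = (LINT x|mT. f x * \<psi> x) - c * m" using if\<psi> i\<psi> by (simp add: m_def)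
    ultimately show "(LINT x|mT. (f x - c) * \<psi> x) = 0" by simp
  qed (use f in simp)
  then show ?thesis unfolding c_def by (rule AE_mp) (auto intro!: AE_I2)
qed

section \<open>Absolutely continuous representatives and weak derivatives\<close>

text \<open>Every element of the Sobolev space of order one is represented by its absolutely continuous
  representative \<open>w\<close>, and \<open>h\<close> is a version of its weak derivative.\<close>
definition H1 :: "(real \<Rightarrow> real) \<Rightarrow> (real \<Rightarrow> real) \<Rightarrow> bool" where
  "H1 w h \<longleftrightarrow> per1 w \<and> h \<in> L2_T \<and>
     (\<forall>x\<in>TT. w x = w (-1/2) + (LINT t|mT. indicat_real {..x} t * h t))"

lemma H1D:
  assumes "H1 w h"
  shows "per1 w" "h \<in> L2_T" "integrable mT h"
    "\<And>x. x \<in> TT \<Longrightarrow> w x = w (-1/2) + (LINT t|mT. indicat_real {..x} t * h t)"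
  using assms L2_imp_integrable unfolding H1_def by blast+

lemma per1_add_int: assumes "per1 f" shows "f (x + of_int n) = f x"
proof -
  have nat: "f (x + of_nat k) = f x" for k x
    by (induction k) (use assms in \<open>auto simp: per1_def add.assoc[symmetric] add.commute[of 1]\<close>)
  show ?thesis
  proof (cases "n \<ge> 0")
    case True then show ?thesis using nat[of x "nat n"] by simp
  next
    case False then show ?thesis using nat[of "x + of_int n" "nat (-n)"] by simp
  qed
qed

lemma TT_representative: obtains n :: int where "x + of_int n \<in> TT"
proof (rule that[of "- round x"])
  show "x + of_int (- round x) \<in> TT"
    using of_int_round_le[of x] of_int_round_ge[of x] unfolding TT_iff by simp
qed

lemma per1_eqI:
  assumes "per1 f" "per1 g" "\<And>x. x \<in> TT \<Longrightarrow> f x = g x" shows "f = g"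
proof
  fix x obtain n :: int where "x + of_int n \<in> TT" using TT_representative by blast
  then show "f x = g x" using assms(3)[of "x + of_int n"] per1_add_int[OF assms(1)] per1_add_int[OF assms(2)] by simp
qed

lemma continuous_on_per1:
  assumes per: "per1 f" and c: "continuous_on TT f" shows "continuous_on UNIV f"
proof -
  have cn: "continuous_on {of_int n - 1/2..of_int n + 1/2} f" for n :: int
  proof -
    have "continuous_on ((\<lambda>x. x - of_int n) ` {of_int n - 1/2..of_int n + 1/2}) f"
      by (rule continuous_on_subset[OF c]) (auto simp: TT_iff)
    with continuous_on_diff[OF continuous_on_id continuous_on_const]
    have "continuous_on {of_int n - 1/2..of_int n + 1/2} (f \<circ> (\<lambda>x. x - of_int n))"
      by (rule continuous_on_compose)
    then have "continuous_on {of_int n - 1/2..of_int n + 1/2} (\<lambda>x. f (x - of_int n))"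
      by (simp only: o_def)
    moreover have "f (x - of_int n) = f x" for x using per1_add_int[OF per, of "x" "-n"] by simp
    ultimately show ?thesis by simp
  qed
  have "isCont f x" for x
  proof -
    define n where "n = round x"
    have x: "of_int n - 1/2 \<le> x" "x \<le> of_int n + 1/2"
      using of_int_round_le[of x] of_int_round_ge[of x] by (auto simp: n_def)
    have "continuous_on ({of_int (n-1) - 1/2..of_int (n-1) + 1/2} \<union>
        {of_int n - 1/2..of_int n + 1/2} \<union> {of_int (n+1) - 1/2..of_int (n+1) + 1/2}) f"
      by (intro continuous_on_closed_Un closed_Un cn closed_atLeastAtMost)
    then have "continuous_on {of_int n - 1<..<of_int n + 1} f"
      by (rule continuous_on_subset) auto
    then show ?thesis using x by (intro continuous_on_interior) (auto simp: interior_open)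
  qed
  then show ?thesis by (simp add: continuous_at_imp_continuous_on)
qed

lemma continuous_indefinite_mT:
  assumes "integrable mT h"
  shows "continuous_on TT (\<lambda>x. LINT t|mT. indicat_real {..x} t * h t)"
proof -
  have si: "set_integrable lborel Tcircle h" using assms by (simp only: set_integrable_T_iff)
  have "h integrable_on Tcircle" using set_borel_integral_eq_integral(1)[OF si] .
  then have c: "continuous_on Tcircle (\<lambda>x. integral {-1/2..x} h)"
    by (rule indefinite_integral_continuous_1)
  have "(LINT t|mT. indicat_real {..x} t * h t) = integral {-1/2..x} h" if "x \<in> TT" for x
  proof -
    have s: "set_integrable lborel {-1/2..x} h"
      by (rule set_integrable_subset[OF si]) (use that in \<open>auto simp: TT_iff\<close>)
    have "(LINT t|mT. indicat_real {..x} t * h t) = (LINT t:{-1/2..x}|lborel. h t)"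
      using that unfolding mT_def set_lebesgue_integral_def by (subst integral_restrict_space)
        (auto intro!: Bochner_Integration.integral_cong simp: indicator_def TT_iff)
    then show ?thesis using set_borel_integral_eq_integral(2)[OF s] by simp
  qed
  then show ?thesis
    using c unfolding TT_def[symmetric] by (subst continuous_on_cong[OF refl]) auto
qed

lemma H1_continuous: assumes "H1 w h" shows "continuous_on A w"
proof -
  have "continuous_on TT (\<lambda>x. w (-1/2) + (LINT t|mT. indicat_real {..x} t * h t))"
    by (intro continuous_intros continuous_indefinite_mT H1D(3)[OF assms])
  moreover have "continuous_on TT w \<longleftrightarrow> continuous_on TT (\<lambda>x. w (-1/2) + (LINT t|mT. indicat_real {..x} t * h t))"
    by (rule continuous_on_cong[OF refl H1D(4)[OF assms]])
  ultimately have "continuous_on TT w" by blast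
  then show ?thesis using continuous_on_per1 H1D(1)[OF assms] continuous_on_subset by blast
qed

lemma integral_indicator_TT_top: "(LINT t|mT. indicat_real {..1/2} t * h t) = (LINT t|mT. h t)"
  by (rule Bochner_Integration.integral_cong[OF refl]) (simp add: space_mT TT_iff)

lemma H1_integral_0: assumes "H1 w h" shows "(LINT t|mT. h t) = 0"
proof -
  have "w (1/2) = w (-1/2) + (LINT t|mT. indicat_real {..1/2} t * h t)"
    by (rule H1D(4)[OF assms]) (simp add: TT_iff)
  then have "w (1/2) = w (-1/2) + (LINT t|mT. h t)" by (simp only: integral_indicator_TT_top)
  moreover have "w (1/2) = w (-1/2)"
  proof -
    have "-1/2 + 1 = (1/2::real)" by simp
    then show ?thesis using H1D(1)[OF assms, unfolded per1_def, rule_format, of "-1/2"] by (rule subst)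
  qed
  ultimately show ?thesis by linarith
qed

text \<open>The boundary values split off as constants and contribute nothing, since
  \<open>g\<close> and \<open>h\<close> have mean zero by periodicity. What remains is
  \<open>integral_mT_indicator_Fubini\<close> with vanishing right-hand side.\<close>

lemma H1_parts:
  assumes "H1 w h" "H1 v g"
  shows "(LINT x|mT. w x * g x) = - (LINT x|mT. h x * v x)"
proof -
  have ig: "integrable mT g" and ih: "integrable mT h"
    using H1D(3) assms by auto
  have ci: "continuous_on TT (\<lambda>x. LINT t|mT. indicat_real {..x} t * h t)"
    "continuous_on TT (\<lambda>x. LINT t|mT. indicat_real {..x} t * g t)"
    using continuous_indefinite_mT ig ih by auto
  have "(LINT x|mT. w x * g x) = (LINT x|mT. w (-1/2) * g x + (LINT t|mT. indicat_real {..x} t * h t) * g x)"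
  proof (intro Bochner_Integration.integral_cong)
    fix x assume "x \<in> space mT"
    then have "w x = w (-1/2) + (LINT t|mT. indicat_real {..x} t * h t)"
      using assms(1) unfolding H1_def space_mT by blast
    then show "w x * g x = w (-1/2) * g x + (LINT t|mT. indicat_real {..x} t * h t) * g x"
      by (simp only: distrib_right)
  qed simp
  also have "\<dots> = (LINT x|mT. (LINT t|mT. indicat_real {..x} t * h t) * g x)"
    using ig integrable_mult_continuous_mT[OF ig ci(1)] H1_integral_0[OF assms(2)] by (simp add: mult.commute)
  finally have 1: "(LINT x|mT. w x * g x) = (LINT x|mT. (LINT t|mT. indicat_real {..x} t * h t) * g x)" .
  have "(LINT x|mT. h x * v x) = (LINT x|mT. v (-1/2) * h x + h x * (LINT t|mT. indicat_real {..x} t * g t))"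
  proof (intro Bochner_Integration.integral_cong)
    fix x assume "x \<in> space mT"
    then have "v x = v (-1/2) + (LINT t|mT. indicat_real {..x} t * g t)"
      using assms(2) unfolding H1_def space_mT by blast
    then show "h x * v x = v (-1/2) * h x + h x * (LINT t|mT. indicat_real {..x} t * g t)"
      by (simp only: distrib_left mult.commute)
  qed simp
  also have "\<dots> = (LINT x|mT. h x * (LINT t|mT. indicat_real {..x} t * g t))"
    using ih integrable_mult_continuous_mT[OF ih ci(2)] H1_integral_0[OF assms(1)] by simp
  finally show ?thesis
    using 1 integral_mT_indicator_Fubini[OF ig ih] H1_integral_0[OF assms(1)] by simp
qed

lemma H1_C1:
  assumes "per1 w" "\<And>x. (w has_real_derivative h x) (at x)" "continuous_on UNIV h"
  shows "H1 w h"
  unfolding H1_def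
proof (intro conjI ballI)
  show "h \<in> L2_T" by (rule continuous_L2[OF continuous_on_subset[OF assms(3) subset_UNIV]])
  fix x assume "x \<in> TT"
  then show "w x = w (-1/2) + (LINT t|mT. indicat_real {..x} t * h t)"
    using integral_mT_FTC[OF assms(2,3), of x] by linarith
qed (rule assms(1))

lemma H1_test_fun: "test_fun \<phi> \<Longrightarrow> H1 \<phi> (deriv \<phi>)"
  using test_funD(1,3)[of \<phi> 0] test_funD(2)[of \<phi> _ 1] by (intro H1_C1) simp_all

lemma is_weak_deriv_iff:
  "is_weak_deriv j u g \<longleftrightarrow> g \<in> L2_T \<and>
     (\<forall>\<phi>. test_fun \<phi> \<longrightarrow> (LINT x|mT. u x * (deriv ^^ j) \<phi> x) = (-1) ^ j * (LINT x|mT. g x * \<phi> x))"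
  unfolding is_weak_deriv_def set_integral_T_eq ..

lemma indicator_indefinite_bot: "(LINT t|mT. indicat_real {..-1/2} t * h t) = 0"
proof -
  have "(LINT t|mT. indicat_real {..-1/2} t * h t) = (LINT t|mT. 0)"
  proof (rule integral_cong_AE)
    show "AE t in mT. indicat_real {..-1/2} t * h t = 0"
      using AE_mT_neq[of "-1/2"] by (rule AE_mp) (auto intro!: AE_I2 simp: space_mT TT_iff indicator_def)
    have "(\<lambda>t. indicat_real {..-1/2} t * h t) \<in> borel_measurable mT \<longleftrightarrow>
      (\<lambda>t. indicat_real {-1/2} t * h (-1/2)) \<in> borel_measurable mT"
      by (rule measurable_cong) (auto simp: space_mT TT_iff indicator_def)
    moreover have "(\<lambda>t. indicat_real {-1/2} t * h (-1/2)) \<in> borel_measurable mT"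
      unfolding mT_def by (intro measurable_restrict_space1) simp
    ultimately show "(\<lambda>t. indicat_real {..-1/2} t * h t) \<in> borel_measurable mT" by blast
  qed simp
  then show ?thesis by simp
qed

text \<open>Subtracting the primitive \<open>H\<close> of \<open>h\<close> from \<open>g\<close>
  leaves a function orthogonal to all derivatives of test functions, hence a constant by
  \<open>du_Bois_Reymond\<close>. Testing with the constant 1 shows that \<open>h\<close> has mean
  zero, so that \<open>H\<close> closes up periodically. The lemma serves twice: to recognize the
  Sobolev space, and to gain regularity from the Euler-Lagrange equation.\<close>

lemma H1_of_weak_orth:
  assumes g: "integrable mT g" and h: "h \<in> L2_T"
    and orth: "\<And>\<phi>. test_fun \<phi> \<Longrightarrow> (LINT x|mT. g x * deriv \<phi> x) = - (LINT x|mT. h x * \<phi> x)"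
  obtains w where "H1 w h" "AE x in mT. g x = w x"
proof -
  define H where "H x = (LINT t|mT. indicat_real {..x} t * h t)" for x
  have ih: "integrable mT h" using h by (rule L2_imp_integrable)
  have Hc: "continuous_on TT H" unfolding H_def by (rule continuous_indefinite_mT[OF ih])
  have iH: "integrable mT H" by (rule continuous_integrable_mT[OF Hc])
  have h0: "(LINT x|mT. h x) = 0"
    using orth[OF test_fun_const[of 1]] by (simp add: deriv_const)
  define c where "c = (LINT t|mT. g t - H t)"
  have "AE x in mT. g x - H x = c"
    unfolding c_def
  proof (rule du_Bois_Reymond)
    fix \<phi> assume \<phi>: "test_fun \<phi>"
    have H1\<phi>: "H1 \<phi> (deriv \<phi>)" by (rule H1_test_fun[OF \<phi>])
    have c\<phi>: "continuous_on A (deriv \<phi>)" for A using test_funD(2)[OF \<phi>, of _ 1] by simp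
    have i\<phi>: "integrable mT (deriv \<phi>)" by (rule continuous_integrable_mT[OF c\<phi>])
    define P where "P x = (LINT t|mT. indicat_real {..x} t * deriv \<phi> t)" for x
    have cP: "continuous_on TT P" unfolding P_def by (rule continuous_indefinite_mT[OF i\<phi>])
    have "(LINT x|mT. h x * \<phi> x) = (LINT x|mT. \<phi> (-1/2) * h x + h x * P x)"
    proof (intro Bochner_Integration.integral_cong)
      fix x assume "x \<in> space mT"
      then have "\<phi> x = \<phi> (-1/2) + P x"
        using H1\<phi> unfolding H1_def space_mT P_def by blast
      then show "h x * \<phi> x = \<phi> (-1/2) * h x + h x * P x"
        by (simp only: distrib_left mult.commute)
    qed simp
    also have "\<dots> = (LINT x|mT. h x * P x)"
      using ih integrable_mult_continuous_mT[OF ih cP] h0 by simp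
    also have "\<dots> = - (LINT x|mT. H x * deriv \<phi> x)"
      using integral_mT_indicator_Fubini[OF i\<phi> ih] h0 by (simp add: P_def H_def)
    finally have "(LINT x|mT. g x * deriv \<phi> x) = (LINT x|mT. H x * deriv \<phi> x)"
      using orth[OF \<phi>] by simp
    moreover have "integrable mT (\<lambda>x. g x * deriv \<phi> x)" "integrable mT (\<lambda>x. H x * deriv \<phi> x)"
      using integrable_mult_continuous_mT[OF _ c\<phi>] g iH by auto
    ultimately show "(LINT x|mT. (g x - H x) * deriv \<phi> x) = 0"
      by (simp add: left_diff_distrib)
  qed (use g iH in simp)
  \<comment> \<open>Periodic extension from the half-open period: the floor sends the endpoint 1/2
    to -1/2, which is harmless because \<open>H\<close> is 0 at both ends.\<close>
  define w where "w x = c + H (x - of_int \<lfloor>x + 1/2\<rfloor>)" for x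
  have wT: "w x = c + H x" if "x \<in> TT" for x
  proof (cases "x = 1/2")
    case True
    have "\<lfloor>x + 1/2\<rfloor> = 1" unfolding True by simp
    then have "w x = c + H (-1/2)" unfolding w_def True by simp
    moreover have "H (-1/2) = 0" unfolding H_def by (rule indicator_indefinite_bot)
    moreover have "H (1/2) = 0" unfolding H_def integral_indicator_TT_top by (rule h0)
    ultimately show ?thesis unfolding True by linarith
  next
    case False
    then have "\<lfloor>x + 1/2\<rfloor> = 0" using that by (intro floor_unique) (auto simp: TT_iff)
    then show ?thesis by (simp add: w_def)
  qed
  have "per1 w"
    unfolding per1_def
  proof
    fix x :: real
    have "\<lfloor>x + 1 + 1/2\<rfloor> = \<lfloor>x + 1/2\<rfloor> + 1" by linarith
    then show "w (x + 1) = w x" by (simp add: w_def)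
  qed
  have "w (-1/2) = c" using wT[of "-1/2"] indicator_indefinite_bot[of h] by (simp add: TT_iff H_def)
  then have "H1 w h"
    unfolding H1_def using h \<open>per1 w\<close> wT unfolding H_def by auto
  moreover have "AE x in mT. g x = w x"
    using \<open>AE x in mT. g x - H x = c\<close>
    by (rule AE_mp) (auto intro!: AE_I2 simp: space_mT wT)
  ultimately show thesis by (rule that)
qed

lemma continuous_AE_eq:
  fixes f g :: "real \<Rightarrow> real"
  assumes "continuous_on TT f" "continuous_on TT g" "AE x in mT. f x = g x" "x \<in> TT"
  shows "f x = g x"
proof -
  have "(LINT x|mT. (f x - g x)\<^sup>2) = (LINT x|mT. 0)"
    using assms continuous_measurable_mT by (intro integral_cong_AE) (auto elim!: AE_mp intro!: AE_I2)
  then show ?thesis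
    using continuous_TT_integral_square_0[of "\<lambda>x. f x - g x" x] assms by (simp add: continuous_on_diff)
qed

text \<open>The converse direction first yields a representative that agrees with \<open>w\<close>
  almost everywhere; two continuous functions with this property agree at every point.\<close>

lemma weak_deriv1_iff:
  assumes "per1 w" "continuous_on UNIV w"
  shows "is_weak_deriv 1 w h \<longleftrightarrow> H1 w h"
proof
  assume H: "H1 w h"
  show "is_weak_deriv 1 w h"
    unfolding is_weak_deriv_iff using H1D(2)[OF H] H1_parts[OF H H1_test_fun] by auto
next
  assume a: "is_weak_deriv 1 w h"
  have cT: "continuous_on TT w" using assms continuous_on_subset by blast
  obtain v where v: "H1 v h" "AE x in mT. w x = v x"
    using a by (elim H1_of_weak_orth[OF continuous_integrable_mT[OF cT], rotated 2])
      (auto simp: is_weak_deriv_iff)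
  have "w = v"
    using continuous_AE_eq[OF cT H1_continuous[OF v(1)] v(2)] assms(1) H1D(1)[OF v(1)]
    by (intro per1_eqI) auto
  then show "H1 w h" using v by simp
qed

lemma H1_continuous_deriv:
  assumes u: "H1 u w" and w: "per1 w" "continuous_on UNIV w"
  shows "(u has_real_derivative w x) (at x)"
proof -
  obtain V where V: "\<And>x. (V has_real_derivative w x) (at x)"
    using continuous_antiderivative[OF w(2)] by blast
  have pV: "per1 V" by (rule per1_antiderivative[OF V w(2,1) H1_integral_0[OF u]])
  have eq: "u = (\<lambda>x. V x + (u (-1/2) - V (-1/2)))"
  proof (rule per1_eqI)
    show "u x = V x + (u (-1/2) - V (-1/2))" if "x \<in> TT" for x
      using H1D(4)[OF u that] integral_mT_FTC[OF V w(2) that] by linarith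
  qed (use H1D(1)[OF u] pV in \<open>auto simp: per1_def\<close>)
  have d: "((\<lambda>x. V x + (u (-1/2) - V (-1/2))) has_real_derivative w x + 0) (at x)"
    by (intro DERIV_add V DERIV_const)
  have "(u has_real_derivative w x + 0) (at x)" using d unfolding eq[symmetric] .
  then show ?thesis by simp
qed

text \<open>Comparing the second-order relation for a test function with the first-order relation
  for its derivative shows that the first weak derivative has \<open>h\<close> as its own weak
  derivative. It is therefore represented by an absolutely continuous \<open>w\<close>, and a
  primitive of a continuous function is continuously differentiable.\<close>

lemma H2_per_iff:
  "u \<in> H2_per \<longleftrightarrow> per1 u \<and> (\<exists>w h. (\<forall>x. (u has_real_derivative w x) (at x)) \<and> H1 w h)"
proof
  assume "u \<in> H2_per"
  then obtain g h where u: "per1 u" "continuous_on UNIV u" and g: "is_weak_deriv 1 u g" and h: "is_weak_deriv 2 u h"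
    by (auto simp: H2_per_def)
  have ug: "H1 u g" using g weak_deriv1_iff[OF u] by blast
  have gL: "g \<in> L2_T" "h \<in> L2_T" using g h by (auto simp: is_weak_deriv_iff)
  obtain w where w: "H1 w h" "AE x in mT. g x = w x"
  proof (rule H1_of_weak_orth[of g h])
    fix \<phi> assume \<phi>: "test_fun \<phi>"
    have "(LINT x|mT. u x * (deriv ^^ 1) (deriv \<phi>) x) = - (LINT x|mT. g x * deriv \<phi> x)"
      using g test_fun_deriv[OF \<phi>] by (auto simp: is_weak_deriv_iff)
    moreover have "(LINT x|mT. u x * (deriv ^^ 2) \<phi> x) = (LINT x|mT. h x * \<phi> x)"
      using h \<phi> by (auto simp: is_weak_deriv_iff)
    ultimately show "(LINT x|mT. g x * deriv \<phi> x) = - (LINT x|mT. h x * \<phi> x)"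
      by (simp add: numeral_2_eq_2)
  qed (use gL L2_imp_integrable in auto)
  have wc: "continuous_on UNIV w" by (rule H1_continuous[OF w(1)])
  have cwT: "continuous_on TT w" by (rule H1_continuous[OF w(1)])
  have "H1 u w"
    unfolding H1_def
  proof (intro conjI ballI)
    fix x assume "x \<in> TT"
    have m: "g \<in> borel_measurable mT" "w \<in> borel_measurable mT"
      using gL continuous_measurable_mT[OF cwT] by (auto simp: L2_T_iff)
    have i: "indicat_real {..x} \<in> borel_measurable mT"
      unfolding mT_def by (intro measurable_restrict_space1) simp
    have "(LINT t|mT. indicat_real {..x} t * g t) = (LINT t|mT. indicat_real {..x} t * w t)"
      by (rule integral_cong_AE[OF borel_measurable_times[OF i m(1)] borel_measurable_times[OF i m(2)]])
         (use w(2) in \<open>eventually_elim, simp\<close>)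
    then show "u x = u (-1/2) + (LINT t|mT. indicat_real {..x} t * w t)"
      using H1D(4)[OF ug \<open>x \<in> TT\<close>] by linarith
  qed (use u continuous_L2[OF cwT] in auto)
  then show "per1 u \<and> (\<exists>w h. (\<forall>x. (u has_real_derivative w x) (at x)) \<and> H1 w h)"
    using H1_continuous_deriv[OF _ H1D(1)[OF w(1)] wc] w(1) u(1) by blast
next
  assume "per1 u \<and> (\<exists>w h. (\<forall>x. (u has_real_derivative w x) (at x)) \<and> H1 w h)"
  then obtain w h where u: "per1 u" "\<And>x. (u has_real_derivative w x) (at x)" and w: "H1 w h" by blast
  have uc: "continuous_on A u" for A
    using u(2) by (intro continuous_at_imp_continuous_on ballI DERIV_isCont)
  have uw: "H1 u w" using H1_C1[OF u H1_continuous[OF w]] .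
  have "is_weak_deriv 2 u h"
    unfolding is_weak_deriv_iff
  proof (intro conjI allI impI)
    fix \<phi> assume \<phi>: "test_fun \<phi>"
    have "(LINT x|mT. u x * (deriv ^^ 2) \<phi> x) = - (LINT x|mT. w x * deriv \<phi> x)"
      using H1_parts[OF uw H1_test_fun[OF test_fun_deriv[OF \<phi>]]] by (simp add: numeral_2_eq_2)
    also have "\<dots> = (LINT x|mT. h x * \<phi> x)" using H1_parts[OF w H1_test_fun[OF \<phi>]] by simp
    finally show "(LINT x|mT. u x * (deriv ^^ 2) \<phi> x) = (-1)\<^sup>2 * (LINT x|mT. h x * \<phi> x)" by simp
  qed (use H1D(2)[OF w] in simp)
  moreover have "is_weak_deriv 1 u w" using weak_deriv1_iff[OF u(1) uc] uw by blast
  ultimately show "u \<in> H2_per"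
    using u uc continuous_L2[OF uc] by (auto simp: H2_per_def)
qed

text \<open>Since \<open>weak_deriv\<close> is a choice among versions, it can be identified only up
  to a null set; \<open>fundamental_lemma\<close> gives exactly that.\<close>

lemma weak_deriv_AE:
  assumes "is_weak_deriv j u g" shows "weak_deriv j u \<in> L2_T" "AE x in mT. weak_deriv j u x = g x"
proof -
  have w: "is_weak_deriv j u (weak_deriv j u)"
    unfolding weak_deriv_def by (rule someI[of _ g]) (rule assms)
  then show L: "weak_deriv j u \<in> L2_T" by (simp add: is_weak_deriv_iff)
  have gL: "g \<in> L2_T" using assms by (simp add: is_weak_deriv_iff)
  have i: "integrable mT (weak_deriv j u)" "integrable mT g" using L gL L2_imp_integrable by auto
  have "AE x in mT. weak_deriv j u x - g x = 0"
  proof (rule fundamental_lemma)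
    fix \<psi> assume \<psi>: "test_fun \<psi>"
    then have c: "continuous_on TT \<psi>" using test_funD(2)[OF \<psi>, of _ 0] by simp
    have "(-1) ^ j * (LINT x|mT. weak_deriv j u x * \<psi> x) = (-1) ^ j * (LINT x|mT. g x * \<psi> x)"
      using w assms \<psi> by (auto simp: is_weak_deriv_iff)
    then show "(LINT x|mT. (weak_deriv j u x - g x) * \<psi> x) = 0"
      using integrable_mult_continuous_mT[OF i(1) c] integrable_mult_continuous_mT[OF i(2) c]
      by (simp add: left_diff_distrib)
  qed (use i in simp)
  then show "AE x in mT. weak_deriv j u x = g x" by (rule AE_mp) (auto intro!: AE_I2)
qed

text \<open>This eliminates the chosen weak derivatives: the functionals see them only under
  integrals, so the pair \<open>w\<close>, \<open>h\<close> may replace them. The mean of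
  \<open>w\<close> is 0 because \<open>u\<close> is periodic.\<close>

lemma H2_functionals:
  assumes u: "per1 u" "\<And>x. (u has_real_derivative w x) (at x)" and w: "H1 w h"
  shows "u \<in> H2_per" "E_fun u = 1/2 * (LINT x|mT. (w x)\<^sup>2)"
    "R_fun u = - ((LINT x|mT. (h x)\<^sup>2) + (LINT x|mT. (w x) ^ 3))"
    "K_fun u = 1/2 * (LINT x|mT. (u x)\<^sup>2)" "(LINT x|mT. w x) = 0"
proof -
  show uH: "u \<in> H2_per" using assms H2_per_iff by blast
  have uc: "continuous_on A u" for A
    using u(2) by (intro continuous_at_imp_continuous_on ballI DERIV_isCont)
  have wc: "continuous_on A w" for A by (rule H1_continuous[OF w])
  have uw: "H1 u w" using H1_C1[OF u wc] .
  show "(LINT x|mT. w x) = 0" by (rule H1_integral_0[OF uw])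
  have 1: "is_weak_deriv 1 u w" using weak_deriv1_iff[OF u(1) uc] uw by blast
  have 2: "is_weak_deriv 2 u h"
    unfolding is_weak_deriv_iff
  proof (intro conjI allI impI)
    fix \<phi> assume \<phi>: "test_fun \<phi>"
    have "(LINT x|mT. u x * (deriv ^^ 2) \<phi> x) = - (LINT x|mT. w x * deriv \<phi> x)"
      using H1_parts[OF uw H1_test_fun[OF test_fun_deriv[OF \<phi>]]] by (simp add: numeral_2_eq_2)
    also have "\<dots> = (LINT x|mT. h x * \<phi> x)" using H1_parts[OF w H1_test_fun[OF \<phi>]] by simp
    finally show "(LINT x|mT. u x * (deriv ^^ 2) \<phi> x) = (-1)\<^sup>2 * (LINT x|mT. h x * \<phi> x)" by simp
  qed (use H1D(2)[OF w] in simp)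
  note A1 = weak_deriv_AE[OF 1] and A2 = weak_deriv_AE[OF 2]
  have [measurable]: "weak_deriv 1 u \<in> borel_measurable mT" "weak_deriv 2 u \<in> borel_measurable mT"
    "w \<in> borel_measurable mT" "h \<in> borel_measurable mT"
    using A1 A2 H1D(2)[OF w] continuous_measurable_mT[OF wc] by (auto simp: L2_T_iff)
  show "E_fun u = 1/2 * (LINT x|mT. (w x)\<^sup>2)"
    unfolding E_fun_def set_integral_T_eq
    by (intro arg_cong[of _ _ "\<lambda>c. 1/2 * c"] integral_cong_AE)
       (use A1(2) in \<open>measurable, eventually_elim, simp\<close>)
  have "(LINT x|mT. (weak_deriv 2 u x)\<^sup>2 + weak_deriv 1 u x ^ 3) = (LINT x|mT. (h x)\<^sup>2 + w x ^ 3)"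
    by (rule integral_cong_AE) (use A1(2) A2(2) in \<open>measurable, eventually_elim, simp\<close>)
  also have "\<dots> = (LINT x|mT. (h x)\<^sup>2) + (LINT x|mT. (w x) ^ 3)"
    using H1D(2)[OF w] by (intro Bochner_Integration.integral_add)
      (auto simp: L2_T_iff intro!: continuous_integrable_mT continuous_intros wc)
  finally show "R_fun u = - ((LINT x|mT. (h x)\<^sup>2) + (LINT x|mT. (w x) ^ 3))"
    unfolding R_fun_def set_integral_T_eq by simp
  show "K_fun u = 1/2 * (LINT x|mT. (u x)\<^sup>2)"
    unfolding K_fun_def set_integral_T_eq ..
qed

section \<open>Existence of a minimizer\<close>

lemma indicator_mT: "A \<in> sets borel \<Longrightarrow> indicat_real A \<in> borel_measurable mT"
  unfolding mT_def by (intro measurable_restrict_space1) (simp add: borel_measurable_indicator)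

lemma integrable_indicator_mT:
  assumes "integrable mT f" "A \<in> sets borel"
  shows "integrable mT (\<lambda>t. indicat_real A t * f t)"
proof (rule Bochner_Integration.integrable_bound[OF assms(1)])
  show "(\<lambda>t. indicat_real A t * f t) \<in> borel_measurable mT"
    using assms(1) by (intro borel_measurable_times indicator_mT[OF assms(2)]) auto
qed (auto intro!: AE_I2 simp: indicator_def)

text \<open>Completeness of the square-integrable functions in the form needed for minimizing
  sequences. A fast subsequence has increments with summable integrals, so it converges almost
  everywhere under an integrable majorant. Fatou bounds the norm of the limit, and dominated
  convergence carries the primitives along.\<close>

lemma L2_Cauchy_limit:
  assumes L2: "\<And>n. h n \<in> L2_T"
    and Cauchy: "\<And>\<epsilon>::real. \<epsilon> > 0 \<Longrightarrow> \<exists>N::nat. \<forall>n\<ge>N. \<forall>m\<ge>N. (LINT x|mT. (h n x - h m x)\<^sup>2) < \<epsilon>"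
    and lim: "(\<lambda>n. LINT x|mT. (h n x)\<^sup>2) \<longlonglongrightarrow> J"
  obtains g r where "g \<in> L2_T" "strict_mono (r :: nat \<Rightarrow> nat)" "(LINT x|mT. (g x)\<^sup>2) \<le> J"
    "\<And>x. (\<lambda>n. LINT t|mT. indicat_real {..x} t * h (r n) t) \<longlonglongrightarrow> (LINT t|mT. indicat_real {..x} t * g t)"
proof -
  have hm[measurable]: "h n \<in> borel_measurable mT" and hi: "integrable mT (h n)" for n
    using L2[of n, unfolded L2_T_iff] L2_imp_integrable[OF L2[of n]] by blast+
  \<comment> \<open>Squared distances below \<open>(1/4)^i\<close> correspond to norms below
    \<open>(1/2)^i\<close>, which is summable.\<close>
  have "\<forall>i::nat. \<exists>N. \<forall>n\<ge>N. \<forall>m\<ge>N. (LINT x|mT. (h n x - h m x)\<^sup>2) < (1/4)^i"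
    by (intro allI Cauchy) simp
  then obtain N where "\<forall>i. \<forall>n\<ge>N i. \<forall>m\<ge>N i. (LINT x|mT. (h n x - h m x)\<^sup>2) < (1/4)^i"
    by (rule choice[THEN exE])
  then have N: "(LINT x|mT. (h n x - h m x)\<^sup>2) < (1/4)^i" if "n \<ge> N i" "m \<ge> N i" for i n m
    using that by simp
  define r where "r = rec_nat (N 0) (\<lambda>i v. max (Suc v) (N (Suc i)))"
  have r_Suc: "r (Suc i) = max (Suc (r i)) (N (Suc i))" and r0: "r 0 = N 0" for i by (simp_all add: r_def)
  have rN: "r i \<ge> N i" for i by (cases i) (auto simp: r_Suc r0)
  have rm: "strict_mono r" by (rule strict_monoI_Suc) (simp add: r_Suc)
  define d where "d i x = h (r (Suc i)) x - h (r i) x" for i x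
  have dm[measurable]: "d i \<in> borel_measurable mT" for i unfolding d_def by measurable
  have di: "integrable mT (d i)" for i unfolding d_def using hi by simp
  have d1: "(LINT x|mT. \<bar>d i x\<bar>) \<le> (1/2)^i" for i
  proof -
    have "d i \<in> L2_T" unfolding d_def using L2_lincomb(1)[OF L2 L2, of 1 _ "-1"] by simp
    then have d2: "integrable mT (\<lambda>x. (d i x)\<^sup>2)" by (simp add: L2_T_iff)
    \<comment> \<open>The arithmetic-geometric inequality with weight \<open>2^i\<close> takes the
      place of Cauchy-Schwarz; with this weight both summands integrate to at most
      \<open>(1/2)^i / 2\<close>.\<close>
    have "(LINT x|mT. \<bar>d i x\<bar>) \<le> (LINT x|mT. 2^i/2 * (d i x)\<^sup>2 + (1/2)^i/2)"
    proof (rule integral_mono)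
      fix x
      have "0 \<le> (2^i * \<bar>d i x\<bar> - 1)\<^sup>2" by simp
      then have "2 * (2^i * \<bar>d i x\<bar>) \<le> (2^i)\<^sup>2 * (d i x)\<^sup>2 + 1"
        by (simp add: power2_diff power_mult_distrib)
      then have "(1/2)^i * (2 * (2^i * \<bar>d i x\<bar>)) \<le> (1/2)^i * ((2^i)\<^sup>2 * (d i x)\<^sup>2 + 1)"
        by (intro mult_left_mono) auto
      moreover have "(1/2)^i * (2::real)^i = 1" by (simp add: power_mult_distrib[symmetric])
      then have "(1/2)^i * (2 * (2^i * \<bar>d i x\<bar>)) = 2 * \<bar>d i x\<bar>"
        "(1/2)^i * ((2^i)\<^sup>2 * (d i x)\<^sup>2 + 1) = 2^i * (d i x)\<^sup>2 + (1/2)^i"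
        by (simp_all add: algebra_simps power2_eq_square)
      ultimately show "\<bar>d i x\<bar> \<le> 2^i/2 * (d i x)\<^sup>2 + (1/2)^i/2" by simp
    qed (use di d2 in auto)
    also have "\<dots> = 2^i/2 * (LINT x|mT. (d i x)\<^sup>2) + (1/2)^i/2" using d2 by (simp add: mT.prob_space)
    also have "\<dots> \<le> 2^i/2 * (1/4)^i + (1/2)^i/2"
      using N[of i "r (Suc i)" "r i"] rN[of i] strict_mono_less_eq[OF rm, of i "Suc i"]
      by (auto simp: d_def intro!: mult_left_mono)
    also have "(2::real)^i/2 * (1/4)^i = (1/2)^i/2" by (simp add: power_mult_distrib[symmetric])
    finally show ?thesis by simp
  qed
  have sum_d: "summable (\<lambda>i. LINT x|mT. norm (d i x))"
    by (rule summable_comparison_test'[of "\<lambda>i. (1/2)^i" 0]) (use d1 in auto)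
  have AEs: "AE x in mT. summable (\<lambda>i. norm (d i x))"
  proof -
    have "(\<integral>\<^sup>+x. (\<Sum>i. ennreal (norm (d i x))) \<partial>mT) = (\<Sum>i. \<integral>\<^sup>+x. ennreal (norm (d i x)) \<partial>mT)"
      by (rule nn_integral_suminf) measurable
    also have "\<dots> = (\<Sum>i. ennreal (LINT x|mT. norm (d i x)))"
      using di by (intro suminf_cong nn_integral_eq_integral) auto
    also have "\<dots> \<noteq> \<infinity>" using sum_d by (subst suminf_ennreal2) auto
    finally have "AE x in mT. (\<Sum>i. ennreal (norm (d i x))) \<noteq> \<infinity>"
      by (intro nn_integral_noteq_infinite) measurable
    then show ?thesis by eventually_elim (rule summable_suminf_not_top, auto)
  qed
  define D where "D x = (\<Sum>i. norm (d i x))" for x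
  define g where "g x = h (r 0) x + (\<Sum>i. d i x)" for x
  have Dm[measurable]: "D \<in> borel_measurable mT" unfolding D_def by measurable
  have gm[measurable]: "g \<in> borel_measurable mT" unfolding g_def by measurable
  have Di: "integrable mT D" unfolding D_def
    using di AEs sum_d by (intro integrable_suminf) auto
  have tele: "h (r n) x = h (r 0) x + (\<Sum>i<n. d i x)" for n x
    by (induction n) (auto simp: d_def)
  have conv: "AE x in mT. (\<lambda>n. h (r n) x) \<longlonglongrightarrow> g x"
    using AEs
  proof eventually_elim
    case (elim x)
    then have "summable (\<lambda>i. d i x)" by (rule summable_norm_cancel)
    then have "(\<lambda>n. h (r 0) x + (\<Sum>i<n. d i x)) \<longlonglongrightarrow> g x"
      unfolding g_def by (intro tendsto_intros summable_LIMSEQ)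
    then show ?case unfolding tele[symmetric] .
  qed
  have bnd: "AE x in mT. norm (h (r n) x) \<le> \<bar>h (r 0) x\<bar> + D x" for n
    using AEs
  proof eventually_elim
    case (elim x)
    have "\<bar>\<Sum>i<n. d i x\<bar> \<le> (\<Sum>i<n. norm (d i x))" using norm_sum[of "\<lambda>i. d i x" "{..<n}"] by simp
    also have "\<dots> \<le> D x" unfolding D_def using elim by (intro sum_le_suminf) auto
    finally show ?case unfolding tele[of n x] by simp
  qed
  have lim1: "(\<lambda>n. LINT t|mT. indicat_real {..x} t * h (r n) t) \<longlonglongrightarrow> (LINT t|mT. indicat_real {..x} t * g t)" for x
  proof (rule integral_dominated_convergence[where w="\<lambda>t. \<bar>h (r 0) t\<bar> + D t"])
    have i: "indicat_real {..x} \<in> borel_measurable mT" by (rule indicator_mT) simp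
    show "(\<lambda>t. indicat_real {..x} t * g t) \<in> borel_measurable mT"
      "(\<lambda>t. indicat_real {..x} t * h (r n) t) \<in> borel_measurable mT" for n
      by (intro borel_measurable_times i gm hm)+
    show "integrable mT (\<lambda>t. \<bar>h (r 0) t\<bar> + D t)" using hi Di by simp
    show "AE t in mT. (\<lambda>n. indicat_real {..x} t * h (r n) t) \<longlonglongrightarrow> indicat_real {..x} t * g t"
      using conv by eventually_elim (intro tendsto_mult tendsto_const)
    show "AE t in mT. norm (indicat_real {..x} t * h (r n) t) \<le> \<bar>h (r 0) t\<bar> + D t" for n
      using bnd[of n] by eventually_elim (auto simp: indicator_def)
  qed
  have J0: "J \<ge> 0" using lim by (rule LIMSEQ_le_const) auto
  have "(\<integral>\<^sup>+x. ennreal ((g x)\<^sup>2) \<partial>mT) = (\<integral>\<^sup>+x. liminf (\<lambda>n. ennreal ((h (r n) x)\<^sup>2)) \<partial>mT)"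
  proof (rule nn_integral_cong_AE)
    show "AE x in mT. ennreal ((g x)\<^sup>2) = liminf (\<lambda>n. ennreal ((h (r n) x)\<^sup>2))"
      using conv
    proof eventually_elim
      case (elim x)
      then have "(\<lambda>n. ennreal ((h (r n) x)\<^sup>2)) \<longlonglongrightarrow> ennreal ((g x)\<^sup>2)"
        by (intro tendsto_ennrealI tendsto_intros)
      then show ?case by (intro lim_imp_Liminf[symmetric]) auto
    qed
  qed
  also have "\<dots> \<le> liminf (\<lambda>n. \<integral>\<^sup>+x. ennreal ((h (r n) x)\<^sup>2) \<partial>mT)"
    by (rule nn_integral_liminf) measurable
  also have "\<dots> = liminf (\<lambda>n. ennreal (LINT x|mT. (h (r n) x)\<^sup>2))"
    using L2 by (intro arg_cong[of _ _ liminf] ext nn_integral_eq_integral) (auto simp: L2_T_iff)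
  also have "\<dots> = ennreal J"
    using LIMSEQ_subseq_LIMSEQ[OF lim rm] by (intro lim_imp_Liminf tendsto_ennrealI) (auto simp: o_def)
  finally have nn: "(\<integral>\<^sup>+x. ennreal ((g x)\<^sup>2) \<partial>mT) \<le> ennreal J" .
  have gi: "integrable mT (\<lambda>x. (g x)\<^sup>2)"
    by (rule integrableI_bounded) (use nn in \<open>auto intro: order.strict_trans1\<close>)
  have "ennreal (LINT x|mT. (g x)\<^sup>2) \<le> ennreal J" using nn gi by (subst (asm) nn_integral_eq_integral) auto
  then have "(LINT x|mT. (g x)\<^sup>2) \<le> J" using J0 by (simp add: ennreal_le_iff)
  moreover have "g \<in> L2_T" using gi by (simp add: L2_T_iff)
  ultimately show thesis using that rm lim1 by blast
qed

section \<open>Uniform bounds from the gradient\<close>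

text \<open>Young's inequality for \<open>\<bar>h t\<bar>\<close> integrated between the two points.
  The weight \<eta> is left free: a small one gives equicontinuity, while a weight tied to the
  constraint gives coercivity.\<close>

lemma H1_oscillation:
  assumes w: "H1 w h" and "\<eta> > 0" and xy: "x \<in> TT" "y \<in> TT"
  shows "\<bar>w y - w x\<bar> \<le> \<eta> / 2 * (LINT t|mT. (h t)\<^sup>2) + \<bar>y - x\<bar> / (2 * \<eta>)"
proof -
  have main: "\<bar>w y - w x\<bar> \<le> \<eta> / 2 * (LINT t|mT. (h t)\<^sup>2) + (y - x) / (2 * \<eta>)"
    if xy: "x \<in> TT" "y \<in> TT" "x \<le> y" for x y
  proof -
    have hi: "integrable mT h" and h2: "integrable mT (\<lambda>x. (h x)\<^sup>2)"
      using H1D(2,3)[OF w] by (auto simp: L2_T_iff)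
    have ii: "integrable mT (\<lambda>t. indicat_real {..z} t * h t)" for z
      by (rule integrable_indicator_mT[OF hi]) simp
    have i3: "integrable mT (indicat_real {x<..y})"
      by (rule bounded_integrable_mT[OF indicator_mT, of _ 1]) (auto simp: indicator_def)
    have "w y - w x = (LINT t|mT. indicat_real {..y} t * h t) - (LINT t|mT. indicat_real {..x} t * h t)"
      using H1D(4)[OF w xy(1)] H1D(4)[OF w xy(2)] by linarith
    also have "\<dots> = (LINT t|mT. indicat_real {..y} t * h t - indicat_real {..x} t * h t)"
      using ii by simp
    also have "\<bar>\<dots>\<bar> \<le> (LINT t|mT. \<eta> / 2 * (h t)\<^sup>2 + 1 / (2 * \<eta>) * indicat_real {x<..y} t)"
    proof (rule integral_abs_bound_integral)
      fix t
      have "0 \<le> (\<eta> * \<bar>h t\<bar> - 1)\<^sup>2" by simp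
      then have "2 * \<eta> * \<bar>h t\<bar> \<le> \<eta> * \<eta> * (h t)\<^sup>2 + 1"
        by (simp add: power2_diff power_mult_distrib power2_eq_square[of \<eta>])
      then have "\<bar>h t\<bar> \<le> \<eta> / 2 * (h t)\<^sup>2 + 1 / (2 * \<eta>)"
        using \<open>\<eta> > 0\<close> by (simp add: field_simps)
      then show "\<bar>indicat_real {..y} t * h t - indicat_real {..x} t * h t\<bar> \<le> \<eta> / 2 * (h t)\<^sup>2 + 1 / (2 * \<eta>) * indicat_real {x<..y} t"
        using xy(3) \<open>\<eta> > 0\<close> by (auto simp: indicator_def)
    qed (use ii h2 i3 in auto)
    also have "\<dots> = \<eta> / 2 * (LINT t|mT. (h t)\<^sup>2) + 1 / (2 * \<eta>) * (LINT t|mT. indicat_real {x<..y} t)"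
      using h2 i3 by simp
    also have "(LINT t|mT. indicat_real {x<..y} t) = y - x"
    proof -
      have "(LINT t|mT. indicat_real {x<..y} t) = (LINT t|lborel. indicat_real {x<..y} t)"
        unfolding mT_def
      proof (subst integral_restrict_space)
        have "indicat_real TT t *\<^sub>R indicat_real {x<..y} t = indicat_real {x<..y} t" for t
          using xy by (auto simp: indicator_def TT_iff)
        then show "(LINT t|lborel. indicat_real TT t *\<^sub>R indicat_real {x<..y} t) = (LINT t|lborel. indicat_real {x<..y} t)"
          by presburger
      qed simp
      then show ?thesis using xy(3) by simp
    qed
    finally show ?thesis by simp
  qed
  show ?thesis using main[of x y] main[of y x] xy by (cases "x \<le> y") (auto simp: abs_minus_commute)
qed

text \<open>Because the mean vanishes, \<open>w x\<close> is the average of the differences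
  \<open>w x - w y\<close>, to which the oscillation bound applies with distance at most 1.\<close>

lemma H1_sup_bound:
  assumes w: "H1 w h" "(LINT t|mT. w t) = 0" and "\<eta> > 0" "x \<in> TT"
  shows "\<bar>w x\<bar> \<le> \<eta> / 2 * (LINT t|mT. (h t)\<^sup>2) + 1 / (2 * \<eta>)"
proof -
  have wi: "integrable mT w" by (rule continuous_integrable_mT[OF H1_continuous[OF w(1)]])
  have "w x = (LINT y|mT. w x - w y)" using wi w(2) by (simp add: mT.prob_space)
  also have "\<bar>\<dots>\<bar> \<le> (LINT y|mT. \<eta> / 2 * (LINT t|mT. (h t)\<^sup>2) + 1 / (2 * \<eta>))"
  proof (rule integral_abs_bound_integral)
    fix y assume "y \<in> space mT"
    then have y: "y \<in> TT" by (simp add: space_mT)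
    have "\<bar>x - y\<bar> / (2 * \<eta>) \<le> 1 / (2 * \<eta>)"
      using y \<open>x \<in> TT\<close> \<open>\<eta> > 0\<close> by (intro divide_right_mono) (auto simp: TT_iff abs_le_iff)
    then show "\<bar>w x - w y\<bar> \<le> \<eta> / 2 * (LINT t|mT. (h t)\<^sup>2) + 1 / (2 * \<eta>)"
      using H1_oscillation[OF w(1) \<open>\<eta> > 0\<close> y \<open>x \<in> TT\<close>] by linarith
  qed (use wi in auto)
  finally show ?thesis by (simp add: mT.prob_space)
qed

lemma H1_lincomb:
  assumes "H1 w h" "H1 v g" shows "H1 (\<lambda>x. a * w x + b * v x) (\<lambda>x. a * h x + b * g x)"
  unfolding H1_def
proof (intro conjI ballI)
  show "per1 (\<lambda>x. a * w x + b * v x)" using H1D(1)[OF assms(1)] H1D(1)[OF assms(2)] by (simp add: per1_def)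
  show "(\<lambda>x. a * h x + b * g x) \<in> L2_T" by (rule L2_lincomb[OF H1D(2)[OF assms(1)] H1D(2)[OF assms(2)]])
  fix x assume x: "x \<in> TT"
  have ii: "integrable mT (\<lambda>t. indicat_real {..x} t * f t)" if "integrable mT f" for f
    by (rule integrable_indicator_mT[OF that]) simp
  have "(LINT t|mT. indicat_real {..x} t * (a * h t + b * g t))
    = (LINT t|mT. a * (indicat_real {..x} t * h t) + b * (indicat_real {..x} t * g t))"
    by (simp add: algebra_simps)
  also have "\<dots> = a * (LINT t|mT. indicat_real {..x} t * h t) + b * (LINT t|mT. indicat_real {..x} t * g t)"
    using ii[OF H1D(3)[OF assms(1)]] ii[OF H1D(3)[OF assms(2)]] by simp
  also have "\<dots> = a * (w x - w (-1/2)) + b * (v x - v (-1/2))"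
    using H1D(4)[OF assms(1) x] H1D(4)[OF assms(2) x] by simp
  finally show "a * w x + b * v x = a * w (-1/2) + b * v (-1/2) + (LINT t|mT. indicat_real {..x} t * (a * h t + b * g t))"
    by (simp add: algebra_simps)
qed

section \<open>The reduced variational problem\<close>

text \<open>Here \<open>w\<close> is the derivative of the unknown \<open>u\<close>. Mean zero is
  the condition for a periodic primitive, and the factor 2 undoes the one half in
  \<open>E_fun\<close>. The derivative \<open>h\<close> is a separate argument because it is
  determined only up to null sets.\<close>

definition admissible :: "real \<Rightarrow> (real \<Rightarrow> real) \<Rightarrow> (real \<Rightarrow> real) \<Rightarrow> bool" where
  "admissible E w h \<longleftrightarrow> H1 w h \<and> (LINT x|mT. w x) = 0 \<and> (LINT x|mT. (w x)\<^sup>2) = 2 * E"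

definition energy :: "(real \<Rightarrow> real) \<Rightarrow> (real \<Rightarrow> real) \<Rightarrow> real" where
  "energy w h = (LINT x|mT. (h x)\<^sup>2) + (LINT x|mT. (w x) ^ 3)"

lemma admissible_exists:
  assumes "E > 0" shows "\<exists>w h. admissible E w h"
proof -
  define w where "w x = sqrt (4 * E) * cos (2 * pi * x)" for x
  define h where "h x = - sqrt (4 * E) * (2 * pi) * sin (2 * pi * x)" for x
  have "H1 w h"
  proof (rule H1_C1)
    show "per1 w" by (simp add: per1_def w_def distrib_left)
    show "(w has_real_derivative h x) (at x)" for x
      unfolding w_def h_def by (auto intro!: derivative_eq_intros)
    show "continuous_on UNIV h" unfolding h_def by (intro continuous_intros)
  qed
  moreover have "(LINT x|mT. w x) = 0"
  proof -
    have "(LINT x|mT. cos (2 * pi * x)) = sin (2 * pi * (1/2)) / (2 * pi) - sin (2 * pi * (-1/2)) / (2 * pi)"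
      by (rule integral_mT_FTC') (auto intro!: derivative_eq_intros continuous_intros)
    then show ?thesis by (simp add: w_def)
  qed
  moreover have "(LINT x|mT. (w x)\<^sup>2) = 2 * E"
  proof -
    have "(w x)\<^sup>2 = 2 * E * (1 + cos (4 * pi * x))" for x
      using assms cos_double_cos[of "2 * pi * x"] by (simp add: w_def power_mult_distrib algebra_simps)
    then have "(LINT x|mT. (w x)\<^sup>2) = (LINT x|mT. 2 * E * (1 + cos (4 * pi * x)))" by simp
    also have "\<dots> = 2 * E * (1/2 + sin (4 * pi * (1/2)) / (4 * pi)) - 2 * E * (-1/2 + sin (4 * pi * (-1/2)) / (4 * pi))"
      by (rule integral_mT_FTC'[of "\<lambda>x. 2 * E * (x + sin (4 * pi * x) / (4 * pi))"])
         (auto intro!: derivative_eq_intros continuous_intros)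
    finally show ?thesis by simp
  qed
  ultimately show ?thesis unfolding admissible_def by blast
qed

text \<open>The cubic term is at most the supremum of \<open>\<bar>w\<bar>\<close> times
  \<open>2 * E\<close>. The weight \<open>1 / (2 * E)\<close> in the supremum bound is chosen so
  that this costs exactly half of the gradient term, which is then absorbed.\<close>

lemma energy_coercive:
  assumes "admissible E w h" "E > 0"
  shows "(LINT x|mT. (h x)\<^sup>2) \<le> 2 * energy w h + 4 * E\<^sup>2"
proof -
  define N where "N = (LINT x|mT. (h x)\<^sup>2)"
  have w: "H1 w h" "(LINT x|mT. w x) = 0" "(LINT x|mT. (w x)\<^sup>2) = 2 * E"
    using assms(1) by (auto simp: admissible_def)
  note wc = H1_continuous[OF w(1)]
  define B where "B = 1 / (2 * E) / 2 * N + 1 / (2 * (1 / (2 * E)))"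
  have B: "\<bar>w x\<bar> \<le> B" if "x \<in> TT" for x
    using H1_sup_bound[OF w(1,2) _ that, of "1 / (2 * E)"] assms(2) by (simp add: B_def N_def)
  have "- (LINT x|mT. (w x) ^ 3) = (LINT x|mT. - ((w x) ^ 3))" by simp
  also have "\<dots> \<le> (LINT x|mT. B * (w x)\<^sup>2)"
  proof (rule integral_mono)
    fix x assume "x \<in> space mT"
    then have "- w x \<le> B" using B[of x] by (auto simp: space_mT)
    then have "(- w x) * (w x)\<^sup>2 \<le> B * (w x)\<^sup>2" by (intro mult_right_mono) auto
    then show "- ((w x) ^ 3) \<le> B * (w x)\<^sup>2" by (simp add: power3_eq_cube power2_eq_square)
  qed (auto intro!: continuous_integrable_mT continuous_intros wc)
  also have "\<dots> = B * (2 * E)" using w(3) by simp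
  also have "\<dots> = N / 2 + 2 * E\<^sup>2" using assms(2) by (simp add: B_def field_simps power2_eq_square)
  finally show ?thesis by (simp add: energy_def N_def)
qed

lemma energy_scale:
  assumes "H1 w h"
  shows "energy (\<lambda>x. c * w x) (\<lambda>x. c * h x) = c\<^sup>2 * (LINT x|mT. (h x)\<^sup>2) + c ^ 3 * (LINT x|mT. (w x) ^ 3)"
  by (simp add: energy_def power_mult_distrib)

lemma admissible_scale:
  assumes "H1 w h" "(LINT x|mT. w x) = 0" "(LINT x|mT. (w x)\<^sup>2) > 0" "E > 0"
  shows "admissible E (\<lambda>x. sqrt (2 * E / (LINT x|mT. (w x)\<^sup>2)) * w x) (\<lambda>x. sqrt (2 * E / (LINT x|mT. (w x)\<^sup>2)) * h x)"
proof -
  define c where "c = sqrt (2 * E / (LINT x|mT. (w x)\<^sup>2))"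
  have c2: "c\<^sup>2 = 2 * E / (LINT x|mT. (w x)\<^sup>2)" using assms by (simp add: c_def)
  have "H1 (\<lambda>x. c * w x) (\<lambda>x. c * h x)" using H1_lincomb[OF assms(1,1), of c 0] by simp
  then show ?thesis
    unfolding admissible_def c_def[symmetric] using assms c2 by (simp add: power_mult_distrib)
qed

lemma minimizer_exists:
  assumes E: "E > 0"
  obtains w h where "admissible E w h" "\<And>v g. admissible E v g \<Longrightarrow> energy w h \<le> energy v g"
proof -
  define X where "X = {energy v g |v g. admissible E v g}"
  have Xne: "X \<noteq> {}" using admissible_exists[OF E] by (auto simp: X_def)
  have "- 2 * E\<^sup>2 \<le> e" if e: "e \<in> X" for e
  proof -
    obtain v g where vg: "admissible E v g" "e = energy v g" using e by (auto simp: X_def)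
    have "0 \<le> (LINT x|mT. (g x)\<^sup>2)" by simp
    then show ?thesis using energy_coercive[OF vg(1) E] vg(2) by linarith
  qed
  then have bdd: "bdd_below X" by (rule bdd_belowI)
  define I where "I = Inf X"
  have I: "I \<le> energy v g" if "admissible E v g" for v g
    unfolding I_def using that bdd by (intro cInf_lower) (auto simp: X_def)
  have "\<exists>v g. admissible E v g \<and> energy v g < I + 1 / (real n + 1)" for n :: nat
  proof -
    have "\<exists>e\<in>X. e < I + 1 / (real n + 1)"
      using cInf_less_iff[OF Xne bdd, of "I + 1 / (real n + 1)"] by (simp add: I_def)
    then show ?thesis by (auto simp: X_def)
  qed
  then obtain v0 g0 where vg0: "\<And>n. admissible E (v0 n) (g0 n)" "\<And>n. energy (v0 n) (g0 n) < I + 1 / (real n + 1)"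
    by metis
  define B where "B = 2 * (I + 1) + 4 * E\<^sup>2"
  have B0: "(LINT x|mT. (g0 n x)\<^sup>2) \<le> B" for n
  proof -
    have "1 / (real n + 1) \<le> 1" by simp
    from order_trans[OF less_imp_le[OF vg0(2)[of n]] add_left_mono[OF this]]
    have "energy (v0 n) (g0 n) \<le> I + 1" .
    from order_trans[OF energy_coercive[OF vg0(1) E] add_right_mono[OF mult_left_mono[OF this]]]
    show ?thesis unfolding B_def by simp
  qed
  have Bnn: "B \<ge> 0" using B0[of 0] by (rule order_trans[rotated]) simp
  have H0: "H1 (v0 n) (g0 n)" "(LINT x|mT. v0 n x) = 0" for n using vg0(1) by (auto simp: admissible_def)
  define C where "C = B / 2 + 1 / 2"
  have sup0: "\<bar>v0 n x\<bar> \<le> C" if "x \<in> TT" for n x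
    using H1_sup_bound[OF H0(1)[of n] H0(2), of 1 x] that B0[of n] by (simp add: C_def)
  obtain gl k where gl: "continuous_on TT gl" "strict_mono (k :: nat \<Rightarrow> nat)"
    "\<And>e. 0 < e \<Longrightarrow> \<exists>N. \<forall>n x. n \<ge> N \<and> x \<in> TT \<longrightarrow> norm (v0 (k n) x - gl x) < e"
  proof (rule Arzela_Ascoli[of TT v0 C])
    fix x e :: real assume x: "x \<in> TT" and e: "e > 0"
    \<comment> \<open>With this weight the gradient part of the oscillation is strictly below
      \<open>e / 2\<close>, and at distances below \<open>\<eta> * e\<close> the other part is at
      most \<open>e / 2\<close>. The summand 1 provides strictness and covers
      \<open>B = 0\<close>.\<close>
    define \<eta> where "\<eta> = e / (B + 1)"
    have \<eta>: "\<eta> > 0" using e Bnn by (simp add: \<eta>_def)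
    have "norm (v0 n x - v0 n y) < e" if "y \<in> TT \<and> norm (x - y) < \<eta> * e" for n y
    proof -
      have "\<bar>v0 n x - v0 n y\<bar> \<le> \<eta> / 2 * (LINT t|mT. (g0 n t)\<^sup>2) + \<bar>x - y\<bar> / (2 * \<eta>)"
        using H1_oscillation[OF H0(1) \<eta>, of y x] that x by simp
      also have "\<dots> \<le> \<eta> / 2 * B + \<bar>x - y\<bar> / (2 * \<eta>)" using B0[of n] \<eta> by simp
      also have "\<dots> < \<eta> / 2 * (B + 1) + \<eta> * e / (2 * \<eta>)"
      proof (intro add_less_le_mono divide_right_mono)
        show "\<eta> / 2 * B < \<eta> / 2 * (B + 1)" using \<eta> by simp
      qed (use that \<eta> in auto)
      also have "\<dots> = e"
      proof -
        have "\<eta> * (B + 1) = e" using Bnn by (simp add: \<eta>_def)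
        moreover have "\<eta> * e / (2 * \<eta>) = e / 2" using \<eta> by simp
        ultimately show ?thesis by (simp add: field_simps)
      qed
      finally show ?thesis by simp
    qed
    then show "\<exists>d>0. \<forall>n y. y \<in> TT \<and> norm (x - y) < d \<longrightarrow> norm (v0 n x - v0 n y) < e"
      using \<eta> e by (intro exI[of _ "\<eta> * e"]) auto
  qed (use sup0 in auto)
  define v where "v n = v0 (k n)" for n
  define g where "g n = g0 (k n)" for n
  have adm: "admissible E (v n) (g n)" for n using vg0 by (simp add: v_def g_def)
  have Hn: "H1 (v n) (g n)" "(LINT x|mT. v n x) = 0" "(LINT x|mT. (v n x)\<^sup>2) = 2 * E" for n
    using adm by (auto simp: admissible_def)
  have vc: "continuous_on A (v n)" for n A by (rule H1_continuous[OF Hn(1)])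
  have sup: "\<bar>v n x\<bar> \<le> C" if "x \<in> TT" for n x using sup0 that by (simp add: v_def)
  have "\<exists>l. (\<lambda>n. v n x) \<longlonglongrightarrow> l" for x
  proof -
    obtain m :: int where m: "x + of_int m \<in> TT" using TT_representative by blast
    have "(\<lambda>n. v n (x + of_int m)) \<longlonglongrightarrow> gl (x + of_int m)"
      unfolding LIMSEQ_iff v_def using gl(3) m by metis
    then show ?thesis using per1_add_int[OF H1D(1)[OF Hn(1)]] by auto
  qed
  then obtain w where w: "\<And>x. (\<lambda>n. v n x) \<longlonglongrightarrow> w x" by metis
  have perw: "per1 w"
    unfolding per1_def
  proof
    fix x
    have "v n (x + 1) = v n x" for n using H1D(1)[OF Hn(1)[of n]] by (simp add: per1_def)
    then show "w (x + 1) = w x" using w[of x] w[of "x + 1"] LIMSEQ_unique by simp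
  qed
  have wm[measurable]: "w \<in> borel_measurable mT"
    by (rule borel_measurable_LIMSEQ_real[OF w continuous_measurable_mT[OF vc]])
  have DCT: "(\<lambda>n. LINT x|mT. f n x) \<longlonglongrightarrow> (LINT x|mT. f' x)"
    if "\<And>n. f n \<in> borel_measurable mT" "f' \<in> borel_measurable mT" "\<And>x. (\<lambda>n. f n x) \<longlonglongrightarrow> f' x"
      "\<And>n x. x \<in> TT \<Longrightarrow> \<bar>f n x\<bar> \<le> c" for f f' and c :: real
    by (rule integral_dominated_convergence[where w="\<lambda>_. c"])
       (use that in \<open>auto intro!: AE_I2 simp: space_mT\<close>)
  have vm[measurable]: "v n \<in> borel_measurable mT" for n by (rule continuous_measurable_mT[OF vc])
  have pw: "\<bar>y ^ p\<bar> \<le> C ^ p" if "\<bar>y\<bar> \<le> C" for y p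
    using that by (simp add: power_abs power_mono)
  have w0: "(LINT x|mT. w x) = 0"
    using DCT[of v w C, OF vm wm w sup] Hn(2) by (simp add: LIMSEQ_const_iff)
  have w2: "(LINT x|mT. (w x)\<^sup>2) = 2 * E"
  proof -
    have "(\<lambda>n. LINT x|mT. (v n x)\<^sup>2) \<longlonglongrightarrow> (LINT x|mT. (w x)\<^sup>2)"
      by (rule DCT[of _ _ "C\<^sup>2"]) (measurable, measurable, intro tendsto_power w, intro pw sup)
    then show ?thesis using Hn(3) by (simp add: LIMSEQ_const_iff)
  qed
  define I3 where "I3 = (LINT x|mT. (w x) ^ 3)"
  have w3: "(\<lambda>n. LINT x|mT. (v n x) ^ 3) \<longlonglongrightarrow> I3"
    unfolding I3_def by (rule DCT[of _ _ "C ^ 3"]) (auto intro!: tendsto_power w pw sup)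
  have Flim: "(\<lambda>n. energy (v n) (g n)) \<longlonglongrightarrow> I"
  proof (rule tendsto_sandwich[of "\<lambda>_. I" _ _ "\<lambda>n. I + 1 / (real n + 1)"])
    show "\<forall>\<^sub>F n in sequentially. energy (v n) (g n) \<le> I + 1 / (real n + 1)"
    proof (rule always_eventually, rule allI)
      fix n
      have "1 / (real (k n) + 1) \<le> 1 / (real n + 1)"
        using seq_suble[OF gl(2), of n] by (intro divide_left_mono) auto
      then show "energy (v n) (g n) \<le> I + 1 / (real n + 1)"
        using vg0(2)[of "k n"] by (simp add: v_def g_def)
    qed
    show "(\<lambda>n. I + 1 / (real n + 1)) \<longlonglongrightarrow> I" by real_asymp
  qed (use I adm in auto)
  \<comment> \<open>The energies converge to \<open>I\<close> and the cubic terms to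
    \<open>I3\<close> by uniform boundedness, so the gradient terms have the limit
    \<open>J\<close>.\<close>
  define J where "J = I - I3"
  have Jlim: "(\<lambda>n. LINT x|mT. (g n x)\<^sup>2) \<longlonglongrightarrow> J"
  proof -
    have "(\<lambda>n. energy (v n) (g n) - (LINT x|mT. (v n x) ^ 3)) \<longlonglongrightarrow> J"
      unfolding J_def by (intro tendsto_diff Flim w3)
    then show ?thesis by (simp add: energy_def)
  qed
  have g2: "integrable mT (\<lambda>x. (g n x)\<^sup>2)" and gL: "g n \<in> L2_T" for n
    using H1D(2)[OF Hn(1)] by (auto simp: L2_T_iff)
  have Cau: "\<exists>N::nat. \<forall>n\<ge>N. \<forall>m\<ge>N. (LINT x|mT. (g n x - g m x)\<^sup>2) < \<epsilon>" if \<epsilon>: "\<epsilon> > 0" for \<epsilon>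
  proof (rule ccontr)
    assume "\<nexists>N. \<forall>n\<ge>N. \<forall>m\<ge>N. (LINT x|mT. (g n x - g m x)\<^sup>2) < \<epsilon>"
    then have "\<forall>N. \<exists>n m. n \<ge> N \<and> m \<ge> N \<and> (LINT x|mT. (g n x - g m x)\<^sup>2) \<ge> \<epsilon>"
      by (meson not_le)
    then obtain p q where pq: "\<And>N. p N \<ge> N" "\<And>N. q N \<ge> N"
      "\<And>N. (LINT x|mT. (g (p N) x - g (q N) x)\<^sup>2) \<ge> \<epsilon>" by metis
    have fp: "filterlim p at_top sequentially" "filterlim q at_top sequentially"
      using pq by (auto intro: filterlim_at_top_mono[OF filterlim_ident])
    \<comment> \<open>Midpoints of two late members leave the constraint set, but their mean squares
      tend to \<open>2 * E\<close>; the factor \<open>c N\<close>, tending to 1, brings them back.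
      Minimality of \<open>I\<close> then bounds their gradient terms from below.\<close>
    define a where "a N x = 1/2 * v (p N) x + 1/2 * v (q N) x" for N x
    define b where "b N x = 1/2 * g (p N) x + 1/2 * g (q N) x" for N x
    have Hab: "H1 (a N) (b N)" for N unfolding a_def b_def by (intro H1_lincomb Hn)
    have a0: "(LINT x|mT. a N x) = 0" for N
      unfolding a_def using Hn(2) continuous_integrable_mT[OF vc] by simp
    have alim: "(\<lambda>N. a N x) \<longlonglongrightarrow> w x" for x
    proof -
      have "(\<lambda>N. 1/2 * v (p N) x + 1/2 * v (q N) x) \<longlonglongrightarrow> 1/2 * w x + 1/2 * w x"
        by (intro tendsto_intros filterlim_compose[OF w[of x]] fp)
      then show ?thesis by (simp add: a_def)
    qed
    have am[measurable]: "a N \<in> borel_measurable mT" for N unfolding a_def by measurable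
    have aC: "\<bar>a N x\<bar> \<le> C" if "x \<in> TT" for N x
      using sup[OF that, of "p N"] sup[OF that, of "q N"] unfolding a_def by (simp add: abs_le_iff)
    define \<alpha> where "\<alpha> N = (LINT x|mT. (a N x)\<^sup>2)" for N
    define \<beta> where "\<beta> N = (LINT x|mT. (a N x) ^ 3)" for N
    have \<alpha>: "\<alpha> \<longlonglongrightarrow> 2 * E" unfolding \<alpha>_def w2[symmetric]
      by (rule DCT[of _ _ "C\<^sup>2"]) (measurable, measurable, intro tendsto_power alim, intro pw aC)
    have \<beta>: "\<beta> \<longlonglongrightarrow> I3" unfolding \<beta>_def I3_def
      by (rule DCT[of _ _ "C ^ 3"]) (auto intro!: tendsto_power alim pw aC)
    define c where "c N = sqrt (2 * E / \<alpha> N)" for N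
    have "c \<longlonglongrightarrow> sqrt (2 * E / (2 * E))" unfolding c_def using E
      by (intro tendsto_real_sqrt tendsto_divide tendsto_const \<alpha>) auto
    then have c: "c \<longlonglongrightarrow> 1" using E by simp
    have \<alpha>pos: "\<forall>\<^sub>F N in sequentially. \<alpha> N > 0" using order_tendstoD(1)[OF \<alpha>, of 0] E by simp
    define A where "A n = (LINT x|mT. (g n x)\<^sup>2)" for n
    \<comment> \<open>Parallelogram law for the two gradients. In the limit the right-hand side is
      \<open>2 * J + 2 * J - 4 * J\<close>, which contradicts a fixed gap \<epsilon>.\<close>
    have bnd: "\<forall>\<^sub>F N in sequentially. \<epsilon> \<le> 2 * A (p N) + 2 * A (q N) - 4 * ((I - (c N) ^ 3 * \<beta> N) / (c N)\<^sup>2)"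
      using \<alpha>pos
    proof eventually_elim
      case (elim N)
      have cp: "c N > 0" using elim E by (simp add: c_def)
      have "admissible E (\<lambda>x. c N * a N x) (\<lambda>x. c N * b N x)"
        using admissible_scale[OF Hab a0 _ E] elim unfolding \<alpha>_def c_def by blast
      then have "I \<le> energy (\<lambda>x. c N * a N x) (\<lambda>x. c N * b N x)" by (rule I)
      also have "\<dots> = (c N)\<^sup>2 * (LINT x|mT. (b N x)\<^sup>2) + (c N) ^ 3 * \<beta> N"
        unfolding \<beta>_def by (rule energy_scale[OF Hab])
      finally have lb: "(I - (c N) ^ 3 * \<beta> N) / (c N)\<^sup>2 \<le> (LINT x|mT. (b N x)\<^sup>2)"
        using cp by (simp add: divide_le_eq algebra_simps)
      have bi: "integrable mT (\<lambda>x. (b N x)\<^sup>2)" using H1D(2)[OF Hab] by (simp add: L2_T_iff)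
      have "(LINT x|mT. (g (p N) x - g (q N) x)\<^sup>2)
          = (LINT x|mT. 2 * (g (p N) x)\<^sup>2 + 2 * (g (q N) x)\<^sup>2 - 4 * (b N x)\<^sup>2)"
        by (intro Bochner_Integration.integral_cong) (auto simp: b_def power2_eq_square algebra_simps)
      also have "\<dots> = 2 * A (p N) + 2 * A (q N) - 4 * (LINT x|mT. (b N x)\<^sup>2)"
        using g2 bi by (simp add: A_def)
      finally show ?case using pq(3)[of N] lb by linarith
    qed
    have "(\<lambda>N. 2 * A (p N) + 2 * A (q N) - 4 * ((I - (c N) ^ 3 * \<beta> N) / (c N)\<^sup>2)) \<longlonglongrightarrow>
        2 * J + 2 * J - 4 * ((I - 1 ^ 3 * I3) / 1\<^sup>2)"
    proof -
      have "(\<lambda>N. A (p N)) \<longlonglongrightarrow> J" "(\<lambda>N. A (q N)) \<longlonglongrightarrow> J"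
        unfolding A_def by (rule filterlim_compose[OF Jlim fp(1)], rule filterlim_compose[OF Jlim fp(2)])
      moreover have "(\<lambda>N. (I - (c N) ^ 3 * \<beta> N) / (c N)\<^sup>2) \<longlonglongrightarrow> (I - 1 ^ 3 * I3) / 1\<^sup>2"
        by (intro tendsto_divide tendsto_diff tendsto_mult tendsto_power c \<beta> tendsto_const) simp
      ultimately show ?thesis by (intro tendsto_diff tendsto_add tendsto_mult_left)
    qed
    then have "\<epsilon> \<le> 2 * J + 2 * J - 4 * ((I - 1 ^ 3 * I3) / 1\<^sup>2)"
      by (rule tendsto_lowerbound[OF _ bnd]) auto
    then show False using \<epsilon> by (simp add: J_def)
  qed
  obtain h r where h: "h \<in> L2_T" "strict_mono (r :: nat \<Rightarrow> nat)" "(LINT x|mT. (h x)\<^sup>2) \<le> J"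
    "\<And>x. (\<lambda>n. LINT t|mT. indicat_real {..x} t * g (r n) t) \<longlonglongrightarrow> (LINT t|mT. indicat_real {..x} t * h t)"
    by (rule L2_Cauchy_limit[OF gL Cau Jlim]) (assumption, rule that)
  have wr: "(\<lambda>n. v (r n) x) \<longlonglongrightarrow> w x" for x
    using LIMSEQ_subseq_LIMSEQ[OF w h(2)] by (simp add: o_def)
  have "H1 w h"
    unfolding H1_def
  proof (intro conjI ballI)
    fix x assume x: "x \<in> TT"
    have "(\<lambda>n. v (r n) (-1/2) + (LINT t|mT. indicat_real {..x} t * g (r n) t)) \<longlonglongrightarrow>
        w (-1/2) + (LINT t|mT. indicat_real {..x} t * h t)"
      by (intro tendsto_add wr h(4))
    moreover have "(\<lambda>n. v (r n) (-1/2) + (LINT t|mT. indicat_real {..x} t * g (r n) t)) = (\<lambda>n. v (r n) x)"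
      by (rule ext) (rule H1D(4)[OF Hn(1) x, symmetric])
    ultimately show "w x = w (-1/2) + (LINT t|mT. indicat_real {..x} t * h t)"
      using LIMSEQ_unique[OF wr] by simp
  qed (use perw h in auto)
  then have "admissible E w h" using w0 w2 by (simp add: admissible_def)
  moreover have "energy w h \<le> I" using h(3) by (simp add: energy_def J_def I3_def)
  ultimately show thesis using that I by (meson order_trans)
qed

section \<open>The Euler-Lagrange equation\<close>

lemma H1_cong_AE:
  assumes w: "H1 w h" and g: "g \<in> L2_T" "AE x in mT. h x = g x"
  shows "H1 w g"
  unfolding H1_def
proof (intro conjI ballI)
  fix x assume x: "x \<in> TT"
  have m: "(\<lambda>t. indicat_real {..x} t * h t) \<in> borel_measurable mT" "(\<lambda>t. indicat_real {..x} t * g t) \<in> borel_measurable mT"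
    using H1D(2)[OF w] g(1) by (auto simp: L2_T_iff intro!: borel_measurable_times indicator_mT)
  have "(LINT t|mT. indicat_real {..x} t * h t) = (LINT t|mT. indicat_real {..x} t * g t)"
    by (rule integral_cong_AE[OF m]) (use g(2) in \<open>eventually_elim, simp\<close>)
  then show "w x = w (-1/2) + (LINT t|mT. indicat_real {..x} t * g t)"
    using H1D(4)[OF w x] by simp
qed (use H1D(1)[OF w] g in auto)

text \<open>The perturbation \<open>w + \<epsilon> * \<phi>\<close> violates the constraint and is
  rescaled by \<open>sqrt (2 * E / A \<epsilon>)\<close>. The energy of the rescaled function is an
  explicit differentiable function of \<epsilon> with a local minimum at 0; the derivative of the
  scaling factor produces the Lagrange multiplier on the right-hand side.\<close>

lemma Euler_Lagrange_weak:
  assumes E: "E > 0" and adm: "admissible E w h"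
    and min: "\<And>v g. admissible E v g \<Longrightarrow> energy w h \<le> energy v g"
    and \<phi>: "H1 \<phi> \<psi>" "(LINT x|mT. \<phi> x) = 0"
  shows "2 * (LINT x|mT. h x * \<psi> x) + 3 * (LINT x|mT. (w x)\<^sup>2 * \<phi> x)
    = ((LINT x|mT. (h x)\<^sup>2) + 3/2 * (LINT x|mT. (w x) ^ 3)) / E * (LINT x|mT. w x * \<phi> x)"
proof -
  have w: "H1 w h" "(LINT x|mT. w x) = 0" "(LINT x|mT. (w x)\<^sup>2) = 2 * E"
    using adm by (auto simp: admissible_def)
  note wc = H1_continuous[OF w(1)] and \<phi>c = H1_continuous[OF \<phi>(1)]
  have i: "integrable mT (\<lambda>x. (w x)\<^sup>2)" "integrable mT (\<lambda>x. w x * \<phi> x)" "integrable mT (\<lambda>x. (\<phi> x)\<^sup>2)"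
    "integrable mT (\<lambda>x. (w x) ^ 3)" "integrable mT (\<lambda>x. (w x)\<^sup>2 * \<phi> x)" "integrable mT (\<lambda>x. w x * (\<phi> x)\<^sup>2)"
    "integrable mT (\<lambda>x. (\<phi> x) ^ 3)" "integrable mT w" "integrable mT \<phi>"
    by (intro continuous_integrable_mT continuous_intros wc \<phi>c)+
  have j: "integrable mT (\<lambda>x. (h x)\<^sup>2)" "integrable mT (\<lambda>x. h x * \<psi> x)" "integrable mT (\<lambda>x. (\<psi> x)\<^sup>2)"
    using H1D(2)[OF w(1)] H1D(2)[OF \<phi>(1)] L2_lincomb(2) by (auto simp: L2_T_iff)
  define a where "a = (LINT x|mT. w x * \<phi> x)"
  define a2 where "a2 = (LINT x|mT. (\<phi> x)\<^sup>2)"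
  define N0 where "N0 = (LINT x|mT. (h x)\<^sup>2)"
  define n1 where "n1 = (LINT x|mT. h x * \<psi> x)"
  define n2 where "n2 = (LINT x|mT. (\<psi> x)\<^sup>2)"
  define T0 where "T0 = (LINT x|mT. (w x) ^ 3)"
  define t1 where "t1 = (LINT x|mT. (w x)\<^sup>2 * \<phi> x)"
  define t2 where "t2 = (LINT x|mT. w x * (\<phi> x)\<^sup>2)"
  define t3 where "t3 = (LINT x|mT. (\<phi> x) ^ 3)"
  define A where "A \<epsilon> = 2 * E + 2 * \<epsilon> * a + \<epsilon>\<^sup>2 * a2" for \<epsilon>
  define N where "N \<epsilon> = N0 + 2 * \<epsilon> * n1 + \<epsilon>\<^sup>2 * n2" for \<epsilon>
  define T where "T \<epsilon> = T0 + 3 * \<epsilon> * t1 + 3 * \<epsilon>\<^sup>2 * t2 + \<epsilon> ^ 3 * t3" for \<epsilon>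
  have A_eq: "(LINT x|mT. (1 * w x + \<epsilon> * \<phi> x)\<^sup>2) = A \<epsilon>" for \<epsilon>
  proof -
    have "(LINT x|mT. (1 * w x + \<epsilon> * \<phi> x)\<^sup>2) = (LINT x|mT. (w x)\<^sup>2 + 2 * \<epsilon> * (w x * \<phi> x) + \<epsilon>\<^sup>2 * (\<phi> x)\<^sup>2)"
      by (intro Bochner_Integration.integral_cong) (auto simp: power2_eq_square algebra_simps)
    also have "\<dots> = A \<epsilon>" using i w(3) by (simp add: A_def a_def a2_def)
    finally show ?thesis .
  qed
  have N_eq: "(LINT x|mT. (1 * h x + \<epsilon> * \<psi> x)\<^sup>2) = N \<epsilon>" for \<epsilon>
  proof -
    have "(LINT x|mT. (1 * h x + \<epsilon> * \<psi> x)\<^sup>2) = (LINT x|mT. (h x)\<^sup>2 + 2 * \<epsilon> * (h x * \<psi> x) + \<epsilon>\<^sup>2 * (\<psi> x)\<^sup>2)"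
      by (intro Bochner_Integration.integral_cong) (auto simp: power2_eq_square algebra_simps)
    also have "\<dots> = N \<epsilon>" using j by (simp add: N_def N0_def n1_def n2_def)
    finally show ?thesis .
  qed
  have T_eq: "(LINT x|mT. (1 * w x + \<epsilon> * \<phi> x) ^ 3) = T \<epsilon>" for \<epsilon>
  proof -
    have "(LINT x|mT. (1 * w x + \<epsilon> * \<phi> x) ^ 3) = (LINT x|mT. (w x) ^ 3 + 3 * \<epsilon> * ((w x)\<^sup>2 * \<phi> x)
        + 3 * \<epsilon>\<^sup>2 * (w x * (\<phi> x)\<^sup>2) + \<epsilon> ^ 3 * (\<phi> x) ^ 3)"
      by (intro Bochner_Integration.integral_cong) (auto simp: power2_eq_square power3_eq_cube algebra_simps)
    also have "\<dots> = T \<epsilon>" using i by (simp add: T_def T0_def t1_def t2_def t3_def)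
    finally show ?thesis .
  qed
  define f where "f \<epsilon> = (2 * E / A \<epsilon>) * N \<epsilon> + (2 * E / A \<epsilon>) * sqrt (2 * E / A \<epsilon>) * T \<epsilon>" for \<epsilon>
  have f0: "f 0 = energy w h" using E by (simp add: f_def A_def N_def T_def energy_def N0_def T0_def)
  have fmin: "f 0 \<le> f \<epsilon>" if "A \<epsilon> > 0" for \<epsilon>
  proof -
    have H: "H1 (\<lambda>x. 1 * w x + \<epsilon> * \<phi> x) (\<lambda>x. 1 * h x + \<epsilon> * \<psi> x)" by (rule H1_lincomb[OF w(1) \<phi>(1)])
    have 0: "(LINT x|mT. 1 * w x + \<epsilon> * \<phi> x) = 0" using i w(2) \<phi>(2) by simp
    define c where "c = sqrt (2 * E / A \<epsilon>)"
    have c2: "c\<^sup>2 = 2 * E / A \<epsilon>" using that E by (simp add: c_def)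
    have "admissible E (\<lambda>x. c * (1 * w x + \<epsilon> * \<phi> x)) (\<lambda>x. c * (1 * h x + \<epsilon> * \<psi> x))"
      using admissible_scale[OF H 0 _ E] that unfolding A_eq c_def by simp
    from min[OF this] have "energy w h \<le> c\<^sup>2 * N \<epsilon> + c ^ 3 * T \<epsilon>"
      unfolding energy_scale[OF H] N_eq T_eq .
    moreover have "c ^ 3 = c\<^sup>2 * c" by (simp add: power3_eq_cube power2_eq_square)
    ultimately have "energy w h \<le> c\<^sup>2 * N \<epsilon> + c\<^sup>2 * c * T \<epsilon>" by simp
    then show ?thesis unfolding f0 c2 unfolding f_def c_def .
  qed
  have "A \<midarrow>0\<rightarrow> A 0" unfolding A_def by (intro tendsto_intros)
  moreover have "A 0 > 0" using E by (simp add: A_def)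
  ultimately have "\<forall>\<^sub>F \<epsilon> in at 0. A \<epsilon> > 0" by (rule order_tendstoD)
  then obtain d where d: "d > 0" "\<And>\<epsilon>. \<epsilon> \<noteq> 0 \<Longrightarrow> \<bar>\<epsilon>\<bar> < d \<Longrightarrow> A \<epsilon> > 0"
    by (auto simp: eventually_at dist_real_def)
  have lm: "f 0 \<le> f y" if "\<bar>0 - y\<bar> < d" for y
    using d(2)[of y] that fmin[of y] by (cases "y = 0") auto
  have dA: "(A has_real_derivative 2 * a) (at 0)"
    unfolding A_def by (auto intro!: derivative_eq_intros)
  have dN: "(N has_real_derivative 2 * n1) (at 0)"
    unfolding N_def by (auto intro!: derivative_eq_intros)
  have dT: "(T has_real_derivative 3 * t1) (at 0)"
    unfolding T_def by (auto intro!: derivative_eq_intros)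
  have A0: "A 0 = 2 * E" "N 0 = N0" "T 0 = T0" by (simp_all add: A_def N_def T_def)
  have dq: "((\<lambda>\<epsilon>. 2 * E / A \<epsilon>) has_real_derivative - a / E) (at 0)"
    by (rule derivative_eq_intros dA refl)+ (use E A0 in \<open>auto simp: field_simps\<close>)
  have ds: "((\<lambda>\<epsilon>. sqrt (2 * E / A \<epsilon>)) has_real_derivative - a / (2 * E)) (at 0)"
  proof -
    have 1: "2 * E / A 0 = 1" using A0 E by simp
    have "(sqrt has_real_derivative 1/2) (at (2 * E / A 0))"
      unfolding 1 using DERIV_real_sqrt[of 1] by simp
    from DERIV_cong[OF DERIV_chain2[OF this dq]] show ?thesis by simp
  qed
  have "(f has_real_derivative 2 * n1 - a / E * N0 + 3 * t1 - 3/2 * (a / E) * T0) (at 0)"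
    unfolding f_def
    by (rule DERIV_cong[OF DERIV_add[OF DERIV_mult[OF dq dN] DERIV_mult[OF DERIV_mult[OF dq ds] dT]]])
       (use E A0 in \<open>simp add: field_simps\<close>)
  from DERIV_local_min[OF this d(1)] lm have "2 * n1 - a / E * N0 + 3 * t1 - 3/2 * (a / E) * T0 = 0" by blast
  then show ?thesis unfolding n1_def[symmetric] t1_def[symmetric] a_def[symmetric] N0_def[symmetric] T0_def[symmetric]
  proof -
    have "(N0 + 3/2 * T0) / E * a = a / E * N0 + 3/2 * (a / E) * T0" using E by (simp add: field_simps)
    then show "2 * n1 + 3 * t1 = (N0 + 3/2 * T0) / E * a"
      using \<open>2 * n1 - a / E * N0 + 3 * t1 - 3/2 * (a / E) * T0 = 0\<close> by linarith
  qed
qed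

text \<open>For a minimizer, \<beta> is the multiplier of the energy constraint and \<gamma> that of
  the mean-zero constraint. Both stay free, so that rescaled and shifted solutions and the lattice
  sums fit the same notion.\<close>

definition stationary :: "(real \<Rightarrow> real) \<Rightarrow> (real \<Rightarrow> real) \<Rightarrow> real \<Rightarrow> real \<Rightarrow> bool" where
  "stationary f f' \<beta> \<gamma> \<longleftrightarrow> (\<forall>x. (f has_real_derivative f' x) (at x)) \<and>
     (\<forall>x. (f' has_real_derivative 3/2 * (f x)\<^sup>2 + \<beta> * f x + \<gamma>) (at x))"

text \<open>The weak equation says that \<open>h\<close> has a weak derivative that is a continuous
  function of \<open>w\<close>. By \<open>H1_of_weak_orth\<close>, \<open>h\<close> has a continuous
  version with this derivative, so a single regularity step makes the equation classical.\<close>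

lemma minimizer_stationary:
  assumes E: "E > 0" and adm: "admissible E w h"
    and min: "\<And>v g. admissible E v g \<Longrightarrow> energy w h \<le> energy v g"
  obtains w' \<beta> \<gamma> where "stationary w w' \<beta> \<gamma>" "AE x in mT. h x = w' x" "H1 w w'"
proof -
  have w: "H1 w h" "(LINT x|mT. w x) = 0" using adm by (auto simp: admissible_def)
  note wc = H1_continuous[OF w(1)]
  define l where "l = ((LINT x|mT. (h x)\<^sup>2) + 3/2 * (LINT x|mT. (w x) ^ 3)) / E"
  define W where "W = (LINT x|mT. (w x)\<^sup>2)"
  \<comment> \<open>The weak equation holds only against functions of mean zero, so a test function
    is used after subtracting its mean \<open>m\<close>. The constant \<open>- 3/2 * W\<close>
    compensates for this; it also makes the mean of \<open>f\<close> vanish.\<close>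
  define f where "f x = 3/2 * (w x)\<^sup>2 + (- l / 2) * w x + (- 3/2 * W)" for x
  have fc: "continuous_on A f" for A unfolding f_def by (intro continuous_intros wc)
  have perf: "per1 f" using H1D(1)[OF w(1)] by (simp add: per1_def f_def)
  obtain w' where w': "H1 w' f" "AE x in mT. h x = w' x"
  proof (rule H1_of_weak_orth[of h f])
    show "integrable mT h" by (rule H1D(3)[OF w(1)])
    show "f \<in> L2_T" by (rule continuous_L2[OF fc])
    fix \<phi> assume \<phi>: "test_fun \<phi>"
    have cp: "continuous_on A \<phi>" for A using test_funD(2)[OF \<phi>, of _ 0] by simp
    define m where "m = (LINT x|mT. \<phi> x)"
    have ip: "integrable mT \<phi>" by (rule continuous_integrable_mT[OF cp])
    have H: "H1 (\<lambda>x. \<phi> x - m) (deriv \<phi>)"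
      using H1_test_fun[OF test_fun_diff_const(1)[OF \<phi>]] test_fun_diff_const(2)[OF \<phi>] by metis
    have m0: "(LINT x|mT. \<phi> x - m) = 0" using ip by (simp add: m_def mT.prob_space)
    have i: "integrable mT (\<lambda>x. (w x)\<^sup>2)" "integrable mT (\<lambda>x. (w x)\<^sup>2 * \<phi> x)" "integrable mT (\<lambda>x. w x * \<phi> x)"
      "integrable mT w"
      by (intro continuous_integrable_mT continuous_intros wc cp)+
    have e1: "(LINT x|mT. (w x)\<^sup>2 * (\<phi> x - m)) = (LINT x|mT. (w x)\<^sup>2 * \<phi> x) - m * W"
      using i by (simp add: right_diff_distrib W_def)
    have e2: "(LINT x|mT. w x * (\<phi> x - m)) = (LINT x|mT. w x * \<phi> x)"
      using i w(2) by (simp add: right_diff_distrib)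
    have "f x * \<phi> x = 3/2 * ((w x)\<^sup>2 * \<phi> x) + (- l / 2) * (w x * \<phi> x) + (- 3/2 * W) * \<phi> x" for x
      by (simp add: f_def algebra_simps)
    then have "(LINT x|mT. f x * \<phi> x) = 3/2 * (LINT x|mT. (w x)\<^sup>2 * \<phi> x) + (- l / 2) * (LINT x|mT. w x * \<phi> x) + (- 3/2 * W) * m"
      using i ip by (simp add: m_def)
    then show "(LINT x|mT. h x * deriv \<phi> x) = - (LINT x|mT. f x * \<phi> x)"
      using Euler_Lagrange_weak[OF E adm min H m0] unfolding e1 e2 l_def[symmetric]
      by (simp add: algebra_simps)
  qed
  note w'c = H1_continuous[OF w'(1)]
  have H: "H1 w w'" by (rule H1_cong_AE[OF w(1) continuous_L2[OF w'c] w'(2)])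
  have "stationary w w' (- l / 2) (- 3/2 * W)"
    unfolding stationary_def
  proof (intro conjI allI)
    show "(w has_real_derivative w' x) (at x)" for x
      by (rule H1_continuous_deriv[OF H H1D(1)[OF w'(1)] w'c])
    show "(w' has_real_derivative 3/2 * (w x)\<^sup>2 + - l / 2 * w x + - 3/2 * W) (at x)" for x
      using H1_continuous_deriv[OF w'(1) perf fc, of x] by (simp add: f_def)
  qed
  then show thesis using that w'(2) H by blast
qed

section \<open>Translating and stretching periodic functions\<close>

lemma DERIV_at_shift:
  fixes F :: "real \<Rightarrow> real"
  assumes "\<And>x. (F has_real_derivative f x) (at x)"
  shows "((\<lambda>x. F (x + s)) has_real_derivative f (x + s)) (at x)"
  using assms[of "x + s"] by (simp add: DERIV_shift)

lemma per1_shift_integral: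
  fixes f :: "real \<Rightarrow> real"
  assumes "per1 f" "continuous_on UNIV f"
  shows "(LINT x|mT. f (x + s)) = (LINT x|mT. f x)"
proof -
  obtain F where F: "\<And>x. (F has_real_derivative f x) (at x)" using continuous_antiderivative[OF assms(2)] by blast
  have "(LINT x|mT. f (x + s)) = F (1/2 + s) - F (-1/2 + s)"
    by (rule integral_mT_FTC') (auto intro!: DERIV_at_shift F continuous_on_compose2[OF assms(2)] continuous_intros)
  moreover have "((\<lambda>s. F (1/2 + s) - F (-1/2 + s)) has_real_derivative 0) (at s)" for s
  proof -
    from DERIV_diff[OF DERIV_at_shift[OF F, of "1/2" s] DERIV_at_shift[OF F, of "-1/2" s]] show ?thesis using assms(1)[unfolded per1_def, rule_format, of "-1/2 + s"] by (simp add: algebra_simps)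
  qed
  then have "F (1/2 + s) - F (-1/2 + s) = F (1/2 + 0) - F (-1/2 + 0)" by (rule DERIV_isconst_all[rule_format])
  moreover have "(LINT x|mT. f x) = F (1/2) - F (-1/2)" by (rule integral_mT_FTC'[OF F assms(2)])
  ultimately show ?thesis by simp
qed

text \<open>A primitive gains the same amount \<open>c\<close> over each of the \<open>n\<close>
  subperiods, so the full period gives \<open>n * c\<close>, and so does one subperiod stretched by
  \<open>n\<close>.\<close>

lemma stretch_integral:
  fixes f :: "real \<Rightarrow> real"
  assumes "continuous_on UNIV f" "\<And>x. f (x + 1 / real n) = f x" "n \<ge> 1"
  shows "(LINT x|mT. f (x / real n)) = (LINT x|mT. f x)"
proof -
  obtain F where F: "\<And>x. (F has_real_derivative f x) (at x)" using continuous_antiderivative[OF assms(1)] by blast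
  define c where "c = F (0 + 1 / real n) - F 0"
  have "((\<lambda>x. F (x + 1 / real n) - F x) has_real_derivative 0) (at x)" for x
    using DERIV_diff[OF DERIV_at_shift[OF F, of "1 / real n" x] F[of x]] assms(2)[of x] by simp
  then have c: "F (x + 1 / real n) = F x + c" for x
    using DERIV_isconst_all[of "\<lambda>x. F (x + 1 / real n) - F x" x 0] by (simp add: c_def)
  have cm: "F (x + real m / real n) = F x + real m * c" for x and m :: nat
  proof (induction m)
    case (Suc m)
    have "F (x + real (Suc m) / real n) = F ((x + real m / real n) + 1 / real n)" by (simp add: add_divide_distrib algebra_simps)
    then show ?case using Suc c[of "x + real m / real n"] by (simp add: algebra_simps)
  qed simp
  have "(LINT x|mT. f (x / real n)) = real n * F ((1/2) / real n) - real n * F ((-1/2) / real n)"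
  proof (rule integral_mT_FTC')
    show "((\<lambda>x. real n * F (x / real n)) has_real_derivative f (x / real n)) (at x)" for x
      using assms(3) DERIV_cmult[OF DERIV_chain2[OF F DERIV_cdivide[OF DERIV_ident]], of "real n" "real n" x UNIV] by simp
    show "continuous_on UNIV (\<lambda>x. f (x / real n))"
      using assms(3) by (intro continuous_on_compose2[OF assms(1)] continuous_intros) auto
  qed
  also have "F ((1/2) / real n) = F ((-1/2) / real n) + c"
    using c[of "(-1/2) / real n"] by (simp add: diff_divide_distrib[symmetric] add_divide_distrib[symmetric])
  also have "real n * (F ((-1/2) / real n) + c) - real n * F ((-1/2) / real n) = real n * c" by (simp add: algebra_simps)
  also have "\<dots> = F (1/2) - F (-1/2)" using cm[of "-1/2" n] assms(3) by simp
  also have "\<dots> = (LINT x|mT. f x)" by (rule integral_mT_FTC'[OF F assms(1), symmetric])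
  finally show ?thesis .
qed

lemma stationaryD:
  assumes "stationary f f' \<beta> \<gamma>"
  shows "(f has_real_derivative f' x) (at x)" "(f' has_real_derivative 3/2 * (f x)\<^sup>2 + \<beta> * f x + \<gamma>) (at x)"
    "continuous_on A f" "continuous_on A f'"
  using assms by (auto simp: stationary_def intro!: continuous_at_imp_continuous_on DERIV_isCont)

lemma admissible_shift:
  assumes "admissible E w w'" "\<And>x. (w has_real_derivative w' x) (at x)" "continuous_on UNIV w'"
  shows "admissible E (\<lambda>x. w (x + s)) (\<lambda>x. w' (x + s))" "energy (\<lambda>x. w (x + s)) (\<lambda>x. w' (x + s)) = energy w w'"
proof -
  have w: "H1 w w'" "(LINT x|mT. w x) = 0" "(LINT x|mT. (w x)\<^sup>2) = 2 * E"
    using assms(1) by (auto simp: admissible_def)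
  have per: "per1 w" by (rule H1D(1)[OF w(1)])
  have per': "per1 w'"
    unfolding per1_def
  proof
    fix x
    have "((\<lambda>x. w (x + 1)) has_real_derivative w' (x + 1)) (at x)" using assms(2)[of "x + 1"] by (simp add: DERIV_shift)
    then show "w' (x + 1) = w' x" using per DERIV_unique[OF assms(2)[of x]] by (simp add: per1_def)
  qed
  note c = H1_continuous[OF w(1), of UNIV]
  have H: "H1 (\<lambda>x. w (x + s)) (\<lambda>x. w' (x + s))"
  proof (rule H1_C1)
    show "per1 (\<lambda>x. w (x + s))" using per[unfolded per1_def, rule_format, of "_ + s"] by (simp add: per1_def add_ac)
    show "((\<lambda>x. w (x + s)) has_real_derivative w' (x + s)) (at x)" for x
      using assms(2)[of "x + s"] by (simp add: DERIV_shift)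
    show "continuous_on UNIV (\<lambda>x. w' (x + s))" by (intro continuous_on_compose2[OF assms(3)] continuous_intros) auto
  qed
  have "(LINT x|mT. w (x + s)) = 0" using per1_shift_integral[OF per c] w by simp
  moreover have "(LINT x|mT. (w (x + s))\<^sup>2) = 2 * E"
    using per1_shift_integral[of "\<lambda>x. (w x)\<^sup>2" s] per c w(3) by (simp add: per1_def continuous_on_power)
  ultimately show "admissible E (\<lambda>x. w (x + s)) (\<lambda>x. w' (x + s))" using H by (simp add: admissible_def)
  show "energy (\<lambda>x. w (x + s)) (\<lambda>x. w' (x + s)) = energy w w'"
    using per1_shift_integral[of "\<lambda>x. (w' x)\<^sup>2" s] per1_shift_integral[of "\<lambda>x. (w x) ^ 3" s] per per' c assms(3)
    by (simp add: per1_def continuous_on_power energy_def)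
qed

text \<open>Stretching a period of length \<open>1 / n\<close> to the whole circle keeps the constraints and the cubic
  term but divides the gradient term by \<open>n\<^sup>2\<close>.\<close>
lemma minimizer_no_subperiod:
  assumes E: "E > 0" and adm: "admissible E w w'"
    and min: "\<And>v g. admissible E v g \<Longrightarrow> energy w w' \<le> energy v g"
    and D: "\<And>x. (w has_real_derivative w' x) (at x)" and c': "continuous_on UNIV w'"
    and n: "n \<ge> 1" "\<And>x. w (x + 1 / real n) = w x"
  shows "n = 1"
proof (rule ccontr)
  assume "n \<noteq> 1"
  then have n2: "n \<ge> 2" using n by simp
  have w: "H1 w w'" "(LINT x|mT. w x) = 0" "(LINT x|mT. (w x)\<^sup>2) = 2 * E"
    using adm by (auto simp: admissible_def)
  note c = H1_continuous[OF w(1), of UNIV]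
  have n': "w' (x + 1 / real n) = w' x" for x
  proof -
    have "((\<lambda>x. w (x + 1 / real n)) has_real_derivative w' (x + 1 / real n)) (at x)" using D[of "x + 1 / real n"] by (simp add: DERIV_shift)
    then show ?thesis using DERIV_unique[OF D[of x]] n(2) by simp
  qed
  define v where "v x = w (x / real n)" for x
  define g where "g x = w' (x / real n) / real n" for x
  have "H1 v g"
  proof (rule H1_C1)
    show "per1 v" unfolding per1_def v_def
    proof
      fix x show "w ((x + 1) / real n) = w (x / real n)" using n(2)[of "x / real n"] by (simp add: add_divide_distrib)
    qed
    show "(v has_real_derivative g x) (at x)" for x unfolding v_def g_def
      using n(1) DERIV_chain2[OF D DERIV_cdivide[OF DERIV_ident], of "real n" x UNIV] by simp
    show "continuous_on UNIV g" unfolding g_def using n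
      by (intro continuous_on_divide continuous_on_const continuous_on_compose2[OF c'] continuous_intros) auto
  qed
  moreover have "(LINT x|mT. v x) = 0" unfolding v_def using stretch_integral[OF c n(2,1)] w(2) by simp
  moreover have "(LINT x|mT. (v x)\<^sup>2) = 2 * E"
    unfolding v_def using stretch_integral[of "\<lambda>x. (w x)\<^sup>2" n] c n w(3) by (simp add: continuous_on_power)
  ultimately have "admissible E v g" by (simp add: admissible_def)
  from min[OF this] have le: "energy w w' \<le> energy v g" .
  have "(LINT x|mT. (v x) ^ 3) = (LINT x|mT. (w x) ^ 3)"
    unfolding v_def using stretch_integral[of "\<lambda>x. (w x) ^ 3" n] c n by (simp add: continuous_on_power)
  moreover have "(LINT x|mT. (g x)\<^sup>2) = (LINT x|mT. (w' x)\<^sup>2) / (real n)\<^sup>2"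
    unfolding g_def using stretch_integral[of "\<lambda>x. (w' x)\<^sup>2" n] c' n n' by (simp add: continuous_on_power power_divide)
  ultimately have "(LINT x|mT. (w' x)\<^sup>2) \<le> (LINT x|mT. (w' x)\<^sup>2) / (real n)\<^sup>2"
    using le by (simp add: energy_def)
  then have "(LINT x|mT. (w' x)\<^sup>2) * (real n)\<^sup>2 \<le> (LINT x|mT. (w' x)\<^sup>2) * 1"
    using n by (simp add: field_simps)
  moreover have "(real n)\<^sup>2 > 1" using n2 by (simp add: one_less_power)
  moreover have "(LINT x|mT. (w' x)\<^sup>2) \<ge> 0" by simp
  ultimately have "(LINT x|mT. (w' x)\<^sup>2) = 0"
    by (metis mult_le_cancel_left_pos not_le order_le_less)
  then have w'0: "w' x = 0" if "x \<in> TT" for x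
    using continuous_TT_integral_square_0[of w' x] c' that continuous_on_subset by blast
  have "w x = w (-1/2)" if "x \<in> TT" for x
  proof -
    have "(LINT t|mT. indicat_real {..x} t * w' t) = (LINT t|mT. 0)"
      by (intro Bochner_Integration.integral_cong) (auto simp: space_mT w'0)
    then show ?thesis using H1D(4)[OF w(1) that] by simp
  qed
  then have "(LINT x|mT. w x) = (LINT x|mT. w (-1/2))" "(LINT x|mT. (w x)\<^sup>2) = (LINT x|mT. (w (-1/2))\<^sup>2)"
    by (metis (no_types, lifting) Bochner_Integration.integral_cong space_mT)+
  then show False using w E by (simp add: mT.prob_space)
qed

section \<open>Periodic solutions of the Euler-Lagrange equation\<close>

text \<open>The bound on \<open>\<bar>D'\<bar>\<close> is two-sided, so the integrating factor
  \<open>exp (- C * x)\<close> works to the right of \<open>a\<close> and \<open>exp (C * x)\<close>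
  to its left.\<close>

lemma Gronwall_zero:
  fixes D D' :: "real \<Rightarrow> real"
  assumes D: "\<And>x. (D has_real_derivative D' x) (at x)" and b: "\<And>x. \<bar>D' x\<bar> \<le> C * D x"
    and "\<And>x. D x \<ge> 0" "D a = 0"
  shows "D x = 0"
proof (cases "a \<le> x")
  case True
  have "D x * exp (- C * x) \<le> D a * exp (- C * a)"
  proof (rule DERIV_nonpos_imp_nonincreasing[OF True])
    fix y
    have "((\<lambda>y. D y * exp (- C * y)) has_real_derivative D' y * exp (- C * y) + (exp (- C * y) * (- C)) * D y) (at y)"
      by (auto intro!: derivative_eq_intros D)
    moreover have "D' y * exp (- C * y) + (exp (- C * y) * (- C)) * D y = (D' y - C * D y) * exp (- C * y)"
      by (simp add: algebra_simps)
    moreover have "\<dots> \<le> 0" using b[of y] by (intro mult_nonpos_nonneg) auto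
    ultimately show "\<exists>z. ((\<lambda>y. D y * exp (- C * y)) has_real_derivative z) (at y) \<and> z \<le> 0" by auto
  qed
  then show ?thesis using assms(3)[of x] assms(4) by (simp add: mult_le_0_iff)
next
  case False
  then have "x \<le> a" by simp
  have "D x * exp (C * x) \<le> D a * exp (C * a)"
  proof (rule DERIV_nonneg_imp_nondecreasing[OF \<open>x \<le> a\<close>])
    fix y
    have "((\<lambda>y. D y * exp (C * y)) has_real_derivative D' y * exp (C * y) + (exp (C * y) * C) * D y) (at y)"
      by (auto intro!: derivative_eq_intros D)
    moreover have "D' y * exp (C * y) + (exp (C * y) * C) * D y = (D' y + C * D y) * exp (C * y)"
      by (simp add: algebra_simps)
    moreover have "\<dots> \<ge> 0" using b[of y] by (intro mult_nonneg_nonneg) auto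
    ultimately show "\<exists>z. ((\<lambda>y. D y * exp (C * y)) has_real_derivative z) (at y) \<and> 0 \<le> z" by auto
  qed
  then show ?thesis using assms(3)[of x] assms(4) by (simp add: mult_le_0_iff)
qed

text \<open>The quadratic right-hand side is only locally Lipschitz; the common bound
  \<open>B\<close> makes it Lipschitz along both solutions. The Gronwall argument is applied to the
  squared distance in the phase plane, with \<open>2 * p * q\<close> bounded by the sum of
  squares.\<close>

lemma stationary_unique:
  assumes f: "stationary f f' \<beta> \<gamma>" and g: "stationary g g' \<beta> \<gamma>"
    and bf: "\<And>x. \<bar>f x\<bar> \<le> B" and bg: "\<And>x. \<bar>g x\<bar> \<le> B" and eq: "f a = g a" "f' a = g' a"
  shows "f x = g x"
proof -
  define D where "D x = (f x - g x)\<^sup>2 + (f' x - g' x)\<^sup>2" for x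
  define D' where "D' x = 2 * (f x - g x) * (f' x - g' x) +
    2 * (f' x - g' x) * (3/2 * (f x)\<^sup>2 + \<beta> * f x + \<gamma> - (3/2 * (g x)\<^sup>2 + \<beta> * g x + \<gamma>))" for x
  define C where "C = 1 + (3 * B + \<bar>\<beta>\<bar>)"
  have "D x = 0"
  proof (rule Gronwall_zero[where D = D and D' = D' and C = C and a = a])
    show "(D has_real_derivative D' x) (at x)" for x
      unfolding D_def D'_def
      by (rule derivative_eq_intros stationaryD(1,2)[OF f] stationaryD(1,2)[OF g] refl)+ (simp add: algebra_simps)
    show "\<bar>D' x\<bar> \<le> C * D x" for x
    proof -
      define p where "p = f x - g x"
      define q where "q = f' x - g' x"
      have e: "D' x = 2 * p * q * (1 + (3/2 * (f x + g x) + \<beta>))"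
      proof -
        have "3/2 * u\<^sup>2 + \<beta> * u + \<gamma> - (3/2 * v\<^sup>2 + \<beta> * v + \<gamma>) = (u - v) * (3/2 * (u + v) + \<beta>)" for u v
          by (simp add: field_simps power2_eq_square)
        from this[of "f x" "g x"] show ?thesis
          unfolding D'_def p_def[symmetric] q_def[symmetric] by (simp add: algebra_simps)
      qed
      have "\<bar>1 + (3/2 * (f x + g x) + \<beta>)\<bar> \<le> C"
      proof -
        have "f x \<le> B" "- B \<le> f x" "g x \<le> B" "- B \<le> g x" "\<beta> \<le> \<bar>\<beta>\<bar>" "- \<beta> \<le> \<bar>\<beta>\<bar>"
          using bf[of x] bg[of x] by (simp_all add: abs_le_iff)
        then show ?thesis unfolding C_def abs_le_iff by (intro conjI; argo)
      qed
      moreover have "\<bar>2 * p * q\<bar> \<le> D x"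
      proof -
        have "0 \<le> (\<bar>p\<bar> - \<bar>q\<bar>)\<^sup>2" by simp
        then show ?thesis unfolding D_def p_def[symmetric] q_def[symmetric]
          by (simp add: power2_diff abs_mult)
      qed
      ultimately have "\<bar>2 * p * q\<bar> * \<bar>1 + (3/2 * (f x + g x) + \<beta>)\<bar> \<le> D x * C"
        by (intro mult_mono) (auto simp: D_def)
      then show ?thesis unfolding e abs_mult by (simp add: mult.commute)
    qed
    show "D x \<ge> 0" for x by (simp add: D_def)
    show "D a = 0" using eq by (simp add: D_def)
  qed
  then show ?thesis by (simp add: D_def sum_power2_eq_zero_iff)
qed

text \<open>Conservation of mechanical energy: twice the right-hand side of the equation is the
  derivative of the cubic in \<open>f\<close>.\<close>

lemma stationary_first_integral:
  assumes f: "stationary f f' \<beta> \<gamma>"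
  obtains \<delta> where "\<And>x. (f' x)\<^sup>2 = (f x) ^ 3 + \<beta> * (f x)\<^sup>2 + 2 * \<gamma> * f x + \<delta>"
proof -
  define H where "H x = (f' x)\<^sup>2 - (f x) ^ 3 - \<beta> * (f x)\<^sup>2 - 2 * \<gamma> * f x" for x
  have "(H has_real_derivative 0) (at x)" for x
  proof -
    have "(H has_real_derivative 2 * f' x * (3/2 * (f x)\<^sup>2 + \<beta> * f x + \<gamma>) - 3 * (f x)\<^sup>2 * f' x
        - \<beta> * (2 * f x * f' x) - 2 * \<gamma> * f' x) (at x)"
      unfolding H_def by (rule derivative_eq_intros stationaryD(1,2)[OF f] refl)+ simp
    then show ?thesis by (simp add: algebra_simps)
  qed
  then have "H x = H 0" for x by (rule DERIV_isconst_all[rule_format])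
  then show thesis by (intro that[of "H 0"]) (simp add: H_def algebra_simps)
qed

lemma periodic_attains:
  fixes f :: "real \<Rightarrow> real"
  assumes c: "continuous_on UNIV f" and T: "T > 0" "\<And>x. f (x + T) = f x"
  obtains a b where "\<And>x. f a \<le> f x" "\<And>x. f x \<le> f b"
proof -
  have per: "per1 (\<lambda>x. f (T * x))" using T(2)[of "T * _"] by (simp add: per1_def distrib_left)
  have c': "continuous_on TT (\<lambda>x. f (T * x))"
    by (intro continuous_on_compose2[OF c] continuous_intros) auto
  have ne: "TT \<noteq> {}" by (auto simp: TT_def)
  obtain a where a: "a \<in> TT" "\<And>x. x \<in> TT \<Longrightarrow> f (T * a) \<le> f (T * x)"
    using continuous_attains_inf[OF compact_TT ne c'] by blast
  obtain b where b: "b \<in> TT" "\<And>x. x \<in> TT \<Longrightarrow> f (T * x) \<le> f (T * b)"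
    using continuous_attains_sup[OF compact_TT ne c'] by blast
  have "f (T * a) \<le> f x \<and> f x \<le> f (T * b)" for x
  proof -
    obtain n :: int where n: "x / T + of_int n \<in> TT" using TT_representative by blast
    have "f (T * (x / T + of_int n)) = f x" using per1_add_int[OF per, of "x / T" n] T by simp
    then show ?thesis using a(2)[OF n] b(2)[OF n] by simp
  qed
  then show thesis using that by blast
qed

lemma extremum_deriv_zero:
  fixes f :: "real \<Rightarrow> real"
  assumes "(f has_real_derivative D) (at a)" "(\<forall>x. f a \<le> f x) \<or> (\<forall>x. f x \<le> f a)"
  shows "D = 0"
  using assms DERIV_local_min[OF assms(1), of 1] DERIV_local_max[OF assms(1), of 1] by auto

text \<open>The data \<open>m < M < r\<close> are the roots of the cubic governing the first integral.\<close>
definition wave :: "(real \<Rightarrow> real) \<Rightarrow> (real \<Rightarrow> real) \<Rightarrow> real \<Rightarrow> real \<Rightarrow> real \<Rightarrow> bool" where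
  "wave f f' m M r \<longleftrightarrow> m < M \<and> M < r \<and> stationary f f' (- (m + M + r)) ((m * M + m * r + M * r) / 2) \<and>
     (\<forall>x. m \<le> f x \<and> f x \<le> M) \<and> (\<forall>x. (f' x)\<^sup>2 = (f x - m) * (f x - M) * (f x - r)) \<and> (\<exists>a. f a = m) \<and> (\<exists>b. f b = M)"

text \<open>Minimum and maximum values are roots of the cubic because \<open>f'\<close> vanishes
  there; the sum of the roots, which is \<open>- \<beta>\<close>, gives the third root
  \<open>r\<close>. All values strictly between \<open>m\<close> and \<open>M\<close> are taken, and
  nonnegativity of the squared slope there forces \<open>M <= r\<close>. If \<open>M = r\<close>,
  the constant \<open>M\<close> would solve the same equation, and \<open>f\<close> meets it with
  slope 0, so uniqueness would make \<open>f\<close> constant.\<close>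

lemma stationary_imp_wave:
  assumes f: "stationary f f' \<beta> \<gamma>" and T: "T > 0" "\<And>x. f (x + T) = f x" and nc: "f u \<noteq> f v"
  obtains m M r where "wave f f' m M r"
proof -
  note fc = stationaryD(3)[OF f]
  obtain a b where ab: "\<And>x. f a \<le> f x" "\<And>x. f x \<le> f b"
    using periodic_attains[OF fc T] by blast
  define m where "m = f a"
  define M where "M = f b"
  define r where "r = - \<beta> - m - M"
  have mM: "m < M" using nc ab[of u] ab[of v] unfolding m_def M_def by linarith
  have f'0: "f' a = 0" "f' b = 0"
    using extremum_deriv_zero[OF stationaryD(1)[OF f], of a] extremum_deriv_zero[OF stationaryD(1)[OF f], of b] ab by auto
  obtain \<delta> where \<delta>: "\<And>x. (f' x)\<^sup>2 = (f x) ^ 3 + \<beta> * (f x)\<^sup>2 + 2 * \<gamma> * f x + \<delta>"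
    using stationary_first_integral[OF f] by blast
  have 1: "m ^ 3 + \<beta> * m\<^sup>2 + 2 * \<gamma> * m + \<delta> = 0" using \<delta>[of a] f'0 by (simp add: m_def)
  have 2: "M ^ 3 + \<beta> * M\<^sup>2 + 2 * \<gamma> * M + \<delta> = 0" using \<delta>[of b] f'0 by (simp add: M_def)
  have \<beta>: "\<beta> = - (m + M + r)" by (simp add: r_def)
  have "(M - m) * (2 * \<gamma> - (m * M + m * r + M * r)) = 0"
  proof -
    have "(M - m) * (2 * \<gamma> - (m * M + m * r + M * r)) =
      (M ^ 3 + \<beta> * M\<^sup>2 + 2 * \<gamma> * M + \<delta>) - (m ^ 3 + \<beta> * m\<^sup>2 + 2 * \<gamma> * m + \<delta>)"
      unfolding \<beta> by (simp add: algebra_simps power2_eq_square power3_eq_cube)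
    then show ?thesis using 1 2 by simp
  qed
  then have \<gamma>2: "2 * \<gamma> = m * M + m * r + M * r" using mM by simp
  then have \<gamma>: "\<gamma> = (m * M + m * r + M * r) / 2" by simp
  have \<delta>': "\<delta> = - (m * M * r)"
    using 1 unfolding \<beta> \<gamma>2 by (simp add: algebra_simps power2_eq_square power3_eq_cube)
  have fi: "(f' x)\<^sup>2 = (f x - m) * (f x - M) * (f x - r)" for x
    unfolding \<delta> \<gamma>2 \<delta>' \<beta> by (simp add: algebra_simps power2_eq_square power3_eq_cube)
  have rge: "s \<le> r" if "m < s" "s < M" for s
  proof -
    have "\<exists>x. f x = s"
    proof (cases "a \<le> b")
      case True
      then show ?thesis using IVT'[of f a s b] that fc[of "{a..b}"] by (auto simp: m_def M_def)
    next
      case False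
      then show ?thesis using IVT2'[of f a s b] that fc[of "{b..a}"] by (auto simp: m_def M_def)
    qed
    then obtain x where "f x = s" by blast
    then have "0 \<le> (s - m) * (s - M) * (s - r)" using fi[of x] by (metis zero_le_power2)
    moreover have "(s - m) * (s - M) < 0" using that by (intro mult_pos_neg) auto
    ultimately show ?thesis using mult_neg_pos[of "(s - m) * (s - M)" "s - r"] by (cases "s \<le> r") auto
  qed
  have "M \<le> r"
    by (rule dense_le_bounded[OF mM]) (use rge in auto)
  moreover have "M \<noteq> r"
  proof
    assume "M = r"
    then have z: "3/2 * M\<^sup>2 + \<beta> * M + \<gamma> = 0"
      unfolding \<beta> \<gamma> by (simp add: algebra_simps power2_eq_square)
    have "stationary (\<lambda>_. M) (\<lambda>_. 0) \<beta> \<gamma>" using z by (simp add: stationary_def)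
    from stationary_unique[OF f this, of "\<bar>m\<bar> + \<bar>M\<bar>" b]
    have "f x = M" for x
    proof
      show "\<bar>f x\<bar> \<le> \<bar>m\<bar> + \<bar>M\<bar>" for x using ab[of x] unfolding m_def M_def by linarith
    qed (simp_all add: M_def f'0)
    then show False using nc by metis
  qed
  ultimately have "M < r" by simp
  have "wave f f' m M r"
    unfolding wave_def using mM \<open>M < r\<close> f fi ab unfolding \<beta>[symmetric] \<gamma>[symmetric] by (auto simp: m_def M_def)
  then show thesis by (rule that)
qed

text \<open>Half the derivative of the cubic with roots \<open>m\<close>, \<open>M\<close>,
  \<open>r\<close>: in this form differences of roots are visible and scale homogeneously.\<close>

lemma wave_second_deriv:
  fixes s m M r :: real
  shows "3/2 * s\<^sup>2 + - (m + M + r) * s + (m * M + m * r + M * r) / 2 =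
    ((s - m) * (s - M) + (s - m) * (s - r) + (s - M) * (s - r)) / 2"
  by (simp add: algebra_simps power2_eq_square)

text \<open>The equation is covariant under \<open>g\<close> to
  \<open>\<sigma>^2 * g (\<sigma> * x)\<close> plus a constant. The factor \<sigma> matches
  \<open>r - m\<close>, and the equal moduli then match \<open>M - m\<close> as well, so both
  functions satisfy the same equation. They share the value \<open>m\<close> and slope 0 at
  \<open>a\<close>, so uniqueness applies.\<close>

lemma wave_similar:
  assumes f: "wave f f' m M r" and g: "wave g g' m2 M2 r2"
    and mod: "(M - m) / (r - m) = (M2 - m2) / (r2 - m2)" and a: "f a = m" and b: "g b = m2"
  defines "\<sigma> \<equiv> sqrt ((r - m) / (r2 - m2))"
  shows "f x = m + \<sigma>\<^sup>2 * (g (b + \<sigma> * (x - a)) - m2)" "\<sigma> > 0"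
proof -
  have o: "m < M" "M < r" "m2 < M2" "M2 < r2" using f g by (auto simp: wave_def)
  show \<sigma>: "\<sigma> > 0" using o by (simp add: \<sigma>_def)
  have \<sigma>2: "\<sigma>\<^sup>2 = (r - m) / (r2 - m2)" using o by (simp add: \<sigma>_def)
  have D: "r - m = \<sigma>\<^sup>2 * (r2 - m2)" using o by (simp add: \<sigma>2)
  have A: "M - m = \<sigma>\<^sup>2 * (M2 - m2)" using mod o by (simp add: \<sigma>2 field_simps)
  have fs: "stationary f f' (- (m + M + r)) ((m * M + m * r + M * r) / 2)"
    and gs: "stationary g g' (- (m2 + M2 + r2)) ((m2 * M2 + m2 * r2 + M2 * r2) / 2)"
    using f g by (auto simp: wave_def)
  have gb: "m2 \<le> g x" "g x \<le> M2" for x using g by (auto simp: wave_def)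
  have fb: "m \<le> f x" "f x \<le> M" for x using f by (auto simp: wave_def)
  define F where "F x = m + \<sigma>\<^sup>2 * (g (b + \<sigma> * (x - a)) - m2)" for x
  define F' where "F' x = \<sigma> ^ 3 * g' (b + \<sigma> * (x - a))" for x
  have aff: "((\<lambda>x. b + \<sigma> * (x - a)) has_real_derivative \<sigma>) (at x)" for x
    by (auto intro!: derivative_eq_intros)
  have "stationary F F' (- (m + M + r)) ((m * M + m * r + M * r) / 2)"
    unfolding stationary_def
  proof (intro conjI allI)
    fix x
    have "(F has_real_derivative \<sigma>\<^sup>2 * (g' (b + \<sigma> * (x - a)) * \<sigma>)) (at x)"
      unfolding F_def
      by (rule derivative_eq_intros DERIV_chain2[OF stationaryD(1)[OF gs] aff] refl)+ simp
    then show "(F has_real_derivative F' x) (at x)"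
      by (simp add: F'_def power2_eq_square power3_eq_cube algebra_simps)
    define s where "s = g (b + \<sigma> * (x - a))"
    have "(F' has_real_derivative \<sigma> ^ 3 * ((((s - m2) * (s - M2) + (s - m2) * (s - r2) + (s - M2) * (s - r2)) / 2) * \<sigma>)) (at x)"
      unfolding F'_def s_def
      by (rule DERIV_cmult[OF DERIV_chain2[OF stationaryD(2)[OF gs, unfolded wave_second_deriv] aff]])
    moreover have "\<sigma> ^ 3 * ((((s - m2) * (s - M2) + (s - m2) * (s - r2) + (s - M2) * (s - r2)) / 2) * \<sigma>)
      = ((F x - m) * (F x - M) + (F x - m) * (F x - r) + (F x - M) * (F x - r)) / 2"
    proof -
      have e: "F x - m = \<sigma>\<^sup>2 * (s - m2)" "F x - M = \<sigma>\<^sup>2 * (s - M2)" "F x - r = \<sigma>\<^sup>2 * (s - r2)"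
        using A D by (simp_all add: F_def s_def algebra_simps)
      show ?thesis unfolding e by (simp add: power2_eq_square power3_eq_cube algebra_simps)
    qed
    ultimately show "(F' has_real_derivative 3/2 * (F x)\<^sup>2 + - (m + M + r) * F x + (m * M + m * r + M * r) / 2) (at x)"
      unfolding wave_second_deriv by simp
  qed
  moreover have "\<bar>f x\<bar> \<le> \<bar>m\<bar> + \<bar>M\<bar>" for x using fb[of x] by linarith
  moreover have "\<bar>F x\<bar> \<le> \<bar>m\<bar> + \<bar>M\<bar>" for x
  proof -
    have "0 \<le> \<sigma>\<^sup>2 * (g (b + \<sigma> * (x - a)) - m2)" using gb by simp
    moreover have "\<sigma>\<^sup>2 * (g (b + \<sigma> * (x - a)) - m2) \<le> M - m" unfolding A using gb by (intro mult_left_mono) auto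
    ultimately show ?thesis unfolding F_def by linarith
  qed
  moreover have "f a = F a" using a b by (simp add: F_def)
  moreover have "f' a = F' a"
  proof -
    have "(f' a)\<^sup>2 = 0" using f a by (simp add: wave_def)
    moreover have "(g' b)\<^sup>2 = 0" using g b by (simp add: wave_def)
    ultimately show ?thesis by (simp add: F'_def)
  qed
  ultimately have "f x = F x" by (rule stationary_unique[OF fs])
  then show "f x = m + \<sigma>\<^sup>2 * (g (b + \<sigma> * (x - a)) - m2)" by (simp add: F_def)
qed

text \<open>At a minimum the second derivative is \<open>(M - m) * (r - m) / 2\<close>, which allows
  the root \<open>r\<close> to be eliminated from the modulus.\<close>

lemma wave_modulus:
  assumes f: "wave f f' m M r" and a: "f a = m" and d: "(f' has_real_derivative d) (at a)"
  shows "(M - m) / (r - m) = (M - m)\<^sup>2 / (2 * d)" "d > 0"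
proof -
  have o: "m < M" "M < r" using f by (auto simp: wave_def)
  have fs: "stationary f f' (- (m + M + r)) ((m * M + m * r + M * r) / 2)" using f by (simp add: wave_def)
  have "d = ((f a - m) * (f a - M) + (f a - m) * (f a - r) + (f a - M) * (f a - r)) / 2"
    by (rule DERIV_unique[OF d stationaryD(2)[OF fs, unfolded wave_second_deriv, of a]])
  then have d: "d = (M - m) * (r - m) / 2" unfolding a by (simp add: algebra_simps)
  have "A / D = A\<^sup>2 / (2 * (A * D / 2))" if "A \<noteq> 0" for A D :: real
    using that by (simp add: power2_eq_square)
  from this[of "M - m" "r - m"] show "(M - m) / (r - m) = (M - m)\<^sup>2 / (2 * d)"
    using o unfolding d by simp
  show "d > 0" unfolding d using o by (intro divide_pos_pos mult_pos_pos) auto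
qed

text \<open>The acceleration is at most a constant times \<open>(M - m) * (r - m)\<close>, so rising
  from \<open>m\<close> to \<open>M\<close> within time \<open>H\<close> requires
  \<open>r - m\<close> to be of order \<open>1 / H^2\<close>. The amplitude cancels. For closely
  spaced lattices this will force the modulus to be small.\<close>

lemma wave_width:
  assumes f: "wave f f' m M r" and "f 0 = m" "f H = M" "H > 0"
  shows "4 / (3 * H\<^sup>2) \<le> r - m"
proof -
  have o: "m < M" "M < r" using f by (auto simp: wave_def)
  have fs: "stationary f f' (- (m + M + r)) ((m * M + m * r + M * r) / 2)" using f by (simp add: wave_def)
  define A where "A = M - m"
  define D where "D = r - m"
  define K where "K = 3/2 * (A * D)"
  have AD: "0 < A" "A < D" using o by (auto simp: A_def D_def)
  have d2: "((f x - m) * (f x - M) + (f x - m) * (f x - r) + (f x - M) * (f x - r)) / 2 \<le> K" for x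
  proof -
    have G: "0 \<le> f x - m" "f x - m \<le> A" using f by (auto simp: wave_def A_def)
    have n: "(f x - m) * (f x - M) \<le> 0" "(f x - m) * (f x - r) \<le> 0"
      using G AD by (auto intro!: mult_nonneg_nonpos simp: A_def D_def)
    have "(M - f x) * (r - f x) \<le> A * D"
      using G AD by (intro mult_mono) (auto simp: A_def D_def)
    then have "(f x - M) * (f x - r) \<le> A * D" by (simp add: algebra_simps)
    with n have "(f x - m) * (f x - M) + (f x - m) * (f x - r) + (f x - M) * (f x - r) \<le> 0 + 0 + A * D"
      by (intro add_mono)
    moreover have "0 \<le> A * D" using AD by simp
    ultimately show ?thesis unfolding K_def by simp
  qed
  have f'0: "f' 0 = 0" using f assms(2) by (auto simp: wave_def dest: spec[of _ 0])
  have f'b: "f' x \<le> K * x" if "x \<ge> 0" for x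
  proof -
    have "f' x - K * x \<le> f' 0 - K * 0"
    proof (rule DERIV_nonpos_imp_nonincreasing[OF that])
      fix y
      have "((\<lambda>y. f' y - K * y) has_real_derivative
          ((f y - m) * (f y - M) + (f y - m) * (f y - r) + (f y - M) * (f y - r)) / 2 - K) (at y)"
        by (rule derivative_eq_intros stationaryD(2)[OF fs, unfolded wave_second_deriv] refl)+ simp
      then show "\<exists>z. ((\<lambda>y. f' y - K * y) has_real_derivative z) (at y) \<and> z \<le> 0"
        using d2[of y] by (intro exI conjI) auto
    qed
    then show ?thesis using f'0 by simp
  qed
  have "f H - K / 2 * H\<^sup>2 \<le> f 0 - K / 2 * 0\<^sup>2"
  proof (rule DERIV_nonpos_imp_nonincreasing[of 0 H "\<lambda>y. f y - K / 2 * y\<^sup>2"])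
    fix y :: real assume "0 \<le> y"
    have "((\<lambda>y. f y - K / 2 * y\<^sup>2) has_real_derivative f' y - K * y) (at y)"
      by (auto intro!: derivative_eq_intros stationaryD(1)[OF fs])
    then show "\<exists>z. ((\<lambda>y. f y - K / 2 * y\<^sup>2) has_real_derivative z) (at y) \<and> z \<le> 0"
      using f'b[OF \<open>0 \<le> y\<close>] by (intro exI conjI) auto
  qed (use assms in simp)
  then have "A \<le> K / 2 * H\<^sup>2" using assms by (simp add: A_def)
  then have "A * 1 \<le> A * (3/4 * D * H\<^sup>2)" by (simp add: K_def algebra_simps)
  then have "1 \<le> 3/4 * D * H\<^sup>2" using AD by (simp only: mult_le_cancel_left_pos)
  then have "4 / (3 * H\<^sup>2) \<le> D" using assms(4) by (simp add: pos_divide_le_eq algebra_simps)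
  then show ?thesis by (simp add: D_def)
qed

lemma period_int_mult:
  fixes f :: "real \<Rightarrow> real"
  assumes "\<And>x. f (x + q) = f x" shows "f (x + of_int n * q) = f x"
proof -
  have nat: "f (x + of_nat k * q) = f x" for k x
  proof (induction k)
    case (Suc k)
    have e: "x + of_nat (Suc k) * q = (x + of_nat k * q) + q" by (simp add: algebra_simps)
    show ?case unfolding e assms by (rule Suc)
  qed simp
  show ?thesis
  proof (cases "n \<ge> 0")
    case True then show ?thesis using nat[of x "nat n"] by simp
  next
    case False then show ?thesis using nat[of "x + of_int n * q" "nat (-n)"] by simp
  qed
qed

text \<open>With arbitrarily small periods, a multiple of one of them would carry \<open>u\<close>
  close to \<open>v\<close> and contradict continuity at \<open>v\<close>. So the positive periods
  are bounded away from 0; their infimum is a period by continuity, and division with remainder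
  shows that it generates all periods.\<close>

lemma minimal_period:
  fixes f :: "real \<Rightarrow> real"
  assumes c: "continuous_on UNIV f" and T: "T > 0" "\<And>x. f (x + T) = f x" and nc: "f u \<noteq> f v"
  obtains p where "p > 0" "\<And>x. f (x + p) = f x" "\<And>q. (\<And>x. f (x + q) = f x) \<Longrightarrow> \<exists>n::int. q = of_int n * p"
proof -
  define S where "S = {q. q > 0 \<and> (\<forall>x. f (x + q) = f x)}"
  have TS: "T \<in> S" using T by (simp add: S_def)
  have fc: "isCont f x" for x using c by (simp add: continuous_on_eq_continuous_at)
  have "\<exists>e>0. \<forall>q\<in>S. e \<le> q"
  proof (rule ccontr)
    assume "\<not> (\<exists>e>0. \<forall>q\<in>S. e \<le> q)"
    then have small: "\<exists>q\<in>S. q < e" if "e > 0" for e using that by (meson not_le)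
    have "\<bar>f u - f v\<bar> > 0" using nc by simp
    then obtain d where d: "d > 0" "\<And>y. \<bar>y - v\<bar> < d \<Longrightarrow> \<bar>f y - f v\<bar> < \<bar>f u - f v\<bar>"
      using fc[of v, unfolded continuous_at_eps_delta, rule_format, OF \<open>\<bar>f u - f v\<bar> > 0\<close>] by (auto simp: dist_real_def)
    obtain q where q: "q > 0" "\<And>x. f (x + q) = f x" "q < d" using small[OF d(1)] by (auto simp: S_def)
    define n where "n = \<lfloor>(v - u) / q\<rfloor>"
    have "of_int n \<le> (v - u) / q" "(v - u) / q < of_int n + 1" by (auto simp: n_def)
    then have "of_int n * q \<le> v - u" "v - u < of_int n * q + q" using q(1) by (simp_all add: field_simps)
    then have "\<bar>(u + of_int n * q) - v\<bar> < d" using q by linarith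
    then show False using d(2) period_int_mult[of f q u n] q(2) by fastforce
  qed
  then obtain e where e: "e > 0" "\<And>q. q \<in> S \<Longrightarrow> e \<le> q" by blast
  define p where "p = Inf S"
  have bdd: "bdd_below S" using e(2) by (rule bdd_belowI)
  have pe: "e \<le> p" unfolding p_def using e TS by (intro cInf_greatest) auto
  have pS: "f (x + p) = f x" for x
  proof (rule ccontr)
    assume "f (x + p) \<noteq> f x"
    then have "\<bar>f x - f (x + p)\<bar> > 0" by simp
    then obtain d where d: "d > 0" "\<And>y. \<bar>y - (x + p)\<bar> < d \<Longrightarrow> \<bar>f y - f (x + p)\<bar> < \<bar>f x - f (x + p)\<bar>"
      using fc[of "x + p", unfolded continuous_at_eps_delta, rule_format, OF \<open>\<bar>f x - f (x + p)\<bar> > 0\<close>] by (auto simp: dist_real_def)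
    obtain q where q: "q \<in> S" "q < p + d"
      using cInf_lessD[of S "p + d"] TS d(1) unfolding p_def by auto
    then have "p \<le> q" unfolding p_def using bdd by (intro cInf_lower)
    then have "\<bar>(x + q) - (x + p)\<bar> < d" using q by simp
    then show False using d(2)[of "x + q"] q(1) by (simp add: S_def)
  qed
  have "\<exists>n::int. q = of_int n * p" if q: "\<And>x. f (x + q) = f x" for q
  proof -
    define n where "n = \<lfloor>q / p\<rfloor>"
    have p0: "p > 0" using pe e by simp
    have "of_int n \<le> q / p" "q / p < of_int n + 1" by (auto simp: n_def)
    then have n: "of_int n * p \<le> q" "q < of_int n * p + p" using p0 by (simp_all add: field_simps)
    have per: "f (x + (q - of_int n * p)) = f x" for x
      using period_int_mult[of f p "x + (q - of_int n * p)" n] pS q[of x] by (simp add: algebra_simps)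
    have "q - of_int n * p = 0"
    proof (rule ccontr)
      assume "q - of_int n * p \<noteq> 0"
      then have "q - of_int n * p \<in> S" using n per by (simp add: S_def)
      then have "p \<le> q - of_int n * p" unfolding p_def using bdd by (intro cInf_lower)
      then show False using n by simp
    qed
    then show ?thesis by (intro exI[of _ n]) simp
  qed
  then show thesis using that[of p] pe e(1) pS by force
qed

section \<open>The lattice sum of squared hyperbolic secants\<close>

lemma has_sum_int_exp:
  fixes c :: real
  assumes "c > 0"
  shows "((\<lambda>j::int. exp (- c * \<bar>real_of_int j\<bar>)) has_sum (1 + 2 / (exp c - 1))) UNIV"
proof -
  define q where "q = exp (- c)"
  have q: "0 < q" "q < 1" using assms by (auto simp: q_def)
  have qn: "exp (- c * real n) = q ^ n" for n
    by (simp add: q_def exp_of_nat_mult[symmetric] mult.commute)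
  have s1: "((\<lambda>n. q * q ^ n) has_sum (q * (1 / (1 - q)))) (UNIV :: nat set)"
  proof (rule norm_summable_imp_has_sum)
    show "(\<lambda>n. q * q ^ n) sums (q * (1 / (1 - q)))" using q by (intro sums_mult geometric_sums) auto
    show "summable (\<lambda>n. norm (q * q ^ n))" using q by (simp add: abs_mult summable_geometric)
  qed
  have q1: "q * (1 / (1 - q)) = 1 / (exp c - 1)"
  proof -
    have e: "exp c = 1 / q" by (simp add: q_def exp_minus field_simps)
    show ?thesis unfolding e using q by (simp add: field_simps)
  qed
  let ?f = "\<lambda>j::int. exp (- c * \<bar>real_of_int j\<bar>)"
  have P: "(?f has_sum (1 / (exp c - 1))) (range (\<lambda>n. int (Suc n)))"
    using s1 qn[of "Suc _"] unfolding q1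
    by (subst has_sum_reindex) (auto simp: inj_on_def o_def algebra_simps)
  have N: "(?f has_sum (1 / (exp c - 1))) (range (\<lambda>n. - int (Suc n)))"
    using s1 qn[of "Suc _"] unfolding q1
    by (subst has_sum_reindex) (auto simp: inj_on_def o_def algebra_simps)
  have Z: "(?f has_sum 1) {0}" by (rule has_sum_finiteI) auto
  have U: "(UNIV :: int set) = {0} \<union> (range (\<lambda>n. int (Suc n)) \<union> range (\<lambda>n. - int (Suc n)))"
  proof -
    have "j = 0 \<or> j = int (Suc (nat (j - 1))) \<or> j = - int (Suc (nat (- j - 1)))" for j :: int by linarith
    then show ?thesis by blast
  qed
  have "(?f has_sum (1 + (1 / (exp c - 1) + 1 / (exp c - 1)))) ({0} \<union> (range (\<lambda>n. int (Suc n)) \<union> range (\<lambda>n. - int (Suc n))))"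
    by (intro has_sum_Un_disjoint Z P N) auto
  then show ?thesis unfolding U[symmetric] by simp
qed

lemma summable_on_int_comparison:
  fixes f :: "int \<Rightarrow> real"
  assumes "\<And>j. \<bar>f j\<bar> \<le> M j" "M summable_on UNIV" shows "f summable_on UNIV"
proof -
  have "(\<lambda>j. norm (f j)) summable_on UNIV"
  proof (rule Infinite_Sum.abs_summable_on_comparison_test')
    show "M summable_on UNIV" by (rule assms(2))
  qed (use assms(1) in simp)
  then show ?thesis by (rule abs_summable_summable)
qed

lemma summable_on_int_exp_bound:
  fixes f :: "int \<Rightarrow> real"
  assumes "c > 0" "\<And>j. \<bar>f j\<bar> \<le> K * exp (- c * \<bar>real_of_int j\<bar>)"
  shows "f summable_on UNIV"
proof (rule summable_on_int_comparison[OF assms(2)])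
  show "(\<lambda>j. K * exp (- c * \<bar>real_of_int j\<bar>)) summable_on UNIV"
    using has_sum_int_exp[OF assms(1)] by (intro summable_on_cmult_right) (auto simp: summable_on_def)
qed

lemma infsum_int_suminf:
  fixes g :: "int \<Rightarrow> real"
  assumes "g summable_on UNIV"
  shows "summable (\<lambda>n. g (int_decode n))" "infsum g UNIV = (\<Sum>n. g (int_decode n))"
proof -
  have b: "bij_betw int_decode UNIV UNIV" by (simp add: bij_betw_def inj_int_decode surj_int_decode)
  have "(\<lambda>n. g (int_decode n)) summable_on UNIV" using summable_on_reindex_bij_betw[OF b] assms by blast
  then have "((\<lambda>n. g (int_decode n)) has_sum infsum g UNIV) UNIV"
    using infsum_reindex_bij_betw[OF b, of g] has_sum_infsum by metis
  then have "(\<lambda>n. g (int_decode n)) sums infsum g UNIV" by (rule has_sum_imp_sums)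
  then show "summable (\<lambda>n. g (int_decode n))" "infsum g UNIV = (\<Sum>n. g (int_decode n))"
    by (auto simp: sums_iff)
qed

text \<open>The majorant may depend on the bound \<open>X\<close> because the translates are
  summable only locally uniformly. The sum is rearranged into a series over the naturals by
  \<open>int_decode\<close>, where termwise differentiation applies.\<close>

lemma has_derivative_infsum_int:
  fixes F F' :: "int \<Rightarrow> real \<Rightarrow> real"
  assumes D: "\<And>j y. (F j has_real_derivative F' j y) (at y)"
    and M: "\<And>X. \<exists>M. M summable_on UNIV \<and> (\<forall>j y. \<bar>y\<bar> \<le> X \<longrightarrow> \<bar>F' j y\<bar> \<le> M j)"
    and sF: "\<And>y. (\<lambda>j. F j y) summable_on UNIV"
  shows "((\<lambda>y. \<Sum>\<^sub>\<infinity>j. F j y) has_real_derivative (\<Sum>\<^sub>\<infinity>j. F' j y)) (at y)"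
proof -
  define X where "X = \<bar>y\<bar> + 1"
  obtain M where M: "M summable_on UNIV" "\<And>j y. \<bar>y\<bar> \<le> X \<Longrightarrow> \<bar>F' j y\<bar> \<le> M j" using assms(2)[of X] by blast
  have y: "y \<in> interior {-X..X}" by (auto simp: X_def)
  have sF': "(\<lambda>j. F' j y) summable_on UNIV"
    using M by (intro summable_on_int_comparison[OF _ M(1)]) (simp add: X_def)
  have "((\<lambda>y. \<Sum>n. F (int_decode n) y) has_real_derivative (\<Sum>n. F' (int_decode n) y)) (at y)"
  proof (rule has_field_derivative_series'(2)[of "{-X..X}" "\<lambda>n. F (int_decode n)" "\<lambda>n. F' (int_decode n)" 0 y])
    show "uniformly_convergent_on {-X..X} (\<lambda>n x. \<Sum>i<n. F' (int_decode i) x)"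
      by (rule Weierstrass_m_test'[of _ _ "\<lambda>n. M (int_decode n)"])
         (use M infsum_int_suminf(1)[OF M(1)] in auto)
    show "summable (\<lambda>n. F (int_decode n) 0)" by (rule infsum_int_suminf(1)[OF sF])
  qed (use y D in \<open>auto simp: X_def intro: DERIV_subset\<close>)
  then show ?thesis unfolding infsum_int_suminf(2)[OF sF] infsum_int_suminf(2)[OF sF'] .
qed

lemma continuous_infsum_int:
  fixes f :: "int \<Rightarrow> real \<Rightarrow> real"
  assumes c: "\<And>j. continuous_on A (f j)" and M: "M summable_on UNIV" "\<And>j x. x \<in> A \<Longrightarrow> \<bar>f j x\<bar> \<le> M j"
  shows "continuous_on A (\<lambda>x. \<Sum>\<^sub>\<infinity>j. f j x)"
proof (rule uniform_limit_theorem)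
  show "uniform_limit A (\<lambda>X x. \<Sum>j\<in>X. f j x) (\<lambda>x. \<Sum>\<^sub>\<infinity>j. f j x) (finite_subsets_at_top UNIV)"
    by (rule Weierstrass_m_test_general[OF _ M(1)]) (use M in auto)
  show "\<forall>\<^sub>F X in finite_subsets_at_top UNIV. continuous_on A (\<lambda>x. \<Sum>j\<in>X. f j x)"
    by (intro always_eventually allI continuous_on_sum c)
qed simp

lemma infsum_int_shift:
  fixes f :: "int \<Rightarrow> real"
  shows "(\<Sum>\<^sub>\<infinity>j. f (j + m)) = (\<Sum>\<^sub>\<infinity>j. f j)" "(\<Sum>\<^sub>\<infinity>j. f (- j)) = (\<Sum>\<^sub>\<infinity>j. f j)"
    "(\<lambda>j. f (j + m)) summable_on UNIV \<longleftrightarrow> f summable_on UNIV"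
proof -
  have b: "bij_betw (\<lambda>j. j + m) UNIV UNIV" by (rule bij_betwI[of _ _ _ "\<lambda>j. j - m"]) auto
  have b': "bij_betw (\<lambda>j::int. - j) UNIV UNIV" by (rule bij_betwI[of _ _ _ "\<lambda>j. - j"]) auto
  show "(\<Sum>\<^sub>\<infinity>j. f (j + m)) = (\<Sum>\<^sub>\<infinity>j. f j)" by (rule infsum_reindex_bij_betw[OF b])
  show "(\<Sum>\<^sub>\<infinity>j. f (- j)) = (\<Sum>\<^sub>\<infinity>j. f j)" by (rule infsum_reindex_bij_betw[OF b'])
  show "(\<lambda>j. f (j + m)) summable_on UNIV \<longleftrightarrow> f summable_on UNIV" by (rule summable_on_reindex_bij_betw[OF b])
qed

text \<open>Unconditional summability allows the sum for one step to be evaluated along symmetric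
  intervals, where it telescopes to \<open>B - A\<close>. For \<open>m\<close> steps this is added
  up over translates; negative \<open>m\<close> follows by translating and changing sign.\<close>

lemma has_sum_int_telescope:
  fixes g :: "int \<Rightarrow> real"
  assumes s: "(\<lambda>i. g (i + 1) - g i) summable_on UNIV"
    and B: "(\<lambda>n. g (int n)) \<longlonglongrightarrow> B" and A: "(\<lambda>n. g (- int n)) \<longlonglongrightarrow> A"
  shows "((\<lambda>i. g (i + m) - g i) has_sum (real_of_int m * (B - A))) UNIV"
proof -
  have fl: "filterlim (\<lambda>N. {- int N..<int N}) (finite_subsets_at_top UNIV) sequentially"
    unfolding filterlim_finite_subsets_at_top
  proof (intro allI impI)
    fix X :: "int set" assume X: "finite X \<and> X \<subseteq> UNIV"
    obtain K where K: "\<And>x. x \<in> X \<Longrightarrow> \<bar>x\<bar> \<le> K" "K \<ge> 0"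
    proof (cases "X = {}")
      case False
      show ?thesis by (rule that[of "Max (abs ` X)"]) (use X False in \<open>auto simp: Max_ge_iff\<close>)
    qed (use that[of 0] in auto)
    show "\<forall>\<^sub>F y in sequentially. finite {- int y..<int y} \<and> X \<subseteq> {- int y..<int y} \<and> {- int y..<int y} \<subseteq> UNIV"
      using eventually_gt_at_top[of "nat K"]
    proof eventually_elim
      case (elim y)
      have "x \<in> {- int y..<int y}" if "x \<in> X" for x using K(1)[OF that] elim by auto
      then show ?case by auto
    qed
  qed
  have fin: "(\<Sum>i\<in>{- int N..<int N}. g (i + 1) - g i) = g (int N) - g (- int N)" for N
  proof (induction N)
    case (Suc N)
    have "{- int (Suc N)..<int (Suc N)} = insert (- int (Suc N)) (insert (int N) {- int N..<int N})" by auto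
    then show ?case using Suc by (simp add: algebra_simps)
  qed simp
  have "((\<lambda>i. g (i + 1) - g i) has_sum (\<Sum>\<^sub>\<infinity>i. g (i + 1) - g i)) UNIV" using s by simp
  then have "((\<lambda>X. \<Sum>i\<in>X. g (i + 1) - g i) \<longlongrightarrow> (\<Sum>\<^sub>\<infinity>i. g (i + 1) - g i)) (finite_subsets_at_top UNIV)"
    unfolding has_sum_def .
  from filterlim_compose[OF this fl] have "(\<lambda>N. g (int N) - g (- int N)) \<longlonglongrightarrow> (\<Sum>\<^sub>\<infinity>i. g (i + 1) - g i)"
    unfolding fin .
  then have "(\<Sum>\<^sub>\<infinity>i. g (i + 1) - g i) = B - A" using LIMSEQ_unique tendsto_diff[OF B A] by blast
  then have h1: "((\<lambda>i. g (i + 1) - g i) has_sum (B - A)) UNIV" using has_sum_infsum[OF s] by simp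
  have sh: "((\<lambda>i. f (i + c)) has_sum S) UNIV" if "(f has_sum S) UNIV" for f :: "int \<Rightarrow> real" and c S
    using infsum_int_shift(1,3)[of f c] that by (simp add: has_sum_iff)
  have nat: "((\<lambda>i. g (i + int n) - g i) has_sum (real n * (B - A))) UNIV" for n
  proof (induction n)
    case (Suc n)
    have "((\<lambda>i. (g (i + int n + 1) - g (i + int n)) + (g (i + int n) - g i)) has_sum ((B - A) + real n * (B - A))) UNIV"
      by (rule has_sum_add[OF sh[OF h1, of "int n"] Suc])
    then show ?case by (simp add: algebra_simps)
  qed (simp add: has_sum_0)
  show ?thesis
  proof (cases "m \<ge> 0")
    case True then show ?thesis using nat[of "nat m"] by simp
  next
    case False
    have "((\<lambda>i. - (g (i + m + int (nat (- m))) - g (i + m))) has_sum - (real (nat (- m)) * (B - A))) UNIV"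
      by (rule has_sum_uminusI[OF sh[OF nat, of m]])
    then show ?thesis using False by simp
  qed
qed

section \<open>The squared hyperbolic secant and its lattice sums\<close>

definition sech2 :: "real \<Rightarrow> real" where "sech2 y = 1 / (cosh y)\<^sup>2"

lemma sech2_tanh: "sech2 y = 1 - (tanh y)\<^sup>2"
proof -
  have "(cosh y)\<^sup>2 \<noteq> 0" by simp
  then have "1 - (tanh y)\<^sup>2 = ((cosh y)\<^sup>2 - (sinh y)\<^sup>2) / (cosh y)\<^sup>2"
    by (simp add: tanh_def power_divide diff_divide_distrib)
  then show ?thesis by (simp add: sech2_def cosh_square_eq)
qed

lemma sech2_pos: "sech2 y > 0" by (simp add: sech2_def)

lemma sech2_le_1: "sech2 y \<le> 1" by (simp add: sech2_tanh)

lemma sech2_minus [simp]: "sech2 (- y) = sech2 y" by (simp add: sech2_def)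

lemma sech2_0 [simp]: "sech2 0 = 1" by (simp add: sech2_def)

lemma sech2_exp_bound: "sech2 y \<le> 4 * exp (- 2 * \<bar>y\<bar>)"
proof -
  have "exp \<bar>y\<bar> / 2 \<le> cosh \<bar>y\<bar>" by (simp add: cosh_def)
  then have "exp \<bar>y\<bar> / 2 \<le> cosh y" by simp
  then have "(exp \<bar>y\<bar> / 2)\<^sup>2 \<le> (cosh y)\<^sup>2" by (intro power_mono) auto
  then have "1 / (cosh y)\<^sup>2 \<le> 1 / (exp \<bar>y\<bar> / 2)\<^sup>2" by (intro divide_left_mono) auto
  also have "\<dots> = 4 * exp (- 2 * \<bar>y\<bar>)"
    by (simp add: power_divide exp_minus exp_double[symmetric] field_simps)
  finally show ?thesis by (simp add: sech2_def)
qed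

lemma DERIV_tanh': "(tanh has_real_derivative sech2 y) (at y)"
  unfolding sech2_tanh by (auto intro!: derivative_eq_intros)

lemma DERIV_sech2: "(sech2 has_real_derivative - 2 * tanh y * sech2 y) (at y)"
proof -
  have "((\<lambda>y. 1 - (tanh y)\<^sup>2) has_real_derivative - 2 * tanh y * (1 - (tanh y)\<^sup>2)) (at y)"
    by (auto intro!: derivative_eq_intros)
  then show ?thesis unfolding sech2_tanh[symmetric] .
qed

lemma DERIV_sech2': "((\<lambda>y. - 2 * tanh y * sech2 y) has_real_derivative 4 * sech2 y - 6 * (sech2 y)\<^sup>2) (at y)"
proof -
  have "((\<lambda>y. - 2 * tanh y * sech2 y) has_real_derivative
      - 2 * sech2 y * sech2 y + (- 2 * tanh y * sech2 y) * (- 2 * tanh y)) (at y)"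
    by (rule DERIV_mult[OF DERIV_cmult[OF DERIV_tanh', of "-2"] DERIV_sech2])
  moreover have "- 2 * sech2 y * sech2 y + (- 2 * tanh y * sech2 y) * (- 2 * tanh y) = 4 * sech2 y - 6 * (sech2 y)\<^sup>2"
    by (simp add: sech2_tanh power2_eq_square algebra_simps)
  ultimately show ?thesis by simp
qed

lemma tanh_diff_sech2: "tanh x - tanh (x - d) = sinh d / (cosh x * cosh (x - d))" for x d :: real
proof -
  have "cosh x \<noteq> 0" "cosh (x - d) \<noteq> 0" using cosh_real_pos[of x] cosh_real_pos[of "x - d"] by linarith+
  moreover have "sinh d = sinh x * cosh (x - d) - cosh x * sinh (x - d)"
    using sinh_diff[of x "x - d"] by simp
  ultimately show ?thesis by (simp add: tanh_def field_simps)
qed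

text \<open>A partial fraction decomposition. For \<open>t = tanh x\<close> and
  \<open>u = tanh (x - d)\<close>, the addition theorems give \<open>t - u\<close> as
  \<open>sinh d\<close> over the product of the hyperbolic cosines, and also
  \<open>(t - u) * coth d = 1 - t * u\<close>. The square of the first is the wanted product times
  \<open>(sinh d)^2\<close>, and the second makes \<open>(t - u)^2\<close> linear in quantities that
  can be summed over a lattice.\<close>

lemma sech2_product:
  assumes "d \<noteq> 0"
  shows "sech2 x * sech2 (x - d) =
    (2 * (cosh d / sinh d) * (tanh x - tanh (x - d)) - sech2 x - sech2 (x - d)) / (sinh d)\<^sup>2"
proof -
  define t where "t = tanh x"
  define u where "u = tanh (x - d)"
  have sd: "sinh d \<noteq> 0" using assms by simp
  have c: "cosh x \<noteq> 0" "cosh (x - d) \<noteq> 0" using cosh_real_pos[of x] cosh_real_pos[of "x - d"] by linarith+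
  have 1: "t - u = sinh d / (cosh x * cosh (x - d))" unfolding t_def u_def by (rule tanh_diff_sech2)
  have 2: "(t - u) * (cosh d / sinh d) = 1 - t * u"
  proof -
    have "cosh d = cosh x * cosh (x - d) - sinh x * sinh (x - d)" using cosh_diff[of x "x - d"] by simp
    then show ?thesis unfolding 1 using c sd by (simp add: t_def u_def tanh_def field_simps)
  qed
  have "sech2 x * sech2 (x - d) = ((t - u) / sinh d)\<^sup>2"
    unfolding 1 using sd by (simp add: sech2_def power_divide power_mult_distrib)
  also have "\<dots> = (t - u)\<^sup>2 / (sinh d)\<^sup>2" by (simp add: power_divide)
  also have "(t - u)\<^sup>2 = 2 * ((t - u) * (cosh d / sinh d)) - sech2 x - sech2 (x - d)"
    unfolding 2 by (simp add: sech2_tanh t_def u_def power2_eq_square algebra_simps)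
  finally show ?thesis unfolding t_def u_def by (simp only: mult_ac)
qed

text \<open>A superposition of solitons at distance \<open>L\<close>; up to an affine change it is
  the cnoidal wave, the square of Jacobi's function cn. \<open>cnQ\<close> and \<open>cnS'\<close>
  are its companions for the squared terms and for the termwise derivatives.\<close>

definition cnS :: "real \<Rightarrow> real \<Rightarrow> real" where
  "cnS L y = (\<Sum>\<^sub>\<infinity>j::int. sech2 (y - of_int j * L))"
definition cnQ :: "real \<Rightarrow> real \<Rightarrow> real" where
  "cnQ L y = (\<Sum>\<^sub>\<infinity>j::int. (sech2 (y - of_int j * L))\<^sup>2)"
definition cnS' :: "real \<Rightarrow> real \<Rightarrow> real" where
  "cnS' L y = (\<Sum>\<^sub>\<infinity>j::int. - 2 * tanh (y - of_int j * L) * sech2 (y - of_int j * L))"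

lemma sech2_lattice_bound:
  assumes "L0 \<le> L" "0 \<le> L0" "\<bar>y\<bar> \<le> X"
  shows "sech2 (y - of_int j * L) \<le> 4 * exp (2 * X) * exp (- (2 * L0) * \<bar>real_of_int j\<bar>)"
proof -
  have "L0 * \<bar>real_of_int j\<bar> \<le> \<bar>of_int j * L\<bar>"
    using mult_right_mono[OF assms(1), of "\<bar>real_of_int j\<bar>"] assms(1,2) by (simp add: abs_mult mult.commute)
  then have "2 * L0 * \<bar>real_of_int j\<bar> - 2 * X \<le> 2 * \<bar>y - of_int j * L\<bar>" using assms(3) by argo
  then have "4 * exp (- 2 * \<bar>y - of_int j * L\<bar>) \<le> 4 * exp (2 * X + - (2 * L0) * \<bar>real_of_int j\<bar>)" by simp
  then show ?thesis using sech2_exp_bound[of "y - of_int j * L"] unfolding exp_add by simp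
qed

lemma sech2_sq_le: "(sech2 y)\<^sup>2 \<le> sech2 y"
  using mult_left_le[OF sech2_le_1, of "sech2 y" y] sech2_pos[of y] by (simp add: power2_eq_square)

lemma abs_tanh_le_1: "\<bar>tanh (y::real)\<bar> \<le> 1"
  using tanh_real_lt_1[of y] tanh_real_gt_neg1[of y] by simp

context
  fixes L :: real
  assumes L: "L > 0"
begin

lemma summable_sech2: "(\<lambda>j::int. sech2 (y - of_int j * L)) summable_on UNIV"
  using L sech2_lattice_bound[of L L y "\<bar>y\<bar>"] sech2_pos
  by (intro summable_on_int_exp_bound[of "2 * L" _ "4 * exp (2 * \<bar>y\<bar>)"]) (auto simp: less_imp_le)

lemma summable_sech2_sq: "(\<lambda>j::int. (sech2 (y - of_int j * L))\<^sup>2) summable_on UNIV"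
  by (rule summable_on_int_comparison[OF _ summable_sech2[of y]]) (simp add: sech2_sq_le)

lemma summable_sech2_deriv: "(\<lambda>j::int. - 2 * tanh (y - of_int j * L) * sech2 (y - of_int j * L)) summable_on UNIV"
proof (rule summable_on_int_comparison[OF _ summable_on_cmult_right[OF summable_sech2[of y], of 2]])
  show "\<bar>- 2 * tanh (y - of_int j * L) * sech2 (y - of_int j * L)\<bar> \<le> 2 * sech2 (y - of_int j * L)" for j
    using mult_right_mono[OF abs_tanh_le_1, of "sech2 (y - of_int j * L)"] sech2_pos[of "y - of_int j * L"]
    by (simp add: abs_mult)
qed

lemma lattice_majorant:
  "\<exists>M. M summable_on UNIV \<and> (\<forall>(j::int) y. \<bar>y\<bar> \<le> X \<longrightarrow> K * sech2 (y - of_int j * L) \<le> M j)" if "K \<ge> 0"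
proof (intro exI conjI allI impI)
  show "(\<lambda>j. K * (4 * exp (2 * X) * exp (- (2 * L) * \<bar>real_of_int j\<bar>))) summable_on UNIV"
    using has_sum_int_exp[of "2 * L"] L
    by (intro summable_on_cmult_right) (auto simp: summable_on_def)
  show "K * sech2 (y - of_int j * L) \<le> K * (4 * exp (2 * X) * exp (- (2 * L) * \<bar>real_of_int j\<bar>))"
    if "\<bar>y\<bar> \<le> X" for j :: int and y
    using sech2_lattice_bound[of L L y X j] L that \<open>K \<ge> 0\<close> by (intro mult_left_mono) auto
qed

lemma DERIV_lattice:
  "(f has_real_derivative f' (y - of_int j * L)) (at (y - of_int j * L)) \<Longrightarrow>
    ((\<lambda>y. f (y - of_int j * L)) has_real_derivative f' (y - of_int j * L)) (at y)" for f f' :: "real \<Rightarrow> real"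
  using DERIV_shift[of f _ y "- (of_int j * L)"] by simp

lemma DERIV_cnS: "(cnS L has_real_derivative cnS' L y) (at y)"
  unfolding cnS_def cnS'_def
proof (rule has_derivative_infsum_int)
  show "((\<lambda>y. sech2 (y - of_int j * L)) has_real_derivative - 2 * tanh (y - of_int j * L) * sech2 (y - of_int j * L)) (at y)" for j y
    by (rule DERIV_lattice[where f' = "\<lambda>y. - 2 * tanh y * sech2 y"]) (rule DERIV_sech2)
  fix X
  obtain M where M: "M summable_on UNIV" "\<And>(j::int) y. \<bar>y\<bar> \<le> X \<Longrightarrow> 2 * sech2 (y - of_int j * L) \<le> M j"
    using lattice_majorant[of 2 X] by auto
  have "\<bar>- 2 * tanh z * sech2 z\<bar> \<le> 2 * sech2 z" for z
    using mult_right_mono[OF abs_tanh_le_1, of "sech2 z" z] sech2_pos[of z] by (simp add: abs_mult)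
  then show "\<exists>M. M summable_on UNIV \<and> (\<forall>(j::int) y. \<bar>y\<bar> \<le> X \<longrightarrow> \<bar>- 2 * tanh (y - of_int j * L) * sech2 (y - of_int j * L)\<bar> \<le> M j)"
    using M by (meson order_trans)
qed (rule summable_sech2)

lemma DERIV_cnS': "(cnS' L has_real_derivative 4 * cnS L y - 6 * cnQ L y) (at y)"
proof -
  have "(cnS' L has_real_derivative (\<Sum>\<^sub>\<infinity>j::int. 4 * sech2 (y - of_int j * L) - 6 * (sech2 (y - of_int j * L))\<^sup>2)) (at y)"
    unfolding cnS'_def
  proof (rule has_derivative_infsum_int)
    show "((\<lambda>y. - 2 * tanh (y - of_int j * L) * sech2 (y - of_int j * L)) has_real_derivative
        4 * sech2 (y - of_int j * L) - 6 * (sech2 (y - of_int j * L))\<^sup>2) (at y)" for j y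
      by (rule DERIV_lattice[where f' = "\<lambda>y. 4 * sech2 y - 6 * (sech2 y)\<^sup>2" and f = "\<lambda>y. - 2 * tanh y * sech2 y"]) (rule DERIV_sech2')
    fix X
    obtain M where M: "M summable_on UNIV" "\<And>(j::int) y. \<bar>y\<bar> \<le> X \<Longrightarrow> 10 * sech2 (y - of_int j * L) \<le> M j"
      using lattice_majorant[of 10 X] by auto
    have "\<bar>4 * sech2 z - 6 * (sech2 z)\<^sup>2\<bar> \<le> 10 * sech2 z" for z
      using sech2_sq_le[of z] sech2_pos[of z] zero_le_power2[of "sech2 z"] unfolding abs_le_iff by argo
    then show "\<exists>M. M summable_on UNIV \<and> (\<forall>(j::int) y. \<bar>y\<bar> \<le> X \<longrightarrow> \<bar>4 * sech2 (y - of_int j * L) - 6 * (sech2 (y - of_int j * L))\<^sup>2\<bar> \<le> M j)"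
      using M by (meson order_trans)
  qed (rule summable_sech2_deriv)
  moreover have "(\<Sum>\<^sub>\<infinity>j::int. 4 * sech2 (y - of_int j * L) - 6 * (sech2 (y - of_int j * L))\<^sup>2) = 4 * cnS L y - 6 * cnQ L y"
    using infsum_add[OF summable_on_cmult_right[OF summable_sech2[of y], of 4] summable_on_cmult_right[OF summable_sech2_sq[of y], of "-6"]]
    unfolding infsum_cmult_right' by (simp add: cnS_def cnQ_def)
  ultimately show ?thesis by simp
qed

lemma cnS_periodic: "cnS L (y + L) = cnS L y"
proof -
  have "cnS L (y + L) = (\<Sum>\<^sub>\<infinity>j::int. sech2 (y - of_int (j + - 1) * L))" unfolding cnS_def by (simp add: algebra_simps)
  then show ?thesis unfolding cnS_def infsum_int_shift(1)[of "\<lambda>j. sech2 (y - of_int j * L)"] .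
qed

lemma cnS_even: "cnS L (- y) = cnS L y"
proof -
  have "sech2 (- y - of_int j * L) = sech2 (y - of_int (- j) * L)" for j
    using sech2_minus[of "y + of_int j * L"] by (simp add: algebra_simps)
  then have "cnS L (- y) = (\<Sum>\<^sub>\<infinity>j::int. sech2 (y - of_int (- j) * L))" unfolding cnS_def by simp
  then show ?thesis unfolding cnS_def infsum_int_shift(2)[of "\<lambda>j. sech2 (y - of_int j * L)"] .
qed

lemma summable_tanh_diff:
  "(\<lambda>i::int. tanh (y - of_int (i + 1) * L) - tanh (y - of_int i * L)) summable_on UNIV"
proof (rule summable_on_int_exp_bound[of "2 * L" _ "L * (4 * exp (2 * (\<bar>y\<bar> + L)))"])
  show "2 * L > 0" using L by simp
  fix i :: int
  define a where "a = y - of_int (i + 1) * L"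
  have ab: "y - of_int i * L = a + L" by (simp add: a_def algebra_simps)
  obtain z where z: "z > a" "z < a + L" "tanh (a + L) - tanh a = (a + L - a) * sech2 z"
    using MVT2[of a "a + L" tanh sech2] DERIV_tanh' L by auto
  have "\<bar>tanh a - tanh (a + L)\<bar> = L * sech2 z" using z(3) L sech2_pos[of z] by (simp add: abs_mult abs_minus_commute)
  also have "\<dots> \<le> L * (4 * exp (2 * (\<bar>y\<bar> + L)) * exp (- (2 * L) * \<bar>real_of_int i\<bar>))"
  proof -
    have "y - L < z + of_int i * L" "z + of_int i * L < y" using z(1,2) by (simp_all add: a_def algebra_simps)
    then have "\<bar>z + of_int i * L\<bar> \<le> \<bar>y\<bar> + L" using L by linarith
    from sech2_lattice_bound[OF _ _ this, of L L i] show ?thesis using L by (intro mult_left_mono) simp_all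
  qed
  finally show "\<bar>tanh (y - of_int (i + 1) * L) - tanh (y - of_int i * L)\<bar> \<le> L * (4 * exp (2 * (\<bar>y\<bar> + L))) * exp (- (2 * L) * \<bar>real_of_int i\<bar>)"
    unfolding ab a_def[symmetric] by (simp add: mult.assoc)
qed

text \<open>Along the lattice index the hyperbolic tangent descends from 1 to -1, so each index step
  contributes -2 to the telescoped sum.\<close>

lemma has_sum_tanh_diff:
  "((\<lambda>i::int. tanh (y - of_int (i + m) * L) - tanh (y - of_int i * L)) has_sum (- 2 * of_int m)) UNIV"
proof -
  have "((\<lambda>i::int. tanh (y - of_int (i + m) * L) - tanh (y - of_int i * L)) has_sum (of_int m * (- 1 - 1))) UNIV"
  proof (rule has_sum_int_telescope[of "\<lambda>i. tanh (y - of_int i * L)"])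
    show "(\<lambda>i. tanh (y - of_int (i + 1) * L) - tanh (y - of_int i * L)) summable_on UNIV" by (rule summable_tanh_diff)
    have "filterlim (\<lambda>n::nat. y - real n * L) at_bot sequentially" using L by real_asymp
    then show "(\<lambda>n. tanh (y - of_int (int n) * L)) \<longlonglongrightarrow> - 1"
      using filterlim_compose[OF tanh_real_at_bot] by simp
    have "filterlim (\<lambda>n::nat. y + real n * L) at_top sequentially" using L by real_asymp
    then show "(\<lambda>n. tanh (y - of_int (- int n) * L)) \<longlonglongrightarrow> 1"
      using filterlim_compose[OF tanh_real_at_top] by simp
  qed
  then show ?thesis by (simp add: mult.commute)
qed

end

section \<open>The quadratic relation for the lattice sum\<close>

text \<open>The terms at \<open>j = 0\<close> are \<open>0\<close> because of \<open>1 / 0 = 0\<close>.\<close>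
definition cnA :: "real \<Rightarrow> real" where
  "cnA L = (\<Sum>\<^sub>\<infinity>m::int. 1 / (sinh (of_int m * L))\<^sup>2)"
definition cnB :: "real \<Rightarrow> real" where
  "cnB L = (\<Sum>\<^sub>\<infinity>m::int. of_int m * (cosh (of_int m * L) / sinh (of_int m * L)) / (sinh (of_int m * L))\<^sup>2)"

lemma inverse_sinh_sq_bound:
  assumes L0: "L0 > 0" and L: "L \<ge> L0"
  shows "\<bar>1 / (sinh (of_int m * L))\<^sup>2\<bar> \<le> 4 / (1 - exp (- 2 * L0))\<^sup>2 * exp (- (2 * L) * \<bar>real_of_int m\<bar>)"
proof (cases "m = 0")
  case False
  define y where "y = \<bar>real_of_int m\<bar> * L"
  have "1 * L0 \<le> \<bar>real_of_int m\<bar> * L" using False L0 L by (intro mult_mono) auto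
  then have y: "y \<ge> L0" by (simp add: y_def)
  define q where "q = 1 - exp (- 2 * L0)"
  have q: "q > 0" using L0 by (simp add: q_def)
  have "sinh y = exp y / 2 * (1 - exp (- 2 * y))"
  proof -
    have "exp y * exp (- 2 * y) = exp (- y)" by (simp flip: exp_add)
    then show ?thesis by (simp add: sinh_field_def right_diff_distrib)
  qed
  also have "\<dots> \<ge> exp y / 2 * q" using y by (intro mult_left_mono) (auto simp: q_def)
  finally have "(exp y / 2 * q)\<^sup>2 \<le> (sinh y)\<^sup>2" using q by (intro power_mono) auto
  moreover have "(sinh (of_int m * L))\<^sup>2 = (sinh y)\<^sup>2"
    using L0 L by (cases "m > 0") (auto simp: y_def)
  ultimately have "1 / (sinh (of_int m * L))\<^sup>2 \<le> 1 / (exp y / 2 * q)\<^sup>2"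
    using q by (intro frac_le) auto
  also have "\<dots> = 4 / q\<^sup>2 * exp (- (2 * L) * \<bar>real_of_int m\<bar>)"
  proof -
    have "exp (- (2 * L) * \<bar>real_of_int m\<bar>) = 1 / (exp y)\<^sup>2"
      by (simp add: y_def exp_minus exp_double[symmetric] field_simps)
    then show ?thesis by (simp add: power_mult_distrib power_divide)
  qed
  finally show ?thesis by (simp add: q_def)
qed (use assms in simp)

context
  fixes L :: real
  assumes L: "L > 0"
begin

lemma summable_cnA: "(\<lambda>m::int. 1 / (sinh (of_int m * L))\<^sup>2) summable_on UNIV"
  by (rule summable_on_int_exp_bound[of "2 * L", OF _ inverse_sinh_sq_bound]) (use L in auto)

text \<open>By \<open>sech2_product\<close> with \<open>d = m * L\<close> the sum splits into a
  telescoping sum of \<open>tanh\<close> and two copies of \<open>cnS L y\<close>. For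
  \<open>m = 0\<close> the two last coefficients are 0 because of division by \<open>sinh 0\<close>,
  so a single formula covers all \<open>m\<close>.\<close>

lemma sech2_correlation:
  "((\<lambda>i::int. sech2 (y - of_int i * L) * sech2 (y - of_int (i + m) * L)) has_sum
    (if m = 0 then cnQ L y else 0) +
    (4 * (of_int m * (cosh (of_int m * L) / sinh (of_int m * L)) / (sinh (of_int m * L))\<^sup>2)
      - 2 * cnS L y * (1 / (sinh (of_int m * L))\<^sup>2))) UNIV"
proof (cases "m = 0")
  case True
  then show ?thesis using has_sum_infsum[OF summable_sech2_sq[OF L, of y]] by (simp add: cnQ_def power2_eq_square)
next
  case False
  define d where "d = of_int m * L"
  have d: "d \<noteq> 0" using False L by (simp add: d_def)
  have S0: "((\<lambda>i::int. sech2 (y - of_int i * L)) has_sum cnS L y) UNIV"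
    unfolding cnS_def by (rule has_sum_infsum[OF summable_sech2[OF L]])
  have Sm: "((\<lambda>i::int. sech2 (y - of_int (i + m) * L)) has_sum cnS L y) UNIV"
    using infsum_int_shift(1,3)[of "\<lambda>i. sech2 (y - of_int i * L)" m] S0 by (simp add: has_sum_iff)
  have T: "((\<lambda>i::int. tanh (y - of_int (i + m) * L) - tanh (y - of_int i * L)) has_sum (- 2 * of_int m)) UNIV"
    by (rule has_sum_tanh_diff[OF L])
  have h: "((\<lambda>i::int. (- 2 * (cosh d / sinh d) / (sinh d)\<^sup>2) * (tanh (y - of_int (i + m) * L) - tanh (y - of_int i * L))
      + ((- 1 / (sinh d)\<^sup>2) * sech2 (y - of_int i * L) + (- 1 / (sinh d)\<^sup>2) * sech2 (y - of_int (i + m) * L))) has_sum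
      ((- 2 * (cosh d / sinh d) / (sinh d)\<^sup>2) * (- 2 * of_int m) + ((- 1 / (sinh d)\<^sup>2) * cnS L y + (- 1 / (sinh d)\<^sup>2) * cnS L y))) UNIV"
    by (intro has_sum_add has_sum_cmult_right S0 Sm T)
  have e1: "(- 2 * (cosh d / sinh d) / (sinh d)\<^sup>2) * (tanh (y - of_int (i + m) * L) - tanh (y - of_int i * L))
      + ((- 1 / (sinh d)\<^sup>2) * sech2 (y - of_int i * L) + (- 1 / (sinh d)\<^sup>2) * sech2 (y - of_int (i + m) * L))
      = sech2 (y - of_int i * L) * sech2 (y - of_int (i + m) * L)" for i
  proof -
    have e: "y - of_int (i + m) * L = (y - of_int i * L) - d" by (simp add: d_def algebra_simps)
    have "(- 2 * (c / s) / s2) * (v - u) + ((- 1 / s2) * p + (- 1 / s2) * q) = (2 * (c / s) * (u - v) - p - q) / s2"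
      for c s s2 u v p q :: real
      by (cases "s = 0"; cases "s2 = 0") (auto simp: field_simps)
    then show ?thesis unfolding e sech2_product[OF d] .
  qed
  have e2: "(- 2 * (cosh d / sinh d) / (sinh d)\<^sup>2) * (- 2 * of_int m) + ((- 1 / (sinh d)\<^sup>2) * cnS L y + (- 1 / (sinh d)\<^sup>2) * cnS L y)
    = 4 * (of_int m * (cosh d / sinh d) / (sinh d)\<^sup>2) - 2 * cnS L y * (1 / (sinh d)\<^sup>2)"
    by simp
  show ?thesis using h False unfolding e1 e2 unfolding d_def by simp
qed

text \<open>In the square of the lattice sum, \<open>sech2_product\<close> turns each sum over pairs of lattice points at a
  fixed distance into telescoping sums of \<open>tanh\<close>.\<close>
lemma cnS_square: "(cnS L y)\<^sup>2 = cnQ L y - 2 * cnA L * cnS L y + 4 * cnB L"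
  and summable_cnB: "(\<lambda>m::int. of_int m * (cosh (of_int m * L) / sinh (of_int m * L)) / (sinh (of_int m * L))\<^sup>2) summable_on UNIV"
proof -
  define s where "s i = sech2 (y - of_int i * L)" for i :: int
  define S where "S = cnS L y"
  have sS: "(s has_sum S) UNIV"
    unfolding s_def S_def cnS_def by (rule has_sum_infsum[OF summable_sech2[OF L]])
  have sp: "\<bar>s i\<bar> = s i" for i by (simp add: s_def sech2_pos less_imp_le)
  have S0: "\<bar>S\<bar> = S" using has_sum_nonneg[OF sS] sp by (metis abs_ge_zero abs_of_nonneg)
  have sh: "((\<lambda>m. s (i + m)) has_sum S) UNIV" for i
    using infsum_int_shift(1,3)[of s i] sS by (simp add: has_sum_iff add.commute)
  have row: "((\<lambda>m. s i * s (i + m)) has_sum (s i * S)) UNIV" for i by (rule has_sum_cmult_right[OF sh])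
  have tot: "((\<lambda>i. s i * S) has_sum (S * S)) UNIV" by (rule has_sum_cmult_left[OF sS])
  have "(\<lambda>p. norm ((\<lambda>(i, m). s i * s (i + m)) p)) summable_on (UNIV \<times> UNIV)"
    unfolding Infinite_Sum.abs_summable_on_Sigma_iff
    using row tot by (auto simp: has_sum_iff abs_mult sp S0)
  then have sm: "(\<lambda>(i, m). s i * s (i + m)) summable_on (UNIV \<times> UNIV)"
    by (rule abs_summable_summable)
  then have sm': "(\<lambda>(m, i). s i * s (i + m)) summable_on (UNIV \<times> UNIV)"
  proof -
    have "bij_betw prod.swap (UNIV \<times> UNIV) (UNIV \<times> UNIV :: (int \<times> int) set)" by (simp add: bij_betw_def)
    from summable_on_reindex_bij_betw[OF this, of "\<lambda>(i, m). s i * s (i + m)"] sm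
    show ?thesis by (simp add: case_prod_unfold prod.swap_def)
  qed
  define a where "a m = 1 / (sinh (of_int m * L))\<^sup>2" for m :: int
  define b where "b m = of_int m * (cosh (of_int m * L) / sinh (of_int m * L)) / (sinh (of_int m * L))\<^sup>2" for m :: int
  define z where "z m = (if m = 0 then cnQ L y else 0)" for m :: int
  have col: "((\<lambda>i. s i * s (i + m)) has_sum (z m + (4 * b m - 2 * S * a m))) UNIV" for m
    unfolding s_def z_def a_def b_def S_def by (rule sech2_correlation)
  have "S * S = (\<Sum>\<^sub>\<infinity>i. \<Sum>\<^sub>\<infinity>m. s i * s (i + m))" using row tot by (simp add: has_sum_iff)
  also have "\<dots> = (\<Sum>\<^sub>\<infinity>m. \<Sum>\<^sub>\<infinity>i. s i * s (i + m))" by (rule infsum_swap_banach[OF sm])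
  also have "\<dots> = (\<Sum>\<^sub>\<infinity>m. z m + (4 * b m - 2 * S * a m))" using col by (simp add: has_sum_iff)
  finally have SS: "S * S = (\<Sum>\<^sub>\<infinity>m. z m + (4 * b m - 2 * S * a m))" .
  have "(\<lambda>m. \<Sum>\<^sub>\<infinity>i. s i * s (i + m)) summable_on UNIV" by (rule summable_on_Sigma_banach[OF sm'])
  then have sc: "(\<lambda>m. z m + (4 * b m - 2 * S * a m)) summable_on UNIV" using col by (simp add: has_sum_iff)
  have hz: "(z has_sum cnQ L y) UNIV"
    using has_sum_cong_neutral[of "{0}" UNIV z z "cnQ L y"] has_sum_finite[of "{0::int}" z]
    by (auto simp: z_def)
  have sa: "a summable_on UNIV" unfolding a_def by (rule summable_cnA)
  \<comment> \<open>Summability of \<open>b\<close> is inherited: \<open>4 * b m\<close> is the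
    column sum minus \<open>z m\<close> plus \<open>2 * S * a m\<close>, and all three families are
    summable.\<close>
  have "(\<lambda>m. 1/4 * ((z m + (4 * b m - 2 * S * a m)) + (- 1 * z m + (2 * S) * a m))) summable_on UNIV"
    using hz by (intro summable_on_cmult_right summable_on_add sc sa) (auto simp: summable_on_def)
  then have sb: "b summable_on UNIV" by (simp add: algebra_simps)
  then show "(\<lambda>m::int. of_int m * (cosh (of_int m * L) / sinh (of_int m * L)) / (sinh (of_int m * L))\<^sup>2) summable_on UNIV"
    unfolding b_def .
  have "((\<lambda>m. z m + (4 * b m + (- 2 * S) * a m)) has_sum (cnQ L y + (4 * cnB L + (- 2 * S) * cnA L))) UNIV"
    unfolding cnA_def cnB_def a_def[symmetric] b_def[symmetric]
    by (intro has_sum_add hz has_sum_cmult_right has_sum_infsum sa sb)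
  then have "S * S = cnQ L y + (4 * cnB L + (- 2 * S) * cnA L)" using SS by (simp add: has_sum_iff)
  then show "(cnS L y)\<^sup>2 = cnQ L y - 2 * cnA L * cnS L y + 4 * cnB L"
    unfolding S_def[symmetric] by (simp add: power2_eq_square algebra_simps)
qed

text \<open>The second derivative \<open>4 * cnS - 6 * cnQ\<close> becomes quadratic in
  \<open>cnS\<close> once \<open>cnQ\<close> is eliminated by \<open>cnS_square\<close>. The factor
  -4 normalizes the leading coefficient -6 to \<open>3/2\<close>.\<close>

lemma cnS_stationary:
  "stationary (\<lambda>y. - 4 * cnS L y) (\<lambda>y. - 4 * cnS' L y) (4 - 12 * cnA L) (- 96 * cnB L)"
  unfolding stationary_def
proof (intro conjI allI)
  show "((\<lambda>y. - 4 * cnS L y) has_real_derivative - 4 * cnS' L y) (at y)" for y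
    by (rule DERIV_cmult[OF DERIV_cnS[OF L]])
  show "((\<lambda>y. - 4 * cnS' L y) has_real_derivative 3/2 * (- 4 * cnS L y)\<^sup>2 + (4 - 12 * cnA L) * (- 4 * cnS L y) + - 96 * cnB L) (at y)" for y
  proof -
    have "((\<lambda>y. - 4 * cnS' L y) has_real_derivative - 4 * (4 * cnS L y - 6 * cnQ L y)) (at y)"
      by (rule DERIV_cmult[OF DERIV_cnS'[OF L]])
    moreover have "cnQ L y = (cnS L y)\<^sup>2 + 2 * cnA L * cnS L y - 4 * cnB L" using cnS_square by simp
    ultimately show ?thesis by (simp add: power2_eq_square algebra_simps)
  qed
qed

text \<open>The primitive is a sum of \<open>tanh\<close> terms, each normalized at 0 so that the
  sum converges. Its gain 2 over a period is the mass of one \<open>sech2\<close> over the whole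
  line.\<close>

lemma cnS_integral:
  obtains Z where "\<And>y. (Z has_real_derivative cnS L y) (at y)" "\<And>y. Z (y + L) = Z y + 2"
proof -
  define F where "F j y = tanh (y - of_int j * L) - tanh (0 - of_int j * L)" for j :: int and y
  have D: "(F j has_real_derivative sech2 (y - of_int j * L)) (at y)" for j y
    unfolding F_def using DERIV_diff[OF DERIV_lattice[OF L, where f = tanh and f' = sech2, OF DERIV_tanh'] DERIV_const[of "tanh (0 - of_int j * L)"]] by simp
  have maj: "\<exists>M. M summable_on UNIV \<and> (\<forall>(j::int) y. \<bar>y\<bar> \<le> X \<longrightarrow> \<bar>sech2 (y - of_int j * L)\<bar> \<le> M j)" for X
    using lattice_majorant[OF L, of 1 X] by (simp add: sech2_pos less_imp_le)
  have sF: "(\<lambda>j. F j y) summable_on UNIV" for y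
  proof -
    obtain M where M: "M summable_on UNIV" "\<And>(j::int) z. \<bar>z\<bar> \<le> \<bar>y\<bar> \<Longrightarrow> \<bar>sech2 (z - of_int j * L)\<bar> \<le> M j"
      using maj by blast
    have "\<bar>F j y\<bar> \<le> \<bar>y\<bar> * M j" for j
    proof -
      have "\<bar>F j y - F j 0\<bar> \<le> M j * \<bar>y - 0\<bar>"
        by (rule field_differentiable_bound[of "{-\<bar>y\<bar>..\<bar>y\<bar>}" "F j" "\<lambda>z. sech2 (z - of_int j * L)" "M j" y 0, unfolded real_norm_def])
           (use D M(2)[of _ j] in \<open>auto intro: DERIV_subset\<close>)
      then show ?thesis by (simp add: F_def mult.commute)
    qed
    then show ?thesis by (rule summable_on_int_comparison) (intro summable_on_cmult_right M(1))
  qed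
  define Z where "Z y = (\<Sum>\<^sub>\<infinity>j. F j y)" for y
  have "(Z has_real_derivative cnS L y) (at y)" for y
    unfolding Z_def cnS_def by (rule has_derivative_infsum_int[OF D maj sF])
  moreover have "Z (y + L) = Z y + 2" for y
  proof -
    have "((\<lambda>i::int. tanh (y - of_int (i + - 1) * L) - tanh (y - of_int i * L)) has_sum (- 2 * of_int (- 1))) UNIV"
      by (rule has_sum_tanh_diff[OF L])
    from has_sum_add[OF this has_sum_infsum[OF sF[of y]]]
    have "((\<lambda>i. F i (y + L)) has_sum (2 + Z y)) UNIV" by (simp add: F_def Z_def algebra_simps)
    then show ?thesis by (simp add: Z_def has_sum_iff)
  qed
  ultimately show thesis by (rule that)
qed

lemma cnS_nonneg: "cnS L y \<ge> 0"
  unfolding cnS_def by (rule infsum_nonneg) (simp add: sech2_pos less_imp_le)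

text \<open>The term \<open>j = 0\<close> is kept and the others are bounded by a geometric series.
  For \<open>\<bar>y\<bar>\<close> up to \<open>L / 2\<close> the error is of order
  \<open>exp (- L)\<close>, so a single soliton dominates for large \<open>L\<close>.\<close>

lemma cnS_le: "cnS L y \<le> sech2 y + 8 * exp (2 * \<bar>y\<bar>) / (exp (2 * L) - 1)"
proof -
  define f where "f j = sech2 (y - of_int j * L)" for j :: int
  have sf: "f summable_on UNIV" unfolding f_def by (rule summable_sech2[OF L])
  have "((\<lambda>j::int. exp (- (2 * L) * \<bar>real_of_int j\<bar>)) has_sum (1 + 2 / (exp (2 * L) - 1))) UNIV"
    by (rule has_sum_int_exp) (use L in simp)
  from has_sum_Diff[OF this, of "{0}" 1]
  have e: "((\<lambda>j::int. exp (- (2 * L) * \<bar>real_of_int j\<bar>)) has_sum (2 / (exp (2 * L) - 1))) (UNIV - {0})"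
    by (simp add: has_sum_finiteI)
  have "(f has_sum cnS L y) UNIV" unfolding cnS_def f_def[symmetric] by (rule has_sum_infsum[OF sf])
  from has_sum_Diff[OF this, of "{0}" "sech2 y"]
  have "(f has_sum (cnS L y - sech2 y)) (UNIV - {0})" by (simp add: has_sum_finiteI f_def)
  moreover have "((\<lambda>j::int. 4 * exp (2 * \<bar>y\<bar>) * exp (- (2 * L) * \<bar>real_of_int j\<bar>)) has_sum (4 * exp (2 * \<bar>y\<bar>) * (2 / (exp (2 * L) - 1)))) (UNIV - {0})"
    by (rule has_sum_cmult_right[OF e])
  ultimately have "cnS L y - sech2 y \<le> 4 * exp (2 * \<bar>y\<bar>) * (2 / (exp (2 * L) - 1))"
    by (rule has_sum_mono) (use sech2_lattice_bound[of L L y "\<bar>y\<bar>"] L in \<open>simp add: f_def\<close>)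
  then show ?thesis by simp
qed

lemma cnS_ge_sech2: "sech2 y \<le> cnS L y"
proof -
  have "infsum (\<lambda>j::int. sech2 (y - of_int j * L)) {0} \<le> cnS L y"
    unfolding cnS_def using sech2_pos summable_sech2[OF L, of y] by (intro infsum_mono2) (auto simp: less_imp_le)
  then show ?thesis by simp
qed

lemma cnS_ge: "cnS L 0 \<ge> 1"
  using cnS_ge_sech2[of 0] by simp

lemma cnS'_0: "cnS' L 0 = 0"
proof -
  have e: "- 2 * tanh (0 - of_int (- j) * L) * sech2 (0 - of_int (- j) * L) =
     - (- 2 * tanh (0 - of_int j * L) * sech2 (0 - of_int j * L))" for j :: int
    by simp
  have "cnS' L 0 = (\<Sum>\<^sub>\<infinity>j::int. - 2 * tanh (0 - of_int (- j) * L) * sech2 (0 - of_int (- j) * L))"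
    unfolding cnS'_def by (rule infsum_int_shift(2)[symmetric])
  also have "\<dots> = - cnS' L 0" unfolding e infsum_uminus cnS'_def ..
  finally show ?thesis by simp
qed

end

section \<open>The lattice sum is nonconstant and has no shorter period\<close>

lemma cnS_double:
  assumes "L > 0" shows "cnS L y = cnS (2 * L) y + cnS (2 * L) (y + L)"
proof -
  define f where "f j = sech2 (y - of_int j * L)" for j :: int
  have sf: "(f has_sum cnS L y) UNIV" unfolding cnS_def f_def by (rule has_sum_infsum[OF summable_sech2[OF assms]])
  have i: "inj (\<lambda>j::int. 2 * j)" "inj (\<lambda>j::int. 2 * j - 1)" by (auto simp: inj_on_def)
  have "f summable_on range (\<lambda>j::int. 2 * j)" "f summable_on range (\<lambda>j::int. 2 * j - 1)"
    using sf summable_on_subset_banach[of f UNIV] by (auto simp: summable_on_def)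
  then have "(f has_sum (infsum f (range (\<lambda>j::int. 2 * j)) + infsum f (range (\<lambda>j::int. 2 * j - 1)))) (range (\<lambda>j::int. 2 * j) \<union> range (\<lambda>j::int. 2 * j - 1))"
    by (intro has_sum_Un_disjoint has_sum_infsum) (auto, presburger)
  moreover have "range (\<lambda>j::int. 2 * j) \<union> range (\<lambda>j::int. 2 * j - 1) = UNIV"
  proof -
    have "x = 2 * (x div 2) \<or> x = 2 * (x div 2 + 1) - 1" for x :: int by presburger
    then show ?thesis by blast
  qed
  ultimately have "cnS L y = infsum f (range (\<lambda>j::int. 2 * j)) + infsum f (range (\<lambda>j::int. 2 * j - 1))"
    using sf infsumI by metis
  also have "infsum f (range (\<lambda>j::int. 2 * j)) = cnS (2 * L) y"
    unfolding infsum_reindex[OF i(1)] cnS_def by (simp add: f_def o_def algebra_simps)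
  also have "infsum f (range (\<lambda>j::int. 2 * j - 1)) = cnS (2 * L) (y + L)"
    unfolding infsum_reindex[OF i(2)] cnS_def by (simp add: f_def o_def algebra_simps)
  finally show ?thesis .
qed

text \<open>The refined lattice is partitioned into its residue classes modulo \<open>l\<close>,
  each a translate of the lattice with spacing \<open>L\<close>.\<close>

lemma cnS_multiple:
  assumes "L > 0" "l \<ge> 1"
  shows "cnS (L / real l) y = (\<Sum>r<l. cnS L (y - real r * (L / real l)))"
proof -
  define D where "D = L / real l"
  have D: "D > 0" "real l * D = L" using assms by (auto simp: D_def)
  define f where "f j = sech2 (y - of_int j * D)" for j :: int
  have sf: "(f has_sum cnS D y) UNIV" unfolding cnS_def f_def by (rule has_sum_infsum[OF summable_sech2[OF D(1)]])
  define R where "R r = range (\<lambda>j::int. int l * j + int r)" for r :: nat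
  have i: "inj (\<lambda>j::int. int l * j + int r)" for r using assms by (auto simp: inj_on_def)
  have part: "(f has_sum cnS L (y - real r * D)) (R r)" for r
  proof -
    have "((f \<circ> (\<lambda>j::int. int l * j + int r)) has_sum cnS L (y - real r * D)) UNIV"
    proof -
      have "f (int l * j + int r) = sech2 (y - real r * D - of_int j * L)" for j
        unfolding f_def D(2)[symmetric] by (simp add: algebra_simps)
      then show ?thesis unfolding cnS_def o_def by (simp add: has_sum_infsum[OF summable_sech2[OF assms(1)]])
    qed
    then show ?thesis unfolding R_def by (subst has_sum_reindex[OF i])
  qed
  have "(f has_sum (\<Sum>r<n. cnS L (y - real r * D))) (\<Union>r<n. R r)" if "n \<le> l" for n
    using that
  proof (induction n)
    case (Suc n)
    have "(\<Union>r<n. R r) \<inter> R n = {}"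
    proof (rule ccontr)
      assume "(\<Union>r<n. R r) \<inter> R n \<noteq> {}"
      then obtain x r where r: "r < n" and x: "x \<in> R r" "x \<in> R n" by blast
      then obtain a b where "x = int l * a + int r" "x = int l * b + int n" unfolding R_def by blast
      then have "(int l * a + int r) mod int l = (int l * b + int n) mod int l" by simp
      then have "int r mod int l = int n mod int l" by simp
      then show False using r(1) Suc.prems by simp
    qed
    from has_sum_Un_disjoint[OF Suc.IH part this] Suc.prems
    show ?case by (simp add: lessThan_Suc Un_commute add.commute)
  qed simp
  moreover have "(\<Union>r<l. R r) = UNIV"
  proof -
    have "x \<in> R (nat (x mod int l))" "nat (x mod int l) < l" for x :: int
      using assms by (auto simp: R_def image_iff nat_less_iff intro!: exI[of _ "x div int l"])
    then show ?thesis by blast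
  qed
  ultimately have "(f has_sum (\<Sum>r<l. cnS L (y - real r * D))) UNIV" by (metis order_refl)
  then show ?thesis using sf has_sum_unique unfolding D_def by blast
qed

text \<open>A continuous function on the line with values in the finite root set of a nonzero
  polynomial cannot jump between roots.\<close>

lemma quadratic_const:
  fixes f :: "real \<Rightarrow> real"
  assumes "continuous_on UNIV f" "A \<noteq> 0" "\<And>y. A * (f y)\<^sup>2 + B * f y + C = 0"
  shows "f x = f y"
proof -
  have "range f \<subseteq> {z. poly [:C, B, A:] z = 0}"
    using assms(3) by (auto simp: power2_eq_square algebra_simps)
  moreover have "finite {z. poly [:C, B, A:] z = 0}" using assms(2) by (intro poly_roots_finite) auto
  ultimately have fin: "finite (range f)" by (rule finite_subset)
  have "f constant_on UNIV"
    by (rule continuous_finite_range_constant[OF connected_UNIV assms(1) fin])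
  then show ?thesis by (auto simp: constant_on_def)
qed

text \<open>Eliminating the second derivative between the two equations leaves a quadratic equation with
  constant coefficients for \<open>f\<close>.\<close>
lemma stationary_affine_const:
  assumes f: "stationary f f' \<beta> \<gamma>" and g: "stationary g g' \<beta>' \<gamma>'"
    and gf: "\<And>y. g y = c + a * f y" and a: "a\<^sup>2 \<noteq> a"
  shows "f x = f y"
proof -
  have g': "g' y = a * f' y" for y
  proof -
    have "((\<lambda>y. c + a * f y) has_real_derivative a * f' y) (at y)"
      by (auto intro!: derivative_eq_intros stationaryD(1)[OF f])
    then have "(g has_real_derivative a * f' y) (at y)" unfolding gf[symmetric] .
    then show ?thesis using DERIV_unique stationaryD(1)[OF g] by blast
  qed
  have key: "3/2 * (c + a * f y)\<^sup>2 + \<beta>' * (c + a * f y) + \<gamma>' = a * (3/2 * (f y)\<^sup>2 + \<beta> * f y + \<gamma>)" for y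
  proof -
    have "((\<lambda>y. a * f' y) has_real_derivative a * (3/2 * (f y)\<^sup>2 + \<beta> * f y + \<gamma>)) (at y)"
      by (rule DERIV_cmult[OF stationaryD(2)[OF f]])
    then have "(g' has_real_derivative a * (3/2 * (f y)\<^sup>2 + \<beta> * f y + \<gamma>)) (at y)" unfolding g'[symmetric] .
    then show ?thesis using DERIV_unique[OF stationaryD(2)[OF g]] unfolding gf by blast
  qed
  have id: "(3/2 * (a\<^sup>2 - a)) * z\<^sup>2 + (3 * a * c + \<beta>' * a - a * \<beta>) * z + (3/2 * c\<^sup>2 + \<beta>' * c + \<gamma>' - a * \<gamma>)
      = 3/2 * (c + a * z)\<^sup>2 + \<beta>' * (c + a * z) + \<gamma>' - a * (3/2 * z\<^sup>2 + \<beta> * z + \<gamma>)" for z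
    by (simp add: field_simps power2_eq_square)
  have "(3/2 * (a\<^sup>2 - a)) * (f y)\<^sup>2 + (3 * a * c + \<beta>' * a - a * \<beta>) * f y + (3/2 * c\<^sup>2 + \<beta>' * c + \<gamma>' - a * \<gamma>) = 0" for y
    unfolding id key by (rule diff_self)
  moreover have "3/2 * (a\<^sup>2 - a) \<noteq> 0" using a by simp
  ultimately show ?thesis using quadratic_const[OF stationaryD(3)[OF f]] by blast
qed

lemma stationary_shift: "stationary f f' \<beta> \<gamma> \<Longrightarrow> stationary (\<lambda>y. f (y + s)) (\<lambda>y. f' (y + s)) \<beta> \<gamma>"
  unfolding stationary_def
  by (intro conjI allI DERIV_at_shift[of f] DERIV_at_shift[of f' "\<lambda>x. 3/2 * (f x)\<^sup>2 + \<beta> * f x + \<gamma>"]) blast+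

text \<open>If the sum for spacing \<open>L\<close> were constant, then by \<open>cnS_double\<close>
  the sum for \<open>2 * L\<close> and its translate by \<open>L\<close> would add up to a constant.
  Both solve the same equation, so \<open>stationary_affine_const\<close> with factor -1 makes the
  sum for \<open>2 * L\<close> constant too. Repeated doubling leads to a spacing
  \<open>l > 2\<close>, where the mean value \<open>2 / l\<close> is below 1 while the value at 0 is
  at least 1.\<close>

lemma cnS_nonconst:
  assumes "L > 0" shows "\<exists>x y. cnS L x \<noteq> cnS L y"
proof (rule ccontr)
  assume "\<not> ?thesis"
  then have c0: "cnS L x = cnS L y" for x y by blast
  have step: "cnS (2 * l) x = cnS (2 * l) y" if l: "l > 0" and c: "\<And>x y. cnS l x = cnS l y" for l x y
  proof -
    note st = cnS_stationary[of "2 * l"]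
    have "- 4 * cnS (2 * l) x = - 4 * cnS (2 * l) y"
    proof (rule stationary_affine_const[OF st stationary_shift[OF st, of l], of "- 4 * cnS l 0" "-1"])
      show "- 4 * cnS (2 * l) (y + l) = - 4 * cnS l 0 + - 1 * (- 4 * cnS (2 * l) y)" for y
        using cnS_double[OF l, of y] c[of y 0] by simp
    qed (use l in auto)
    then show ?thesis by simp
  qed
  have all: "cnS (2 ^ n * L) x = cnS (2 ^ n * L) y" for n x y
  proof (induction n arbitrary: x y)
    case (Suc n)
    show ?case using step[of "2 ^ n * L" x y] Suc assms by (simp add: mult.assoc)
  qed (use c0 in simp)
  obtain n :: nat where "2 / L < 2 ^ n" using real_arch_pow[of 2 "2 / L"] by auto
  then have l: "2 ^ n * L > 2" using assms by (simp add: divide_less_eq)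
  define l where "l = 2 ^ n * L"
  have l2: "l > 2" using l by (simp add: l_def)
  then have l0: "l > 0" by simp
  obtain Z where Z: "\<And>y. (Z has_real_derivative cnS l y) (at y)" "\<And>y. Z (y + l) = Z y + 2"
    using cnS_integral[OF l0] by blast
  obtain z where "Z l - Z 0 = (l - 0) * cnS l z" using MVT2[of 0 l Z "cnS l"] Z(1) l0 by auto
  then have "Z l - Z 0 = l * cnS l z" by simp
  moreover have "cnS l z \<ge> 1" using all[of n z 0] cnS_ge[OF l0] unfolding l_def by simp
  then have "l * 1 \<le> l * cnS l z" using l0 by (intro mult_left_mono) auto
  moreover have "Z l = Z 0 + 2" using Z(2)[of 0] by simp
  ultimately show False using l2 by linarith
qed

text \<open>With a period \<open>L / l\<close>, the sum over the finer lattice would be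
  \<open>l\<close> times the original one by \<open>cnS_multiple\<close>. Both are stationary, and a
  factor \<open>l\<close> other than 0 and 1 forces constancy.\<close>

lemma cnS_no_subperiod:
  assumes "L > 0" "l \<ge> 2" shows "\<exists>y. cnS L (y + L / real l) \<noteq> cnS L y"
proof (rule ccontr)
  assume "\<not> ?thesis"
  then have p: "cnS L (y + L / real l) = cnS L y" for y by blast
  have bk: "cnS L (y - real r * (L / real l)) = cnS L y" for r y
    using period_int_mult[of "cnS L" "L / real l" y "- int r"] p by simp
  have m: "cnS (L / real l) y = real l * cnS L y" for y
    using cnS_multiple[of L l y] assms unfolding bk by simp
  obtain x y where xy: "cnS L x \<noteq> cnS L y" using cnS_nonconst[OF assms(1)] by blast
  have "L / real l > 0" using assms by simp
  have "- 4 * cnS L x = - 4 * cnS L y"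
  proof (rule stationary_affine_const[OF cnS_stationary[OF assms(1)] cnS_stationary[OF \<open>L / real l > 0\<close>], of 0 "real l"])
    show "- 4 * cnS (L / real l) y = 0 + real l * (- 4 * cnS L y)" for y using m by simp
    show "(real l)\<^sup>2 \<noteq> real l" using assms(2) by (simp add: power2_eq_square)
  qed
  then show False using xy by simp
qed

text \<open>The sums are evaluated at a fixed fraction \<theta> of the period. The distance to the
  \<open>j\<close>-th lattice point is then at least \<open>(\<bar>j\<bar> - 1) * L0\<close> for all
  \<open>L >= L0\<close>, which yields one summable majorant.\<close>

lemma lattice_continuous:
  assumes "0 \<le> \<theta>" "\<theta> \<le> 1"
  shows "continuous_on {0<..} (\<lambda>L. cnS L (\<theta> * L))" "continuous_on {0<..} (\<lambda>L. cnQ L (\<theta> * L))"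
proof -
  have sb: "sech2 (\<theta> * L - of_int j * L) \<le> 4 * exp (2 * L0) * exp (- (2 * L0) * \<bar>real_of_int j\<bar>)"
    if "L \<in> {L0..}" "L0 > 0" for L L0 j
  proof -
    have "\<bar>\<theta> * L - of_int j * L\<bar> = \<bar>\<theta> - of_int j\<bar> * L" using that by (simp add: abs_mult left_diff_distrib[symmetric])
    moreover have "(\<bar>real_of_int j\<bar> - 1) * L0 \<le> \<bar>\<theta> - of_int j\<bar> * L"
    proof -
      have "(\<bar>real_of_int j\<bar> - 1) * L0 \<le> \<bar>\<theta> - of_int j\<bar> * L0"
        using assms that by (intro mult_right_mono) auto
      also have "\<dots> \<le> \<bar>\<theta> - of_int j\<bar> * L" using that by (intro mult_left_mono) auto
      finally show ?thesis .
    qed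
    ultimately have "- 2 * \<bar>\<theta> * L - of_int j * L\<bar> \<le> 2 * L0 + - (2 * L0) * \<bar>real_of_int j\<bar>" by argo
    then have "4 * exp (- 2 * \<bar>\<theta> * L - of_int j * L\<bar>) \<le> 4 * exp (2 * L0 + - (2 * L0) * \<bar>real_of_int j\<bar>)" by simp
    then show ?thesis using sech2_exp_bound[of "\<theta> * L - of_int j * L"] unfolding exp_add by simp
  qed
  have sc: "continuous_on A (\<lambda>L. sech2 (\<theta> * L - of_int j * L))" for A j
  proof -
    have "continuous_on UNIV sech2" by (intro continuous_at_imp_continuous_on ballI DERIV_isCont[OF DERIV_sech2])
    then show ?thesis by (rule continuous_on_compose2) (intro continuous_intros, auto)
  qed
  have main: "continuous_on {L0..} (\<lambda>L. cnS L (\<theta> * L))" "continuous_on {L0..} (\<lambda>L. cnQ L (\<theta> * L))" if "L0 > 0" for L0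
  proof -
    have M: "(\<lambda>j. 4 * exp (2 * L0) * exp (- (2 * L0) * \<bar>real_of_int j\<bar>)) summable_on UNIV"
      using has_sum_int_exp[of "2 * L0"] that by (intro summable_on_cmult_right) (auto simp: summable_on_def)
    show "continuous_on {L0..} (\<lambda>L. cnS L (\<theta> * L))"
      unfolding cnS_def
      by (rule continuous_infsum_int[OF sc M]) (use sb that sech2_pos in \<open>auto simp: less_imp_le\<close>)
    show "continuous_on {L0..} (\<lambda>L. cnQ L (\<theta> * L))"
      unfolding cnQ_def
      by (rule continuous_infsum_int[OF continuous_on_power[OF sc] M])
         (simp only: abs_power2, rule order_trans[OF sech2_sq_le sb], use that in auto)
  qed
  have ext: "continuous_on {0<..} F" if "\<And>L0. L0 > 0 \<Longrightarrow> continuous_on {L0..} F" for F :: "real \<Rightarrow> real"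
  proof -
    have "isCont F x" if "x > 0" for x
      by (rule continuous_on_interior[OF \<open>x / 2 > 0 \<Longrightarrow> continuous_on {x/2..} F\<close>[OF _]])
         (use that \<open>\<And>L0. L0 > 0 \<Longrightarrow> continuous_on {L0..} F\<close> in auto)
    then show ?thesis by (intro continuous_at_imp_continuous_on) auto
  qed
  show "continuous_on {0<..} (\<lambda>L. cnS L (\<theta> * L))" "continuous_on {0<..} (\<lambda>L. cnQ L (\<theta> * L))"
    by (rule ext, erule main)+
qed

section \<open>Classification of the minimizers\<close>

text \<open>The second derivative of \<open>- 4 * cnS L\<close> at 0; its sign decides whether the
  wave has its minimum or its maximum there.\<close>

definition cnd :: "real \<Rightarrow> real" where "cnd L = 24 * cnQ L 0 - 16 * cnS L 0"

lemma cnd_deriv: "L > 0 \<Longrightarrow> ((\<lambda>y. - 4 * cnS' L y) has_real_derivative cnd L) (at 0)"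
  using DERIV_cmult[OF DERIV_cnS'[of L 0], of "-4"] by (simp add: cnd_def algebra_simps)

lemma cnS_wave_exists:
  assumes L: "L > 0"
  obtains m M r where "wave (\<lambda>y. - 4 * cnS L y) (\<lambda>y. - 4 * cnS' L y) m M r"
proof -
  obtain x y where "cnS L x \<noteq> cnS L y" using cnS_nonconst[OF L] by blast
  then show thesis
    using stationary_imp_wave[OF cnS_stationary[OF L] L, of x y] cnS_periodic[OF L] that by auto
qed

lemma wave_critical:
  assumes "wave f f' m M r" "f' a = 0" shows "f a = m \<or> f a = M"
proof -
  have "(f a - m) * (f a - M) * (f a - r) = 0" using assms by (metis wave_def power_zero_numeral)
  moreover have "f a < r" using assms by (auto simp: wave_def intro: order.strict_trans1)
  ultimately show ?thesis by simp
qed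

text \<open>By evenness 0 is a critical point, hence a minimum or a maximum of the wave. The second
  derivative is then \<open>(M - m) * (r - m) / 2\<close> or \<open>(M - m) * (M - r) / 2\<close>,
  nonzero in both cases and with opposite signs.\<close>

lemma cnd_nonzero: assumes "L > 0" shows "cnd L \<noteq> 0" "cnd L > 0 \<Longrightarrow> wave (\<lambda>y. - 4 * cnS L y) (\<lambda>y. - 4 * cnS' L y) m M r \<Longrightarrow> - 4 * cnS L 0 = m"
proof -
  have key: "(cnd L > 0 \<and> - 4 * cnS L 0 = m) \<or> cnd L < 0"
    if w: "wave (\<lambda>y. - 4 * cnS L y) (\<lambda>y. - 4 * cnS' L y) m M r" for m M r
  proof -
    have o: "m < M" "M < r" and st: "stationary (\<lambda>y. - 4 * cnS L y) (\<lambda>y. - 4 * cnS' L y) (- (m + M + r)) ((m * M + m * r + M * r) / 2)"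
      using w by (auto simp: wave_def)
    have "- 4 * cnS L 0 = m \<or> - 4 * cnS L 0 = M"
      by (rule wave_critical[OF w]) (simp add: cnS'_0[OF assms])
    moreover have "cnd L > 0" if "- 4 * cnS L 0 = m"
      by (rule wave_modulus(2)[OF w that cnd_deriv[OF assms]])
    moreover have "cnd L < 0" if e: "- 4 * cnS L 0 = M"
    proof -
      have "cnd L = ((M - m) * (M - M) + (M - m) * (M - r) + (M - M) * (M - r)) / 2"
        using DERIV_unique[OF cnd_deriv[OF assms] stationaryD(2)[OF st, unfolded wave_second_deriv, of 0]] unfolding e .
      then have "cnd L = (M - m) * (M - r) / 2" by simp
      then show ?thesis using mult_pos_neg[of "M - m" "M - r"] o by simp
    qed
    ultimately show ?thesis by blast
  qed
  show "cnd L \<noteq> 0" using cnS_wave_exists[OF assms] key by (metis less_irrefl)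
  show "cnd L > 0 \<Longrightarrow> wave (\<lambda>y. - 4 * cnS L y) (\<lambda>y. - 4 * cnS' L y) m M r \<Longrightarrow> - 4 * cnS L 0 = m"
    using key by force
qed

lemma cnQ_bounds:
  assumes "L > 0" shows "1 \<le> cnQ L 0" "cnQ L 0 \<le> cnS L 0"
proof -
  have "infsum (\<lambda>j::int. (sech2 (0 - of_int j * L))\<^sup>2) {0} \<le> cnQ L 0"
    unfolding cnQ_def using summable_sech2_sq[OF assms, of 0] by (intro infsum_mono2) auto
  then show "1 \<le> cnQ L 0" by simp
  show "cnQ L 0 \<le> cnS L 0"
    unfolding cnQ_def cnS_def
    by (intro infsum_mono summable_sech2 summable_sech2_sq assms sech2_sq_le)
qed

lemma cnd_continuous: "continuous_on {0<..} cnd"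
  using lattice_continuous[of 0] unfolding cnd_def by (intro continuous_intros) simp_all

text \<open>The series does not show the sign for short periods. However, \<open>cnd\<close> is
  continuous without zeros on the connected half-line, so one positive value suffices.\<close>

lemma cnd_pos: assumes "L > 0" shows "cnd L > 0"
proof (rule ccontr)
  assume "\<not> cnd L > 0"
  then have neg: "cnd L \<le> 0" by simp
  \<comment> \<open>At spacing 10 the crude bound \<open>exp 20 >= 21\<close> gives
    \<open>cnS 10 0 <= 1.4\<close>, and \<open>24 * 1 - 16 * 1.4\<close> is positive.\<close>
  have "cnd 10 > 0"
  proof -
    have "exp (20::real) \<ge> 1 + 20" by (rule exp_ge_add_one_self)
    then have "8 * exp (2 * \<bar>0\<bar>) / (exp (2 * 10) - 1) \<le> 8 / (20::real)" by (intro frac_le) auto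
    then have "cnS 10 0 \<le> 1 + 8 / 20" using cnS_le[of 10 0] by simp
    then show ?thesis using cnQ_bounds(1)[of 10] by (simp add: cnd_def)
  qed
  have "connected (cnd ` {0<..})"
    by (intro connected_continuous_image cnd_continuous) auto
  moreover have "cnd L \<in> cnd ` {0<..}" "cnd 10 \<in> cnd ` {0<..}" using assms by auto
  ultimately have "0 \<in> cnd ` {0<..}"
    using neg \<open>cnd 10 > 0\<close> unfolding connected_iff_interval by (meson less_imp_le)
  then show False using cnd_nonzero(1) by force
qed

text \<open>Reflection makes \<open>L / 2\<close> critical, so the value there is \<open>m\<close>
  or \<open>M\<close>. If it were the minimum \<open>m\<close>, the wave and its translate by
  \<open>L / 2\<close> would agree at 0 to first order, and uniqueness would give the excluded
  period \<open>L / 2\<close>.\<close>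

lemma cnS_wave:
  assumes L: "L > 0"
  obtains r where "wave (\<lambda>y. - 4 * cnS L y) (\<lambda>y. - 4 * cnS' L y) (- 4 * cnS L 0) (- 4 * cnS L (L / 2)) r"
proof -
  obtain m M r where w: "wave (\<lambda>y. - 4 * cnS L y) (\<lambda>y. - 4 * cnS' L y) m M r" using cnS_wave_exists[OF L] by blast
  have m: "- 4 * cnS L 0 = m" using cnd_nonzero(2)[OF L cnd_pos[OF L] w] .
  have sym: "cnS L (L - y) = cnS L y" for y using cnS_periodic[OF L, of "- y"] cnS_even[OF L, of y] by (simp add: algebra_simps)
  have "cnS' L (L / 2) = 0"
  proof -
    have "((\<lambda>y. cnS L (L - y)) has_real_derivative cnS' L (L - L / 2) * (- 1)) (at (L / 2))"
      by (rule DERIV_chain2[OF DERIV_cnS[OF L]]) (auto intro!: derivative_eq_intros)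
    then have "(cnS L has_real_derivative - cnS' L (L / 2)) (at (L / 2))" unfolding sym by simp
    then have "cnS' L (L / 2) = - cnS' L (L / 2)" using DERIV_unique DERIV_cnS[OF L] by blast
    then show ?thesis by simp
  qed
  then have "- 4 * cnS L (L / 2) = m \<or> - 4 * cnS L (L / 2) = M" by (intro wave_critical[OF w]) simp
  moreover have "- 4 * cnS L (L / 2) \<noteq> m"
  proof
    assume e: "- 4 * cnS L (L / 2) = m"
    note st = cnS_stationary[OF L]
    have b: "\<bar>- 4 * cnS L y\<bar> \<le> \<bar>m\<bar> + \<bar>M\<bar>" for y
    proof -
      have "m \<le> - 4 * cnS L y" "- 4 * cnS L y \<le> M" using w by (auto simp: wave_def)
      then show ?thesis by linarith
    qed
    have "- 4 * cnS L (y + L / 2) = - 4 * cnS L y" for y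
    proof (rule stationary_unique[OF stationary_shift[OF st, of "L / 2"] st, of "\<bar>m\<bar> + \<bar>M\<bar>" 0 y])
      show "- 4 * cnS' L (0 + L / 2) = - 4 * cnS' L 0" using \<open>cnS' L (L / 2) = 0\<close> cnS'_0[OF L] by simp
    qed (rule b, rule b, use e m in simp)
    then show False using cnS_no_subperiod[OF L, of 2] by auto
  qed
  ultimately have "M = - 4 * cnS L (L / 2)" by auto
  then show thesis using that w m by auto
qed

section \<open>The modulus takes every value between 0 and 1\<close>

text \<open>The squared elliptic modulus \<open>(M - m) / (r - m)\<close> of the wave \<open>- 4 * cnS L\<close>, written without the
  third root \<open>r\<close> so that its continuity in \<open>L\<close> is that of the lattice sums.\<close>
definition cnmod :: "real \<Rightarrow> real" where
  "cnmod L = (- 4 * cnS L (L / 2) - - 4 * cnS L 0)\<^sup>2 / (2 * cnd L)"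

lemma cnmod_wave:
  assumes L: "L > 0" and w: "wave (\<lambda>y. - 4 * cnS L y) (\<lambda>y. - 4 * cnS' L y) (- 4 * cnS L 0) (- 4 * cnS L (L / 2)) r"
  shows "(- 4 * cnS L (L / 2) - - 4 * cnS L 0) / (r - - 4 * cnS L 0) = cnmod L"
  unfolding cnmod_def by (rule wave_modulus(1)[OF w refl cnd_deriv[OF L]])

text \<open>The amplitude is at most \<open>4 + 16 / L\<close>, whereas \<open>wave_width\<close>
  with half period \<open>L / 2\<close> bounds the denominator from below by
  \<open>16 / (3 * L^2)\<close>.\<close>

lemma cnmod_small: assumes L: "L > 0" shows "cnmod L \<le> 3/4 * L\<^sup>2 + 3 * L"
proof -
  obtain r where w: "wave (\<lambda>y. - 4 * cnS L y) (\<lambda>y. - 4 * cnS' L y) (- 4 * cnS L 0) (- 4 * cnS L (L / 2)) r"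
    using cnS_wave[OF L] by blast
  have wd: "4 / (3 * (L / 2)\<^sup>2) \<le> r - - 4 * cnS L 0"
    by (rule wave_width[OF w]) (use L in auto)
  have "2 * L \<le> exp (2 * L) - 1" using exp_ge_add_one_self[of "2 * L"] by linarith
  then have "8 / (exp (2 * L) - 1) \<le> 8 / (2 * L)" using L by (intro frac_le) linarith+
  then have "cnS L 0 \<le> 1 + 4 / L" using cnS_le[OF L, of 0] by simp
  then have A: "- 4 * cnS L (L / 2) - - 4 * cnS L 0 \<le> 4 + 16 / L" using cnS_nonneg[OF L, of "L / 2"] by simp
  have "cnmod L \<le> (4 + 16 / L) / (4 / (3 * (L / 2)\<^sup>2))"
    unfolding cnmod_wave[OF L w, symmetric] using A wd L by (intro frac_le) (auto intro: add_nonneg_nonneg)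
  also have "\<dots> = 3/4 * L\<^sup>2 + 3 * L" using L by (simp add: field_simps power2_eq_square)
  finally show ?thesis .
qed

text \<open>For widely separated solitons the squared amplitude tends to 16 and \<open>cnd\<close>
  to 8, so the modulus tends to 1. \<open>q\<close> and \<open>l\<close> are explicit lower bounds
  with that limit; the 192 is 24 times the 8 in \<open>cnS_le\<close>.\<close>

lemma cnmod_large: assumes "\<nu> < 1" shows "\<exists>L>0. \<nu> < cnmod L"
proof -
  define q where "q L = 1 - 4 * exp (- L) - 8 * exp L / (exp (2 * L) - 1)" for L :: real
  define l where "l L = 16 * (q L)\<^sup>2 / (2 * (8 + 192 / (exp (2 * L) - 1)))" for L :: real
  have q: "(q \<longlongrightarrow> 1) at_top" unfolding q_def by real_asymp
  have l: "(l \<longlongrightarrow> 1) at_top" unfolding l_def q_def by real_asymp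
  have "\<forall>\<^sub>F L in at_top. 0 < q L \<and> \<nu> < l L \<and> 0 < L"
    by (intro eventually_conj order_tendstoD(1)[OF q] order_tendstoD(1)[OF l assms] eventually_gt_at_top) simp
  then obtain L where L: "q L > 0" "\<nu> < l L" "L > 0" using eventually_happens by force
  have "cnS L (L / 2) \<le> 4 * exp (- L) + 8 * exp L / (exp (2 * L) - 1)"
    using cnS_le[OF L(3), of "L / 2"] sech2_exp_bound[of "L / 2"] L(3) by simp
  then have q1: "q L \<le> cnS L 0 - cnS L (L / 2)" using cnS_ge[OF L(3)] unfolding q_def by simp
  have "(4 * q L)\<^sup>2 \<le> (- 4 * cnS L (L / 2) - - 4 * cnS L 0)\<^sup>2" using q1 L(1) by (intro power_mono) auto
  then have n: "16 * (q L)\<^sup>2 \<le> (- 4 * cnS L (L / 2) - - 4 * cnS L 0)\<^sup>2" by (simp add: power_mult_distrib)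
  have "cnS L 0 \<le> 1 + 8 / (exp (2 * L) - 1)" using cnS_le[OF L(3), of 0] by simp
  moreover have "cnd L \<le> 24 * cnS L 0 - 16" using cnQ_bounds(2)[OF L(3)] cnS_ge[OF L(3)] unfolding cnd_def by simp
  ultimately have d: "cnd L \<le> 8 + 192 / (exp (2 * L) - 1)" by simp
  have "l L \<le> cnmod L"
    unfolding l_def cnmod_def using n d cnd_pos[OF L(3)] by (intro frac_le) auto
  then show ?thesis using L by (intro exI[of _ L]) auto
qed

lemma cnmod_surj:
  assumes "0 < \<nu>" "\<nu> < 1" shows "\<exists>L>0. cnmod L = \<nu>"
proof -
  \<comment> \<open>Then \<open>L1^2 <= L1\<close>, and the bound of \<open>cnmod_small\<close> is
    at most \<open>15/4 * L1\<close>, which does not exceed \<nu>.\<close>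
  define L1 where "L1 = min 1 (\<nu> / 4)"
  have L1: "L1 > 0" "L1 \<le> 1" "L1 \<le> \<nu> / 4" using assms by (auto simp: L1_def)
  have "L1\<^sup>2 \<le> L1" using L1 by (simp add: power2_eq_square mult_left_le)
  then have lo: "cnmod L1 \<le> \<nu>" using cnmod_small[OF L1(1)] L1 by argo
  obtain L2 where L2: "L2 > 0" "\<nu> < cnmod L2" using cnmod_large[OF assms(2)] by blast
  have "continuous_on {0<..} (\<lambda>L. cnS L (1/2 * L))" by (rule lattice_continuous) auto
  moreover have "continuous_on {0<..} (\<lambda>L. cnS L 0)" using lattice_continuous(1)[of 0] by simp
  ultimately have "continuous_on {0<..} cnmod"
    unfolding cnmod_def using cnd_pos by (intro continuous_intros cnd_continuous) (auto simp: less_imp_neq[symmetric])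
  then have "connected (cnmod ` {0<..})" by (intro connected_continuous_image) auto
  moreover have "cnmod L1 \<in> cnmod ` {0<..}" "cnmod L2 \<in> cnmod ` {0<..}" using L1 L2 by auto
  ultimately have "\<nu> \<in> cnmod ` {0<..}" using lo L2(2) unfolding connected_iff_interval by (meson less_imp_le)
  then show ?thesis by auto
qed

text \<open>\<open>L\<close> is chosen to match the modulus and \<sigma> to match the distance of
  the outer roots. The two are still independent here; only the minimality of the period 1 will
  identify them.\<close>

lemma stationary_classification:
  assumes w: "stationary w w' \<beta> \<gamma>" and per: "per1 w" and nc: "w u \<noteq> w v"
  obtains L \<sigma> a c where "L > 0" "\<sigma> > 0" "\<And>x. w x = c - 4 * \<sigma>\<^sup>2 * cnS L (\<sigma> * (x - a))"
proof -
  obtain m M r where W: "wave w w' m M r"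
    using stationary_imp_wave[OF w, of 1 u v] per nc by (auto simp: per1_def)
  have o: "m < M" "M < r" using W by (auto simp: wave_def)
  have "0 < (M - m) / (r - m)" "(M - m) / (r - m) < 1" using o by auto
  then obtain L where L: "L > 0" "cnmod L = (M - m) / (r - m)" using cnmod_surj by blast
  obtain r2 where w2: "wave (\<lambda>y. - 4 * cnS L y) (\<lambda>y. - 4 * cnS' L y) (- 4 * cnS L 0) (- 4 * cnS L (L / 2)) r2"
    using cnS_wave[OF L(1)] by blast
  obtain a where a: "w a = m" using W by (auto simp: wave_def)
  note sim = wave_similar[OF W w2 _ a refl, unfolded cnmod_wave[OF L(1) w2], OF L(2)[symmetric]]
  define \<sigma> where "\<sigma> = sqrt ((r - m) / (r2 - - 4 * cnS L 0))"
  show thesis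
  proof (rule that[OF L(1)])
    show "\<sigma> > 0" unfolding \<sigma>_def by (rule sim(2))
    show "w x = (m + 4 * \<sigma>\<^sup>2 * cnS L 0) - 4 * \<sigma>\<^sup>2 * cnS L (\<sigma> * (x - a))" for x
      using sim(1)[of x] unfolding \<sigma>_def[symmetric] by (simp add: algebra_simps)
  qed
qed

section \<open>The normalized profile and the form of a minimizer\<close>

text \<open>The parameter is both the lattice spacing and the spatial scale, which gives period 1.
  The lattice sum has integral 2 over its period, so \<open>cnS k (k * x)\<close> has mean
  \<open>2 / k\<close> and the constant \<open>8 * k\<close> makes the mean of \<open>wk k\<close>
  vanish.\<close>

definition wk :: "real \<Rightarrow> real \<Rightarrow> real" where "wk k x = 8 * k - 4 * k\<^sup>2 * cnS k (k * x)"
definition wk' :: "real \<Rightarrow> real \<Rightarrow> real" where "wk' k x = - 4 * k ^ 3 * cnS' k (k * x)"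

lemma DERIV_wk: "k > 0 \<Longrightarrow> (wk k has_real_derivative wk' k x) (at x)"
proof -
  assume k: "k > 0"
  have "((\<lambda>x. cnS k (k * x)) has_real_derivative cnS' k (k * x) * k) (at x)"
    by (rule DERIV_chain2[OF DERIV_cnS[OF k]]) (auto intro!: derivative_eq_intros)
  from DERIV_diff[OF DERIV_const[of "8 * k"] DERIV_cmult[OF this, of "4 * k\<^sup>2"]] show ?thesis
    unfolding wk_def wk'_def by (simp add: power2_eq_square power3_eq_cube algebra_simps)
qed

lemma per1_wk: "k > 0 \<Longrightarrow> per1 (wk k)"
  unfolding per1_def wk_def using cnS_periodic by (simp add: distrib_left)

lemma continuous_wk: "k > 0 \<Longrightarrow> continuous_on A (wk k)"
  by (intro continuous_at_imp_continuous_on ballI DERIV_isCont[OF DERIV_wk])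

lemma continuous_wk': "k > 0 \<Longrightarrow> continuous_on A (wk' k)"
proof -
  assume k: "k > 0"
  have "continuous_on UNIV (cnS' k)" using DERIV_cnS'[OF k] by (intro continuous_at_imp_continuous_on ballI DERIV_isCont)
  then have "continuous_on A (\<lambda>x. cnS' k (k * x))"
    by (rule continuous_on_compose2) (intro continuous_intros, auto)
  then show ?thesis unfolding wk'_def by (intro continuous_intros)
qed

lemma wk_even: "k > 0 \<Longrightarrow> wk k (- x) = wk k x"
  using cnS_even[of k "k * x"] by (simp add: wk_def)

lemma wk_primitive:
  assumes k: "k > 0"
  shows "(LINT x|mT. cnS k (k * x)) = 2 / k" "(LINT x|mT. wk k x) = 0"
proof -
  obtain Z where Z: "\<And>y. (Z has_real_derivative cnS k y) (at y)" "\<And>y. Z (y + k) = Z y + 2"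
    using cnS_integral[OF k] by blast
  have cc: "continuous_on UNIV (\<lambda>x. cnS k (k * x))"
  proof -
    have "continuous_on UNIV (cnS k)" using DERIV_cnS[OF k] by (intro continuous_at_imp_continuous_on ballI DERIV_isCont)
    then show ?thesis by (rule continuous_on_compose2) (intro continuous_intros, auto)
  qed
  have "(LINT x|mT. cnS k (k * x)) = Z (k * (1/2)) / k - Z (k * (-1/2)) / k"
  proof (rule integral_mT_FTC'[OF _ cc])
    show "((\<lambda>x. Z (k * x) / k) has_real_derivative cnS k (k * x)) (at x)" for x
    proof -
      have "((\<lambda>x. Z (k * x)) has_real_derivative cnS k (k * x) * k) (at x)"
        by (rule DERIV_chain2[OF Z(1)]) (auto intro!: derivative_eq_intros)
      from DERIV_cdivide[OF this, of k] show ?thesis using k by simp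
    qed
  qed
  moreover have "Z (k * (1/2)) = Z (k * (-1/2)) + 2" using Z(2)[of "k * (-1/2)"] by (simp add: algebra_simps)
  ultimately show i: "(LINT x|mT. cnS k (k * x)) = 2 / k" by (simp add: diff_divide_distrib[symmetric])
  have "integrable mT (\<lambda>x. cnS k (k * x))" by (rule continuous_integrable_mT[OF continuous_on_subset[OF cc]]) auto
  then have "(LINT x|mT. wk k x) = 8 * k - 4 * k\<^sup>2 * (2 / k)" unfolding wk_def i[symmetric] by (simp add: mT.prob_space)
  then show "(LINT x|mT. wk k x) = 0" using k by (simp add: power2_eq_square)
qed

text \<open>Two different arguments exclude shorter periods. The minimal period of \<open>w\<close>
  is \<open>1 / N\<close>, and minimality of the energy gives \<open>N = 1\<close>. The natural
  period \<open>L / \<sigma>\<close> is then a positive integer, and it is 1 because the lattice sum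
  has no shorter period. That all periods are integers is recorded in order to fix the translation
  of odd maximizers later.\<close>

lemma minimizer_classification:
  assumes E: "E > 0" and adm: "admissible E w h"
    and min: "\<And>v g. admissible E v g \<Longrightarrow> energy w h \<le> energy v g"
  obtains k a where "k > 0" "w = (\<lambda>x. wk k (x - a))"
    "\<forall>p. (\<forall>x. w (x + p) = w x) \<longrightarrow> p \<in> \<int>" "energy w h = energy (wk k) (wk' k)" "admissible E (wk k) (wk' k)"
proof -
  obtain w' \<beta> \<gamma> where w': "stationary w w' \<beta> \<gamma>" "AE x in mT. h x = w' x" "H1 w w'"
    using minimizer_stationary[OF E adm min] by blast
  note D = stationaryD(1)[OF w'(1)] and c' = stationaryD(4)[OF w'(1)] and c = stationaryD(3)[OF w'(1)]
  have adm': "admissible E w w'" using adm w'(3) by (simp add: admissible_def)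
  have "(LINT x|mT. (h x)\<^sup>2) = (LINT x|mT. (w' x)\<^sup>2)"
  proof (rule integral_cong_AE)
    show "(\<lambda>x. (h x)\<^sup>2) \<in> borel_measurable mT" "(\<lambda>x. (w' x)\<^sup>2) \<in> borel_measurable mT"
      using adm H1D(2)[OF w'(3)] H1D(2)[of w h] by (auto simp: admissible_def L2_T_iff)
    show "AE x in mT. (h x)\<^sup>2 = (w' x)\<^sup>2" using w'(2) by eventually_elim simp
  qed
  then have en: "energy w h = energy w w'" by (simp add: energy_def)
  have min': "energy w w' \<le> energy v g" if "admissible E v g" for v g using min[OF that] en by simp
  have per: "per1 w" by (rule H1D(1)[OF w'(3)])
  have "\<exists>u v. w u \<noteq> w v"
  proof (rule ccontr)
    assume neg: "\<not> ?thesis"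
    have wc: "w x = w 0" for x
    proof (rule ccontr)
      assume "w x \<noteq> w 0"
      then have "\<exists>u v. w u \<noteq> w v" by (intro exI)
      with neg show False by (rule notE)
    qed
    define c where "c = w 0"
    have e: "w = (\<lambda>_. c)" unfolding c_def by (rule ext) (rule wc)
    have "(LINT x|mT. w x) = 0" "(LINT x|mT. (w x)\<^sup>2) = 2 * E" using adm by (auto simp: admissible_def)
    then show False using E unfolding e by (simp add: mT.prob_space)
  qed
  then obtain u v where uv: "w u \<noteq> w v" by blast
  obtain L \<sigma> a b where W: "L > 0" "\<sigma> > 0" "\<And>x. w x = b - 4 * \<sigma>\<^sup>2 * cnS L (\<sigma> * (x - a))"
    by (rule stationary_classification[OF w'(1) per uv], rule that)
  obtain p where p: "p > 0" "\<And>x. w (x + p) = w x" "\<And>q. (\<And>x. w (x + q) = w x) \<Longrightarrow> \<exists>n::int. q = of_int n * p"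
    using minimal_period[OF c zero_less_one _ uv] per unfolding per1_def by blast
  obtain n :: int where n: "1 = of_int n * p" using p(3)[of 1] per unfolding per1_def by blast
  have n0: "n > 0" using n p(1) by (metis of_int_0_less_iff zero_less_mult_pos2 zero_less_one)
  define N where "N = nat n"
  have N: "N \<ge> 1" "1 / real N = p" using n n0 by (auto simp: N_def field_simps)
  have "N = 1" by (rule minimizer_no_subperiod[OF E adm' min' D c' N(1)]) (assumption, unfold N(2), rule p(2))
  then have p1: "p = 1" using N(2) by simp
  have ints: "q \<in> \<int>" if "\<And>x. w (x + q) = w x" for q using p(3)[OF that] p1 by auto
  have "w (x + L / \<sigma>) = w x" for x
    unfolding W(3) using cnS_periodic[OF W(1), of "\<sigma> * (x - a)"] W(2) by (simp add: algebra_simps)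
  then obtain l :: int where l: "L / \<sigma> = of_int l" using ints Ints_cases by metis
  have l0: "l > 0" using l W(1,2) by (metis divide_pos_pos of_int_0_less_iff)
  define k where "k = nat l"
  have k: "k \<ge> 1" "L / \<sigma> = real k" using l l0 by (auto simp: k_def)
  then have \<sigma>: "\<sigma> = L / real k" using W(2) by (simp add: field_simps)
  \<comment> \<open>Otherwise the period 1 of \<open>w\<close> would correspond to the period
    \<open>L / k\<close> of the lattice sum.\<close>
  have "k = 1"
  proof (rule ccontr)
    assume "k \<noteq> 1"
    then have "k \<ge> 2" using k by simp
    have "cnS L (y + L / real k) = cnS L y" for y
    proof -
      define x where "x = y / \<sigma> + a"
      have e: "y = \<sigma> * (x - a)" "y + L / real k = \<sigma> * ((x + 1) - a)" using W(2) \<sigma> by (auto simp: x_def algebra_simps)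
      have "w (x + 1) = w x" using per by (simp add: per1_def)
      then have "cnS L (\<sigma> * ((x + 1) - a)) = cnS L (\<sigma> * (x - a))" unfolding W(3) using W(2) by simp
      then show ?thesis unfolding e(2)[symmetric] e(1)[symmetric] .
    qed
    then show False using cnS_no_subperiod[OF W(1) \<open>k \<ge> 2\<close>] by blast
  qed
  then have "\<sigma> = L" using \<sigma> by simp
  define v where "v x = (b - 8 * L) + wk L x" for x
  have wv: "w x = v (x - a)" for x using W(3) \<open>\<sigma> = L\<close> by (simp add: v_def wk_def)
  have pv: "per1 v" using per1_wk[OF W(1)] by (simp add: v_def per1_def)
  have cv: "continuous_on UNIV v" unfolding v_def by (intro continuous_intros continuous_wk W)
  have "(LINT x|mT. v (x + - a)) = 0" using adm by (simp add: admissible_def wv)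
  then have "(LINT x|mT. v x) = 0" unfolding per1_shift_integral[OF pv cv] .
  moreover have "(LINT x|mT. v x) = b - 8 * L"
    unfolding v_def using wk_primitive(2)[OF W(1)] continuous_integrable_mT[OF continuous_wk[OF W(1)]]
    by (simp add: mT.prob_space)
  ultimately have "b = 8 * L" by simp
  then have wk: "w = (\<lambda>x. wk L (x - a))" using wv by (auto simp: v_def)
  have w'k: "w' x = wk' L (x - a)" for x
  proof -
    have "(w has_real_derivative wk' L (x - a)) (at x)"
      unfolding wk using DERIV_at_shift[OF DERIV_wk[OF W(1)], of "- a" x] by simp
    then show ?thesis using DERIV_unique D by blast
  qed
  have e: "(\<lambda>x. w (x + a)) = wk L" "(\<lambda>x. w' (x + a)) = wk' L" using wk w'k by auto
  show thesis
  proof (rule that[OF W(1) wk])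
    show "\<forall>p. (\<forall>x. w (x + p) = w x) \<longrightarrow> p \<in> \<int>" using ints by blast
    show "energy w h = energy (wk L) (wk' L)" using admissible_shift(2)[OF adm' D c', of a] en unfolding e by simp
    show "admissible E (wk L) (wk' L)" using admissible_shift(1)[OF adm' D c', of a] unfolding e .
  qed
qed

section \<open>Asymptotics\<close>

definition Ek :: "real \<Rightarrow> real" where "Ek k = 1/2 * (LINT x|mT. (wk k x)\<^sup>2)"

text \<open>The equation of \<open>cnS_stationary\<close> after scaling, written through
  \<open>wk k\<close> itself so that continuity and integrals over a period are immediate.\<close>

definition wk'' :: "real \<Rightarrow> real \<Rightarrow> real" where
  "wk'' k x = 3/2 * (wk k x - 8 * k)\<^sup>2 + k\<^sup>2 * (4 - 12 * cnA k) * (wk k x - 8 * k) - 96 * k ^ 4 * cnB k"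

lemma DERIV_wk':
  assumes k: "k > 0" shows "(wk' k has_real_derivative wk'' k x) (at x)"
proof -
  have "((\<lambda>x. - 4 * cnS' k (k * x)) has_real_derivative
      (3/2 * (- 4 * cnS k (k * x))\<^sup>2 + (4 - 12 * cnA k) * (- 4 * cnS k (k * x)) + - 96 * cnB k) * k) (at x)"
    by (rule DERIV_chain2[OF stationaryD(2)[OF cnS_stationary[OF k]]]) (auto intro!: derivative_eq_intros)
  from DERIV_cmult[OF this, of "k ^ 3"]
  have "((\<lambda>x. k ^ 3 * (- 4 * cnS' k (k * x))) has_real_derivative
      k ^ 3 * ((3/2 * (- 4 * cnS k (k * x))\<^sup>2 + (4 - 12 * cnA k) * (- 4 * cnS k (k * x)) + - 96 * cnB k) * k)) (at x)" .
  moreover have "k ^ 3 * ((3/2 * (- 4 * cnS k (k * x))\<^sup>2 + (4 - 12 * cnA k) * (- 4 * cnS k (k * x)) + - 96 * cnB k) * k) = wk'' k x"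
    by (simp add: wk''_def wk_def power2_eq_square power3_eq_cube power4_eq_xxxx algebra_simps)
  moreover have "(\<lambda>x. k ^ 3 * (- 4 * cnS' k (k * x))) = wk' k" by (simp add: wk'_def fun_eq_iff)
  ultimately show ?thesis by simp
qed

lemma per1_deriv:
  assumes "per1 f" "\<And>x. (f has_real_derivative f' x) (at x)" shows "per1 f'"
  unfolding per1_def
proof
  fix x
  have "((\<lambda>x. f (x + 1)) has_real_derivative f' (x + 1)) (at x)" by (rule DERIV_at_shift[OF assms(2)])
  then show "f' (x + 1) = f' x" using assms(1) DERIV_unique[OF assms(2)[of x]] by (simp add: per1_def)
qed

context
  fixes k :: real
  assumes k: "k > 0"
begin

lemma H1_wk: "H1 (wk k) (wk' k)"
  by (rule H1_C1[OF per1_wk[OF k] DERIV_wk[OF k] continuous_wk'[OF k]])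

lemma H1_wk': "H1 (wk' k) (wk'' k)"
proof (rule H1_C1[OF per1_deriv[OF per1_wk[OF k] DERIV_wk[OF k]] DERIV_wk'[OF k]])
  show "continuous_on UNIV (wk'' k)" unfolding wk''_def by (intro continuous_intros continuous_wk k)
qed

lemma wk_integrable: "integrable mT (wk k)" "integrable mT (\<lambda>x. (wk k x)\<^sup>2)" "integrable mT (\<lambda>x. (wk k x) ^ 3)"
  by (intro continuous_integrable_mT continuous_intros continuous_wk k)+

text \<open>This is the differential equation of \<open>wk k\<close> integrated over a period.\<close>
lemma Ek_formula: "Ek k = 32/3 * k ^ 3 - 32 * k\<^sup>2 + 32 * (k ^ 4 * cnB k - k ^ 3 * cnA k)"
proof -
  have "(LINT x|mT. wk'' k x) = 0" by (rule H1_integral_0[OF H1_wk'])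
  moreover have "(LINT x|mT. wk'' k x) = 3/2 * (2 * Ek k) + 96 * k\<^sup>2 - 8 * k ^ 3 * (4 - 12 * cnA k) - 96 * k ^ 4 * cnB k"
  proof -
    have "(LINT x|mT. wk'' k x) = (LINT x|mT. 3/2 * (wk k x)\<^sup>2 + (k\<^sup>2 * (4 - 12 * cnA k) - 24 * k) * wk k x
        + (96 * k\<^sup>2 - 8 * k ^ 3 * (4 - 12 * cnA k) - 96 * k ^ 4 * cnB k))"
      by (intro Bochner_Integration.integral_cong)
         (auto simp: wk''_def power2_eq_square power3_eq_cube algebra_simps)
    then show ?thesis using wk_integrable wk_primitive(2)[OF k] by (simp add: Ek_def mT.prob_space)
  qed
  ultimately show ?thesis by (simp add: algebra_simps)
qed

text \<open>Multiplying the differential equation by \<open>wk k\<close> and integrating by parts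
  expresses the gradient term through the quadratic and cubic integrals; the constant in the
  equation drops out since the mean is 0. Only the cubic integral then needs its own
  expansion.\<close>

lemma energy_wk: "- energy (wk k) (wk' k) = 1/2 * (LINT x|mT. (wk k x) ^ 3) + (k\<^sup>2 * (4 - 12 * cnA k) - 24 * k) * (2 * Ek k)"
proof -
  have "(LINT x|mT. (wk' k x)\<^sup>2) = - (LINT x|mT. wk k x * wk'' k x)"
    using H1_parts[OF H1_wk H1_wk'] by (simp add: power2_eq_square)
  also have "(LINT x|mT. wk k x * wk'' k x) = (LINT x|mT. 3/2 * (wk k x) ^ 3 + (k\<^sup>2 * (4 - 12 * cnA k) - 24 * k) * (wk k x)\<^sup>2
        + (96 * k\<^sup>2 - 8 * k ^ 3 * (4 - 12 * cnA k) - 96 * k ^ 4 * cnB k) * wk k x)"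
    by (intro Bochner_Integration.integral_cong)
       (auto simp: wk''_def power2_eq_square power3_eq_cube algebra_simps)
  also have "\<dots> = 3/2 * (LINT x|mT. (wk k x) ^ 3) + (k\<^sup>2 * (4 - 12 * cnA k) - 24 * k) * (2 * Ek k)"
    using wk_integrable wk_primitive(2)[OF k] by (simp add: Ek_def)
  finally show ?thesis by (simp add: energy_def)
qed

lemma cnS_le_cnS_0: "cnS k y \<le> cnS k 0"
proof -
  obtain r where "wave (\<lambda>y. - 4 * cnS k y) (\<lambda>y. - 4 * cnS' k y) (- 4 * cnS k 0) (- 4 * cnS k (k / 2)) r"
    using cnS_wave[OF k] by blast
  then show ?thesis by (auto simp: wave_def)
qed

lemma cnS_bound: "cnS k y \<le> 1 + 4 / k"
proof -
  have "2 * k \<le> exp (2 * k) - 1" using exp_ge_add_one_self[of "2 * k"] by linarith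
  then have "8 / (exp (2 * k) - 1) \<le> 8 / (2 * k)" using k by (intro frac_le) linarith+
  then show ?thesis using cnS_le[OF k, of 0] cnS_le_cnS_0[of y] by simp
qed

text \<open>The bound holds for all \<open>k\<close> up to \<open>K\<close>, however small. It is
  what forces \<open>k\<close> to be large when the energy is large.\<close>

lemma Ek_le: assumes "k \<le> K" shows "Ek k \<le> 1/2 * (4 * K\<^sup>2 + 24 * K)\<^sup>2"
proof -
  have b: "\<bar>wk k x\<bar> \<le> 4 * K\<^sup>2 + 24 * K" for x
  proof -
    have "0 \<le> 4 * k\<^sup>2 * cnS k (k * x)" using cnS_nonneg[OF k] by simp
    moreover have "4 * k\<^sup>2 * cnS k (k * x) \<le> 4 * k\<^sup>2 * (1 + 4 / k)" using cnS_bound by (intro mult_left_mono) auto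
    moreover have "4 * k\<^sup>2 * (1 + 4 / k) = 4 * k\<^sup>2 + 16 * k" using k by (simp add: field_simps power2_eq_square)
    moreover have "k\<^sup>2 \<le> K\<^sup>2" using k assms by (intro power_mono) auto
    ultimately show ?thesis using k assms unfolding wk_def abs_le_iff by argo
  qed
  have "(LINT x|mT. (wk k x)\<^sup>2) \<le> (LINT x|mT. (4 * K\<^sup>2 + 24 * K)\<^sup>2)"
  proof (rule integral_mono)
    show "(wk k x)\<^sup>2 \<le> (4 * K\<^sup>2 + 24 * K)\<^sup>2" for x using b[of x] by (simp add: abs_le_square_iff[symmetric])
  qed (use wk_integrable in auto)
  then show ?thesis by (simp add: Ek_def mT.prob_space)
qed

end

section \<open>Monotonicity and growth of the energy in k\<close>

lemma bounded_at_top_real: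
  fixes f :: "real \<Rightarrow> real"
  assumes "continuous_on {1..} f" "(f \<longlongrightarrow> 0) at_top"
  obtains C where "C > 0" "\<And>y. y \<ge> 1 \<Longrightarrow> \<bar>f y\<bar> \<le> C"
proof -
  have "\<forall>\<^sub>F y in at_top. \<bar>f y\<bar> < 1" using tendstoD[OF assms(2), of 1] by (simp add: dist_real_def)
  then obtain Y where Y: "\<And>y. y \<ge> Y \<Longrightarrow> \<bar>f y\<bar> < 1" by (auto simp: eventually_at_top_linorder)
  have "compact (f ` {1..Y})" using assms(1) by (intro compact_continuous_image) (auto intro: continuous_on_subset)
  then obtain B where B: "\<And>y. y \<in> {1..Y} \<Longrightarrow> \<bar>f y\<bar> \<le> B"
    using compact_imp_bounded bounded_iff by (metis imageI real_norm_def)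
  show thesis
  proof (rule that[of "\<bar>B\<bar> + 1"])
    show "\<bar>f y\<bar> \<le> \<bar>B\<bar> + 1" if "y \<ge> 1" for y
      using Y[of y] B[of y] that by (cases "y \<le> Y") auto
  qed simp
qed

text \<open>With \<open>y = \<bar>m\<bar> * k\<close>, the \<open>m\<close>-th term of
  \<open>k^4 * cnB k - k^3 * cnA k\<close> is \<open>psi y / \<bar>m\<bar>^3\<close>, so a single
  function of one variable controls all terms.\<close>

definition psi :: "real \<Rightarrow> real" where
  "psi y = y ^ 4 * cosh y / (sinh y) ^ 3 - y ^ 3 / (sinh y)\<^sup>2"

text \<open>The derivative decays like \<open>exp (- 2 * y)\<close> up to a polynomial factor; after
  multiplication by \<open>exp y\<close> it still tends to 0, and a continuous function with a limit
  at infinity is bounded on \<open>{1..}\<close>. The mean value theorem finishes.\<close>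

lemma psi_Lipschitz:
  obtains C where "C > 0" "\<And>y z. 1 \<le> y \<Longrightarrow> y \<le> z \<Longrightarrow> \<bar>psi z - psi y\<bar> \<le> C * exp (- y) * (z - y)"
proof -
  define p where "p y = (4 * y ^ 3 * cosh y + y ^ 4 * sinh y) / (sinh y) ^ 3 - 3 * y ^ 4 * (cosh y)\<^sup>2 / (sinh y) ^ 4
    - 3 * y\<^sup>2 / (sinh y)\<^sup>2 + 2 * y ^ 3 * cosh y / (sinh y) ^ 3" for y :: real
  have D: "(psi has_real_derivative p y) (at y)" if "y \<ge> 1" for y
  proof -
    have s: "sinh y \<noteq> 0" using that by simp
    have "(psi has_real_derivative (((4 * y ^ 3 * cosh y + y ^ 4 * sinh y) * (sinh y) ^ 3 - y ^ 4 * cosh y * (3 * (sinh y)\<^sup>2 * cosh y)) / ((sinh y) ^ 3)\<^sup>2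
       - (3 * y\<^sup>2 * (sinh y)\<^sup>2 - y ^ 3 * (2 * sinh y * cosh y)) / ((sinh y)\<^sup>2)\<^sup>2)) (at y)"
      unfolding psi_def using s
      by (auto intro!: derivative_eq_intros simp: power2_eq_square mult_ac)
    moreover have "((4 * y ^ 3 * cosh y + y ^ 4 * sinh y) * (sinh y) ^ 3 - y ^ 4 * cosh y * (3 * (sinh y)\<^sup>2 * cosh y)) / ((sinh y) ^ 3)\<^sup>2
       - (3 * y\<^sup>2 * (sinh y)\<^sup>2 - y ^ 3 * (2 * sinh y * cosh y)) / ((sinh y)\<^sup>2)\<^sup>2 = p y"
      unfolding p_def using s by (simp add: field_simps power2_eq_square power3_eq_cube power4_eq_xxxx)
    ultimately show ?thesis by simp
  qed
  have "continuous_on {1..} (\<lambda>y. exp y * p y)" unfolding p_def by (intro continuous_intros) auto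
  moreover have "((\<lambda>y. exp y * p y) \<longlongrightarrow> 0) at_top"
    unfolding p_def sinh_field_def cosh_field_def by real_asymp
  ultimately obtain C where C: "C > 0" "\<And>y. y \<ge> 1 \<Longrightarrow> \<bar>exp y * p y\<bar> \<le> C" using bounded_at_top_real by blast
  have pb: "\<bar>p y\<bar> \<le> C * exp (- y)" if "y \<ge> 1" for y
    using C(2)[OF that] by (simp add: abs_mult exp_minus field_simps)
  show thesis
  proof (rule that[OF C(1)])
    fix y z :: real assume yz: "1 \<le> y" "y \<le> z"
    show "\<bar>psi z - psi y\<bar> \<le> C * exp (- y) * (z - y)"
    proof (cases "y = z")
      case False
      then obtain t where t: "y < t" "t < z" "psi z - psi y = (z - y) * p t"
        using MVT2[of y z psi p] yz D by auto
      have "\<bar>p t\<bar> \<le> C * exp (- t)" using pb yz t by simp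
      also have "\<dots> \<le> C * exp (- y)" using t C(1) by simp
      finally have "(z - y) * \<bar>p t\<bar> \<le> (z - y) * (C * exp (- y))" using yz by (intro mult_left_mono) auto
      then show ?thesis unfolding t(3) abs_mult using yz by (simp add: mult_ac)
    qed simp
  qed
qed

definition phi :: "real \<Rightarrow> real" where "phi k = k ^ 4 * cnB k - k ^ 3 * cnA k"

lemma phi_has_sum:
  assumes "k > 0"
  shows "((\<lambda>m::int. psi (\<bar>of_int m\<bar> * k) / \<bar>of_int m\<bar> ^ 3) has_sum phi k) UNIV"
proof -
  have "((\<lambda>m::int. k ^ 4 * (of_int m * (cosh (of_int m * k) / sinh (of_int m * k)) / (sinh (of_int m * k))\<^sup>2)
      + (- (k ^ 3)) * (1 / (sinh (of_int m * k))\<^sup>2)) has_sum (k ^ 4 * cnB k + (- (k ^ 3)) * cnA k)) UNIV"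
    unfolding cnA_def cnB_def
    by (intro has_sum_add has_sum_cmult_right has_sum_infsum summable_cnA summable_cnB assms)
  moreover have "k ^ 4 * (of_int m * (cosh (of_int m * k) / sinh (of_int m * k)) / (sinh (of_int m * k))\<^sup>2)
      + (- (k ^ 3)) * (1 / (sinh (of_int m * k))\<^sup>2) = psi (\<bar>of_int m\<bar> * k) / \<bar>of_int m\<bar> ^ 3" for m :: int
  proof -
    have pos: "k ^ 4 * (x * (cosh (x * k) / sinh (x * k)) / (sinh (x * k))\<^sup>2) + (- (k ^ 3)) * (1 / (sinh (x * k))\<^sup>2) = psi (x * k) / x ^ 3"
      if "x > 0" for x :: real
    proof -
      have "sinh (x * k) \<noteq> 0" using that assms by simp
      then show ?thesis unfolding psi_def using that
        by (simp add: field_simps power2_eq_square power3_eq_cube power4_eq_xxxx)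
    qed
    consider "m = 0" | "m > 0" | "m < 0" by linarith
    then show ?thesis
    proof cases
      case 2 then show ?thesis using pos[of "of_int m"] by simp
    next
      case 3 then show ?thesis using pos[of "- of_int m"] by simp
    qed simp
  qed
  ultimately show ?thesis by (simp add: phi_def)
qed

text \<open>A Lipschitz bound stands in for differentiating the lattice sums with respect to
  \<open>k\<close>; against the cubic main part of \<open>Ek\<close> it is all that monotonicity
  needs.\<close>

lemma phi_Lipschitz:
  obtains C where "C > 0" "\<And>k l. 1 \<le> k \<Longrightarrow> k \<le> l \<Longrightarrow> \<bar>phi l - phi k\<bar> \<le> C * (l - k)"
proof -
  obtain C where C: "C > 0" "\<And>y z. 1 \<le> y \<Longrightarrow> y \<le> z \<Longrightarrow> \<bar>psi z - psi y\<bar> \<le> C * exp (- y) * (z - y)"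
    using psi_Lipschitz by blast
  define G where "G = 1 + 2 / (exp 1 - 1 :: real)"
  have Gp: "G > 0" unfolding G_def by (intro add_pos_nonneg) auto
  have G: "((\<lambda>j::int. exp (- 1 * \<bar>real_of_int j\<bar>)) has_sum G) UNIV"
    unfolding G_def by (rule has_sum_int_exp) simp
  show thesis
  proof (rule that[of "C * G"])
    fix k l :: real assume kl: "1 \<le> k" "k \<le> l"
    define f where "f m = psi (\<bar>of_int m\<bar> * l) / \<bar>of_int m\<bar> ^ 3 - psi (\<bar>of_int m\<bar> * k) / \<bar>of_int m\<bar> ^ 3" for m :: int
    have "((\<lambda>m. psi (\<bar>of_int m\<bar> * l) / \<bar>of_int m\<bar> ^ 3 + - (psi (\<bar>of_int m\<bar> * k) / \<bar>of_int m\<bar> ^ 3)) has_sum (phi l + - phi k)) (UNIV :: int set)"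
      using kl by (intro has_sum_add has_sum_uminusI phi_has_sum) auto
    then have f: "(f has_sum (phi l - phi k)) UNIV" by (simp add: f_def[abs_def])
    have M: "((\<lambda>j::int. C * (l - k) * exp (- 1 * \<bar>real_of_int j\<bar>)) has_sum (C * (l - k) * G)) UNIV"
      by (rule has_sum_cmult_right[OF G])
    have fb: "\<bar>f m\<bar> \<le> C * (l - k) * exp (- 1 * \<bar>real_of_int m\<bar>)" for m
    proof (cases "m = 0")
      case False
      define x where "x = \<bar>real_of_int m\<bar>"
      have x: "x \<ge> 1" using False by (simp add: x_def)
      have "1 * 1 \<le> x * k" using x kl by (intro mult_mono) auto
      then have "\<bar>psi (x * l) - psi (x * k)\<bar> \<le> C * exp (- (x * k)) * (x * l - x * k)"
        using x kl by (intro C(2)) (auto intro: mult_left_mono)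
      also have "\<dots> = C * exp (- (x * k)) * (x * (l - k))" by (simp add: right_diff_distrib)
      \<comment> \<open>The chain rule factor \<open>x\<close> is absorbed by the denominator
        \<open>x^3\<close>, and \<open>k >= 1\<close> leaves the summable weight
        \<open>exp (- x)\<close>.\<close>
      also have "\<dots> \<le> C * exp (- x) * (x ^ 3 * (l - k))"
      proof (intro mult_mono)
        show "exp (- (x * k)) \<le> exp (- x)" using mult_left_mono[OF kl(1), of x] x by simp
        show "x \<le> x ^ 3" using x power_increasing[of 1 3 x] by simp
      qed (use C(1) x kl in auto)
      finally have "\<bar>psi (x * l) - psi (x * k)\<bar> / x ^ 3 \<le> C * exp (- x) * (l - k)"
        using x by (simp add: divide_le_eq mult.assoc mult.commute[of "x ^ 3"])
      then show ?thesis unfolding f_def x_def[symmetric] using x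
        by (simp add: diff_divide_distrib[symmetric] abs_divide mult_ac)
    qed (use C(1) kl in \<open>simp add: f_def\<close>)
    have "phi l - phi k \<le> C * (l - k) * G" by (rule has_sum_mono[OF f M]) (use fb in \<open>simp add: abs_le_iff\<close>)
    moreover have "- (phi l - phi k) \<le> C * (l - k) * G"
    proof (rule has_sum_mono[OF has_sum_uminusI[OF f] M])
      show "- f m \<le> C * (l - k) * exp (- 1 * \<bar>real_of_int m\<bar>)" for m using fb[of m] by linarith
    qed
    ultimately show "\<bar>phi l - phi k\<bar> \<le> C * G * (l - k)" by (simp add: abs_le_iff mult_ac)
  qed (use C(1) Gp in simp)
qed

text \<open>The increment of the polynomial part contains the factor \<open>l - k\<close>. For
  arguments of at least 6 its cofactor is at least \<open>(64 - 32) * (l + k)\<close>, which exceeds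
  the loss \<open>32 * C\<close> from \<open>phi\<close> as soon as both arguments exceed
  \<open>C\<close>.\<close>

lemma Ek_eventually_strict_mono:
  obtains K where "K \<ge> 1" "\<And>k l. K \<le> k \<Longrightarrow> k < l \<Longrightarrow> Ek k < Ek l"
proof -
  obtain C where C: "C > 0" "\<And>k l. 1 \<le> k \<Longrightarrow> k \<le> l \<Longrightarrow> \<bar>phi l - phi k\<bar> \<le> C * (l - k)"
    using phi_Lipschitz by blast
  show thesis
  proof (rule that[of "6 + C"])
    fix k l :: real assume kl: "6 + C \<le> k" "k < l"
    have k1: "1 \<le> k" "1 \<le> l" using kl C(1) by auto
    have E: "Ek x = 32/3 * x ^ 3 - 32 * x\<^sup>2 + 32 * phi x" if "1 \<le> x" for x
      using Ek_formula[of x] that by (simp add: phi_def)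
    have "- (C * (l - k)) \<le> phi l - phi k" using C(2)[of k l] kl k1 by (simp add: abs_le_iff)
    moreover have "0 < (l - k) * (32/3 * (l\<^sup>2 + l * k + k\<^sup>2) - 32 * (l + k) - 32 * C)"
    proof (rule mult_pos_pos)
      have "6 * l \<le> l * l" "6 * k \<le> k * k" using kl C(1) by (auto intro!: mult_right_mono)
      moreover have "0 \<le> l * k" using k1 by simp
      ultimately have "32/3 * (6 * (l + k)) \<le> 32/3 * (l\<^sup>2 + l * k + k\<^sup>2)" by (simp add: power2_eq_square)
      then show "0 < 32/3 * (l\<^sup>2 + l * k + k\<^sup>2) - 32 * (l + k) - 32 * C" using kl C(1) by argo
    qed (use kl in simp)
    moreover have "(l - k) * (32/3 * (l\<^sup>2 + l * k + k\<^sup>2) - 32 * (l + k) - 32 * C) =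
      (32/3 * l ^ 3 - 32 * l\<^sup>2) - (32/3 * k ^ 3 - 32 * k\<^sup>2) - 32 * (C * (l - k))"
      by (simp add: power2_eq_square power3_eq_cube field_simps)
    ultimately show "Ek k < Ek l" unfolding E[OF k1(1)] E[OF k1(2)] by argo
  qed (use C(1) in simp)
qed

text \<open>The Lipschitz bound makes \<open>phi\<close> grow at most linearly, which is within the
  error already present from the quadratic term of the polynomial.\<close>

lemma Ek_asymp: obtains C where "\<And>k. k \<ge> 1 \<Longrightarrow> \<bar>Ek k - 32/3 * k ^ 3\<bar> \<le> C * k\<^sup>2"
proof -
  obtain C where C: "C > 0" "\<And>k l. 1 \<le> k \<Longrightarrow> k \<le> l \<Longrightarrow> \<bar>phi l - phi k\<bar> \<le> C * (l - k)"
    using phi_Lipschitz by blast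
  show thesis
  proof (rule that[of "32 + 32 * (\<bar>phi 1\<bar> + C)"])
    fix k :: real assume k: "k \<ge> 1"
    have k2: "1 \<le> k\<^sup>2" "k \<le> k\<^sup>2" using k one_le_power[of k 2] self_le_power[of k 2] by auto
    have "\<bar>phi k\<bar> \<le> \<bar>phi 1\<bar> + C * (k - 1)" using C(2)[of 1 k] k by linarith
    also have "\<dots> \<le> \<bar>phi 1\<bar> * k\<^sup>2 + C * k\<^sup>2"
      using k2 C(1) mult_left_mono[OF k2(1), of "\<bar>phi 1\<bar>"] by (intro add_mono mult_left_mono) auto
    finally have "\<bar>phi k\<bar> \<le> (\<bar>phi 1\<bar> + C) * k\<^sup>2" by (simp add: algebra_simps)
    moreover have "Ek k - 32/3 * k ^ 3 = 32 * phi k - 32 * k\<^sup>2" using Ek_formula[of k] k by (simp add: phi_def)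
    ultimately show "\<bar>Ek k - 32/3 * k ^ 3\<bar> \<le> (32 + 32 * (\<bar>phi 1\<bar> + C)) * k\<^sup>2"
      using k2 by (simp add: abs_le_iff algebra_simps)
  qed
qed

text \<open>From \<open>exp (- 2 * k * \<bar>m\<bar>)\<close> a factor \<open>exp (- k)\<close> is
  split off and the rest stays summable uniformly in \<open>k\<close>. Order \<open>1 / k\<close>
  suffices, since in the energy formula \<open>k^2 * cnA k\<close> stands next to a term of order
  \<open>k\<close>.\<close>

lemma cnA_bound: obtains C where "C > 0" "\<And>k. k \<ge> 1 \<Longrightarrow> 0 \<le> cnA k \<and> cnA k \<le> C / k"
proof -
  define q where "q = 4 / (1 - exp (- 2 * (1::real)))\<^sup>2"
  define G where "G = 1 + 2 / (exp 1 - 1 :: real)"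
  have Gp: "G > 0" unfolding G_def by (intro add_pos_nonneg) auto
  have qp: "q > 0" unfolding q_def by simp
  have G: "((\<lambda>j::int. exp (- 1 * \<bar>real_of_int j\<bar>)) has_sum G) UNIV"
    unfolding G_def by (rule has_sum_int_exp) simp
  show thesis
  proof (rule that[of "q * G"])
    fix k :: real assume k: "k \<ge> 1"
    have s: "((\<lambda>m::int. 1 / (sinh (of_int m * k))\<^sup>2) has_sum cnA k) UNIV"
      unfolding cnA_def using k by (intro has_sum_infsum summable_cnA) simp
    have "0 \<le> cnA k" unfolding cnA_def by (rule infsum_nonneg) simp
    moreover have "cnA k \<le> q * exp (- k) * G"
    proof (rule has_sum_mono[OF s has_sum_cmult_right[OF G]])
      fix m :: int
      show "1 / (sinh (of_int m * k))\<^sup>2 \<le> q * exp (- k) * exp (- 1 * \<bar>real_of_int m\<bar>)"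
      proof (cases "m = 0")
        case False
        then have m: "1 \<le> \<bar>real_of_int m\<bar>" by simp
        have "k * 1 \<le> k * \<bar>real_of_int m\<bar>" using m k by (intro mult_left_mono) auto
        moreover have "1 * \<bar>real_of_int m\<bar> \<le> k * \<bar>real_of_int m\<bar>" using k by (intro mult_right_mono) auto
        ultimately have "- (2 * k) * \<bar>real_of_int m\<bar> \<le> - k + - 1 * \<bar>real_of_int m\<bar>" by simp
        then have "exp (- (2 * k) * \<bar>real_of_int m\<bar>) \<le> exp (- k) * exp (- 1 * \<bar>real_of_int m\<bar>)"
          unfolding exp_add[symmetric] by simp
        then have "q * exp (- (2 * k) * \<bar>real_of_int m\<bar>) \<le> q * (exp (- k) * exp (- 1 * \<bar>real_of_int m\<bar>))"
          using qp by (intro mult_left_mono) auto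
        then show ?thesis using inverse_sinh_sq_bound[of 1 k m] k unfolding q_def by (simp add: mult.assoc)
      qed (use qp in simp)
    qed
    moreover have "k \<le> exp k" using exp_ge_add_one_self[of k] by linarith
    then have "1 / exp k \<le> 1 / k" using k by (intro frac_le) auto
    then have "exp (- k) \<le> 1 / k" by (simp add: exp_minus inverse_eq_divide)
    then have "q * exp (- k) * G \<le> q * (1 / k) * G" using qp Gp k by (intro mult_mono) auto
    ultimately show "0 \<le> cnA k \<and> cnA k \<le> q * G / k" by simp
  qed (use qp Gp in simp)
qed

section \<open>Comparison with a single soliton\<close>

text \<open>On one period \<open>2 * \<bar>k * x\<bar>\<close> is at most \<open>k\<close>, so the
  geometric tail in \<open>cnS_le\<close> is of size \<open>exp k / exp (2 * k)\<close>.\<close>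

lemma cnS_remainder:
  assumes k: "k \<ge> 1" and x: "x \<in> TT"
  shows "0 \<le> cnS k (k * x) - sech2 (k * x)" "cnS k (k * x) - sech2 (k * x) \<le> 16 * exp (- k)"
proof -
  have k0: "k > 0" using k by simp
  show "0 \<le> cnS k (k * x) - sech2 (k * x)" using cnS_ge_sech2[OF k0] by simp
  have "2 * \<bar>k * x\<bar> \<le> k"
  proof -
    have "\<bar>x\<bar> \<le> 1/2" using x by (auto simp: TT_iff)
    then have "k * \<bar>x\<bar> \<le> k * (1/2)" using k0 by (intro mult_left_mono) auto
    then show ?thesis using k0 by (simp add: abs_mult)
  qed
  then have "8 * exp (2 * \<bar>k * x\<bar>) / (exp (2 * k) - 1) \<le> 8 * exp k / (exp (2 * k) / 2)"
  proof (intro frac_le mult_left_mono)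
    have "2 \<le> exp (2 * k)" using exp_ge_add_one_self[of "2 * k"] k by linarith
    then show "exp (2 * k) / 2 \<le> exp (2 * k) - 1" by simp
  qed auto
  also have "\<dots> = 16 * exp (- k)"
  proof -
    have "exp (2 * k) = exp k * exp k" by (simp flip: exp_add)
    then show ?thesis by (simp add: exp_minus field_simps)
  qed
  finally show "cnS k (k * x) - sech2 (k * x) \<le> 16 * exp (- k)" using cnS_le[OF k0, of "k * x"] by simp
qed

lemma exp_decay: "k * exp (- k) \<le> 1" for k :: real
proof -
  have "k \<le> exp k" using exp_ge_add_one_self[of k] by linarith
  then show ?thesis by (simp add: exp_minus inverse_eq_divide)
qed

lemma integral_sech2_le:
  assumes k: "k > 0" shows "(LINT x|mT. sech2 (k * x)) \<le> 2 / k"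
    "integrable mT (\<lambda>x. (sech2 (k * x)) ^ n)" "continuous_on A (\<lambda>x. (sech2 (k * x)) ^ n)"
proof -
  have c0: "continuous_on UNIV sech2" by (intro continuous_at_imp_continuous_on ballI DERIV_isCont[OF DERIV_sech2])
  have c: "continuous_on A (\<lambda>x. sech2 (k * x))" for A by (rule continuous_on_compose2[OF c0]) (intro continuous_intros, auto)
  show "continuous_on A (\<lambda>x. (sech2 (k * x)) ^ n)" by (intro continuous_intros c)
  show "integrable mT (\<lambda>x. (sech2 (k * x)) ^ n)" by (intro continuous_integrable_mT continuous_intros c)
  have "(LINT x|mT. sech2 (k * x)) = tanh (k * (1/2)) / k - tanh (k * (-1/2)) / k"
  proof (rule integral_mT_FTC'[OF _ c])
    fix x
    have "((\<lambda>x. tanh (k * x)) has_real_derivative sech2 (k * x) * k) (at x)"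
      by (rule DERIV_chain2[OF DERIV_tanh']) (auto intro!: derivative_eq_intros)
    from DERIV_cdivide[OF this, of k] show "((\<lambda>x. tanh (k * x) / k) has_real_derivative sech2 (k * x)) (at x)" using k by simp
  qed
  also have "\<dots> \<le> 1 / k - (- 1) / k"
    using k tanh_real_lt_1[of "k * (1/2)"] tanh_real_gt_neg1[of "k * (-1/2)"]
    by (intro diff_mono divide_right_mono) auto
  finally show "(LINT x|mT. sech2 (k * x)) \<le> 2 / k" by (simp add: diff_divide_distrib[symmetric])
qed

text \<open>The substitution \<open>t = tanh (k * x)\<close> turns the integrand into
  \<open>(1 - t^2)^2 / k\<close> with primitive \<open>P\<close>. The value
  \<open>P 1 = 8/15\<close> gives \<open>16 / (15 * k)\<close>, and the error is the distance of
  \<open>tanh (k / 2)\<close> from 1.\<close>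

lemma integral_sech2_cube:
  assumes k: "k \<ge> 1" shows "\<bar>(LINT x|mT. (sech2 (k * x)) ^ 3) - 16 / (15 * k)\<bar> \<le> 4 * exp (- k)"
proof -
  have k0: "k > 0" using k by simp
  define P where "P t = t - 2/3 * t ^ 3 + t ^ 5 / 5" for t :: real
  define T where "T = tanh (k / 2)"
  have DP: "(P has_real_derivative (1 - t\<^sup>2)\<^sup>2) (at t)" for t
    unfolding P_def by (auto intro!: derivative_eq_intros simp: power2_eq_square power4_eq_xxxx algebra_simps)
  have "(LINT x|mT. (sech2 (k * x)) ^ 3) = P (tanh (k * (1/2))) / k - P (tanh (k * (-1/2))) / k"
  proof (rule integral_mT_FTC'[OF _ integral_sech2_le(3)[OF k0]])
    fix x
    have "((\<lambda>x. tanh (k * x)) has_real_derivative sech2 (k * x) * k) (at x)"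
      by (rule DERIV_chain2[OF DERIV_tanh']) (auto intro!: derivative_eq_intros)
    from DERIV_cdivide[OF DERIV_chain2[OF DP this], of k]
    have "((\<lambda>x. P (tanh (k * x)) / k) has_real_derivative (1 - (tanh (k * x))\<^sup>2)\<^sup>2 * (sech2 (k * x) * k) / k) (at x)" .
    then show "((\<lambda>x. P (tanh (k * x)) / k) has_real_derivative (sech2 (k * x)) ^ 3) (at x)"
      using k0 unfolding sech2_tanh[symmetric] by (simp add: power2_eq_square power3_eq_cube mult_ac)
  qed
  also have "\<dots> = 2 * P T / k" by (simp add: P_def T_def diff_divide_distrib[symmetric])
  finally have I: "(LINT x|mT. (sech2 (k * x)) ^ 3) = 2 * P T / k" .
  have T: "0 < T" "T < 1" using k0 by (auto simp: T_def tanh_real_lt_1)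
  obtain z where z: "T < z" "z < 1" "P 1 - P T = (1 - T) * (1 - z\<^sup>2)\<^sup>2"
    using MVT2[of T 1 P "\<lambda>t. (1 - t\<^sup>2)\<^sup>2"] T DP by auto
  have "(1 - z\<^sup>2)\<^sup>2 \<le> 1" using z T by (intro power_le_one) (auto simp: power_le_one)
  then have d: "0 \<le> P 1 - P T" "P 1 - P T \<le> 1 - T"
    unfolding z(3) using T by (auto intro: mult_left_le)
  have "1 - T \<le> 2 * exp (- k)"
  proof -
    have "1 - T = 2 * exp (- k) / (1 + exp (- k))"
      unfolding T_def tanh_real_altdef by (simp add: field_simps add_pos_pos[THEN less_imp_neq, symmetric])
    also have "\<dots> \<le> 2 * exp (- k) / 1" by (intro divide_left_mono) (auto intro: add_pos_pos)
    finally show ?thesis by simp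
  qed
  then have d2: "P 1 - P T \<le> 2 * exp (- k)" using d by linarith
  have P1: "P 1 = 8/15" by (simp add: P_def)
  have "(LINT x|mT. (sech2 (k * x)) ^ 3) - 16 / (15 * k) = - (2 * (P 1 - P T) / k)"
    unfolding I P1 using k0 by (simp add: field_simps)
  also have "\<bar>\<dots>\<bar> = 2 * (P 1 - P T) / k" using d(1) k0 by simp
  also have "\<dots> \<le> 2 * (P 1 - P T) / 1" using d(1) k by (intro divide_left_mono) auto
  finally show ?thesis using d2 by simp
qed

text \<open>The main part \<open>- 4 * k^2 * sech2\<close> contributes
  \<open>- 64 * k^6 * 16 / (15 * k)\<close>. The rest \<open>r\<close> is at most
  \<open>72 * k\<close>: 8 from the constant in \<open>wk\<close> and 64 from the neighbouring
  solitons.\<close>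

lemma wk_cube_asymp: assumes k: "k \<ge> 1"
  shows "\<bar>(LINT x|mT. (wk k x) ^ 3) + 1024/15 * k ^ 5\<bar> \<le> 1000000 * k ^ 4"
proof -
  have k0: "k > 0" using k by simp
  define s where "s x = sech2 (k * x)" for x
  define r where "r x = 8 * k - 4 * k\<^sup>2 * (cnS k (k * x) - s x)" for x
  have w: "wk k x = - 4 * k\<^sup>2 * s x + r x" for x by (simp add: wk_def r_def algebra_simps)
  have s: "0 \<le> s x" "s x \<le> 1" for x by (auto simp: s_def sech2_pos less_imp_le sech2_le_1)
  have r: "\<bar>r x\<bar> \<le> 72 * k" if "x \<in> TT" for x
  proof -
    define d where "d = cnS k (k * x) - s x"
    have d: "0 \<le> d" "d \<le> 16 * exp (- k)" using cnS_remainder[OF k that] by (auto simp: d_def s_def)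
    have "4 * k\<^sup>2 * d \<le> 4 * k\<^sup>2 * (16 * exp (- k))" using d by (intro mult_left_mono) auto
    also have "\<dots> = 64 * k * (k * exp (- k))" by (simp add: power2_eq_square)
    also have "\<dots> \<le> 64 * k * 1" using exp_decay[of k] k0 by (intro mult_left_mono) auto
    finally have "4 * k\<^sup>2 * d \<le> 64 * k" by simp
    moreover have "0 \<le> 4 * k\<^sup>2 * d" using d by simp
    ultimately show ?thesis using k0 unfolding r_def d_def[symmetric] abs_le_iff by linarith
  qed
  have i3: "integrable mT (\<lambda>x. (s x) ^ 3)" and i1: "integrable mT s"
    unfolding s_def using integral_sech2_le(2)[OF k0, of 3] integral_sech2_le(2)[OF k0, of 1] by simp_all
  have eq: "(LINT x|mT. (wk k x) ^ 3) + 64 * k ^ 6 * (LINT x|mT. (s x) ^ 3) = (LINT x|mT. (wk k x) ^ 3 + 64 * k ^ 6 * (s x) ^ 3)"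
    using wk_integrable(3)[OF k0] i3 by simp
  \<comment> \<open>A factor \<open>s x\<close> is kept in the pointwise bound of the mixed terms:
    its integral is at most \<open>2 / k\<close>, which gains the power of \<open>k\<close> that a
    supremum bound would lose.\<close>
  have "\<bar>(LINT x|mT. (wk k x) ^ 3) + 64 * k ^ 6 * (LINT x|mT. (s x) ^ 3)\<bar> \<le> (LINT x|mT. 70000 * k ^ 5 * s x + 400000 * k ^ 3)"
    unfolding eq
  proof (rule integral_abs_bound_integral)
    fix x assume "x \<in> space mT"
    then have rx: "\<bar>r x\<bar> \<le> 72 * k" using r by (simp add: space_mT)
    have k35: "k ^ 4 \<le> k ^ 5" using k by (intro power_increasing) auto
    have r2: "(r x)\<^sup>2 \<le> 5184 * k\<^sup>2" using power_mono[OF rx, of 2] by (simp add: power_mult_distrib)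
    have r3: "\<bar>r x ^ 3\<bar> \<le> 373248 * k ^ 3" using power_mono[OF rx, of 3] by (simp add: power_mult_distrib power_abs)
    have "(wk k x) ^ 3 + 64 * k ^ 6 * (s x) ^ 3 = 48 * k ^ 4 * (s x)\<^sup>2 * r x - 12 * k\<^sup>2 * s x * (r x)\<^sup>2 + r x ^ 3"
      unfolding w by (simp add: power2_eq_square power3_eq_cube power4_eq_xxxx eval_nat_numeral algebra_simps)
    moreover have "\<bar>48 * k ^ 4 * (s x)\<^sup>2 * r x\<bar> \<le> 3456 * k ^ 5 * s x"
    proof -
      have "(s x)\<^sup>2 * \<bar>r x\<bar> \<le> s x * (72 * k)"
        using s[of x] rx by (intro mult_mono) (auto simp: power2_eq_square mult_left_le)
      then have "48 * k ^ 4 * ((s x)\<^sup>2 * \<bar>r x\<bar>) \<le> 48 * k ^ 4 * (s x * (72 * k))" using k0 by (intro mult_left_mono) auto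
      then show ?thesis using k0 by (simp add: abs_mult eval_nat_numeral algebra_simps)
    qed
    moreover have "\<bar>12 * k\<^sup>2 * s x * (r x)\<^sup>2\<bar> \<le> 62208 * k ^ 5 * s x"
    proof -
      have "12 * k\<^sup>2 * s x * (r x)\<^sup>2 \<le> 12 * k\<^sup>2 * s x * (5184 * k\<^sup>2)" using r2 s[of x] by (intro mult_left_mono) auto
      also have "\<dots> = 62208 * k ^ 4 * s x" by (simp add: eval_nat_numeral algebra_simps)
      also have "\<dots> \<le> 62208 * k ^ 5 * s x" using k35 s[of x] by (intro mult_right_mono) auto
      finally show ?thesis using s[of x] by (simp add: abs_mult)
    qed
    moreover have "0 \<le> k ^ 5 * s x" "0 \<le> k ^ 3" using s[of x] k0 by auto
    ultimately show "\<bar>(wk k x) ^ 3 + 64 * k ^ 6 * (s x) ^ 3\<bar> \<le> 70000 * k ^ 5 * s x + 400000 * k ^ 3"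
      using r3 unfolding abs_le_iff by argo
  qed (use wk_integrable(3)[OF k0] i3 i1 in auto)
  also have "\<dots> = 70000 * k ^ 5 * (LINT x|mT. s x) + 400000 * k ^ 3" using i1 by (simp add: mT.prob_space)
  also have "\<dots> \<le> 70000 * k ^ 5 * (2 / k) + 400000 * k ^ 3"
    unfolding s_def using integral_sech2_le(1)[OF k0] k0 by (intro add_mono mult_left_mono) auto
  also have "\<dots> = 140000 * k ^ 4 + 400000 * k ^ 3" using k0 by (simp add: eval_nat_numeral)
  also have "\<dots> \<le> 540000 * k ^ 4" using power_increasing[of 3 4 k] k by simp
  finally have 1: "\<bar>(LINT x|mT. (wk k x) ^ 3) + 64 * k ^ 6 * (LINT x|mT. (s x) ^ 3)\<bar> \<le> 540000 * k ^ 4" .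
  have eq2: "64 * k ^ 6 * (LINT x|mT. (s x) ^ 3) - 1024/15 * k ^ 5 = 64 * k ^ 6 * ((LINT x|mT. (s x) ^ 3) - 16 / (15 * k))"
    using k0 by (simp add: eval_nat_numeral right_diff_distrib)
  have "\<bar>64 * k ^ 6 * (LINT x|mT. (s x) ^ 3) - 1024/15 * k ^ 5\<bar> \<le> 64 * k ^ 6 * (4 * exp (- k))"
    unfolding eq2 using integral_sech2_cube[OF k] k0 unfolding s_def by (simp add: abs_mult)
  also have "\<dots> = 256 * k ^ 4 * (k\<^sup>2 * exp (- k))" by (simp add: eval_nat_numeral)
  also have "\<dots> \<le> 256 * k ^ 4 * 4"
  proof -
    have "(k/2 * exp (- (k/2)))\<^sup>2 \<le> 1" using exp_decay[of "k/2"] k0 by (intro power_le_one) auto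
    then have "k\<^sup>2 * exp (- k) \<le> 4" by (simp add: power_mult_distrib power_divide exp_double[symmetric])
    then show ?thesis using k0 by (intro mult_left_mono) auto
  qed
  finally have 2: "\<bar>64 * k ^ 6 * (LINT x|mT. (s x) ^ 3) - 1024/15 * k ^ 5\<bar> \<le> 1024 * k ^ 4" by simp
  have "0 \<le> k ^ 4" by simp
  then show ?thesis using 1 2 unfolding abs_le_iff by argo
qed

text \<open>In \<open>energy_wk\<close> the cubic integral contributes \<open>- 512/15 * k^5\<close>
  and the energy term \<open>4 * k^2 * 2 * 32/3 * k^3\<close>; together these are
  \<open>256/5 * k^5\<close>. Everything else is of order \<open>k^4\<close>.\<close>

lemma energy_asymp: obtains C where "\<And>k. k \<ge> 1 \<Longrightarrow> \<bar>- energy (wk k) (wk' k) - 256/5 * k ^ 5\<bar> \<le> C * k ^ 4"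
proof -
  obtain C1 where C1: "\<And>k. k \<ge> 1 \<Longrightarrow> \<bar>Ek k - 32/3 * k ^ 3\<bar> \<le> C1 * k\<^sup>2" using Ek_asymp by blast
  obtain C2 where C2: "C2 > 0" "\<And>k. k \<ge> 1 \<Longrightarrow> 0 \<le> cnA k \<and> cnA k \<le> C2 / k" using cnA_bound by blast
  have C1p: "C1 \<ge> 0" using C1[of 1] by simp
  show thesis
  proof (rule that[of "500000 + 8 * C1 + (24 + 12 * C2) * (64/3 + 2 * C1)"])
    fix k :: real assume k: "k \<ge> 1"
    have k0: "k > 0" using k by simp
    define e where "e = Ek k - 32/3 * k ^ 3"
    define t where "t = (LINT x|mT. (wk k x) ^ 3) + 1024/15 * k ^ 5"
    define a where "a = 12 * cnA k * k\<^sup>2 + 24 * k"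
    have e: "\<bar>e\<bar> \<le> C1 * k\<^sup>2" using C1[OF k] by (simp add: e_def)
    have t: "\<bar>t\<bar> \<le> 1000000 * k ^ 4" using wk_cube_asymp[OF k] by (simp add: t_def)
    have a: "0 \<le> a" "a \<le> (24 + 12 * C2) * k"
    proof -
      have "cnA k * k\<^sup>2 \<le> C2 / k * k\<^sup>2" using C2(2)[OF k] by (intro mult_right_mono) auto
      also have "\<dots> = C2 * k" using k0 by (simp add: power2_eq_square)
      finally show "a \<le> (24 + 12 * C2) * k" by (simp add: a_def algebra_simps)
      show "0 \<le> a" using C2(2)[OF k] k0 by (simp add: a_def)
    qed
    have eq: "- energy (wk k) (wk' k) - 256/5 * k ^ 5 = 1/2 * t + 8 * k\<^sup>2 * e - a * (64/3 * k ^ 3 + 2 * e)"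
      unfolding energy_wk[OF k0] t_def e_def a_def by (simp add: eval_nat_numeral field_simps)
    have "\<bar>64/3 * k ^ 3 + 2 * e\<bar> \<le> (64/3 + 2 * C1) * k ^ 3"
    proof -
      have "C1 * k\<^sup>2 \<le> C1 * k ^ 3" using C1p k by (intro mult_left_mono power_increasing) auto
      moreover have "0 \<le> k ^ 3" using k0 by simp
      ultimately show ?thesis using e unfolding abs_le_iff distrib_right by argo
    qed
    then have "a * \<bar>64/3 * k ^ 3 + 2 * e\<bar> \<le> ((24 + 12 * C2) * k) * ((64/3 + 2 * C1) * k ^ 3)"
      using a k0 C2(1) by (intro mult_mono) auto
    also have "\<dots> = (24 + 12 * C2) * (64/3 + 2 * C1) * k ^ 4" by (simp add: eval_nat_numeral)
    finally have 1: "\<bar>a * (64/3 * k ^ 3 + 2 * e)\<bar> \<le> (24 + 12 * C2) * (64/3 + 2 * C1) * k ^ 4" using a(1) by (simp add: abs_mult)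
    have "8 * k\<^sup>2 * \<bar>e\<bar> \<le> 8 * k\<^sup>2 * (C1 * k\<^sup>2)" using e by (intro mult_left_mono) auto
    then have 2: "\<bar>8 * k\<^sup>2 * e\<bar> \<le> 8 * C1 * k ^ 4" by (simp add: abs_mult eval_nat_numeral mult_ac)
    show "\<bar>- energy (wk k) (wk' k) - 256/5 * k ^ 5\<bar> \<le> (500000 + 8 * C1 + (24 + 12 * C2) * (64/3 + 2 * C1)) * k ^ 4"
      unfolding eq distrib_right[of _ _ "k ^ 4"] using 1 2 t by linarith
  qed
qed

section \<open>The maximizer as a primitive, and its expansions\<close>

text \<open>The primitive is normalized at 0: since \<open>wk k\<close> is even, this makes it
  odd.\<close>

definition uk :: "real \<Rightarrow> real \<Rightarrow> real" where
  "uk k = (SOME u. (\<forall>x. (u has_real_derivative wk k x) (at x)) \<and> u 0 = 0)"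

lemma uk:
  assumes k: "k > 0"
  shows "(uk k has_real_derivative wk k x) (at x)" "uk k 0 = 0"
proof -
  obtain U where "\<And>x. (U has_real_derivative wk k x) (at x)"
    using continuous_antiderivative[OF continuous_wk[OF k]] by blast
  then have "(\<forall>x. ((\<lambda>x. U x - U 0) has_real_derivative wk k x) (at x)) \<and> U 0 - U 0 = 0"
    using DERIV_diff[OF _ DERIV_const, of U _ _ UNIV "U 0"] by auto
  then have "(\<forall>x. (uk k has_real_derivative wk k x) (at x)) \<and> uk k 0 = 0"
    unfolding uk_def by (rule someI[where P = "\<lambda>u. (\<forall>x. (u has_real_derivative wk k x) (at x)) \<and> u 0 = 0"])
  then show "(uk k has_real_derivative wk k x) (at x)" "uk k 0 = 0" by auto
qed

lemma DERIV_eq_imp_eq: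
  fixes u v :: "real \<Rightarrow> real"
  assumes "\<And>x. (u has_real_derivative w x) (at x)" "\<And>x. (v has_real_derivative w x) (at x)" "u a = v a"
  shows "u = v"
proof
  fix x
  have "((\<lambda>x. u x - v x) has_real_derivative 0) (at x)" for x using DERIV_diff[OF assms(1,2)] by simp
  then have "u x - v x = u a - v a" by (rule DERIV_isconst_all[rule_format])
  then show "u x = v x" using assms(3) by simp
qed

lemma per1_uk: "k > 0 \<Longrightarrow> per1 (uk k)"
  by (rule per1_antiderivative[OF uk(1) continuous_wk per1_wk wk_primitive(2)])

lemma uk_odd: assumes k: "k > 0" shows "uk k (- x) = - uk k x"
proof -
  have "(\<lambda>x. - uk k (- x)) = uk k"
  proof (rule DERIV_eq_imp_eq[where a = 0])
    show "((\<lambda>x. - uk k (- x)) has_real_derivative wk k x) (at x)" for x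
    proof -
      have "((\<lambda>x. uk k (- x)) has_real_derivative wk k (- x) * - 1) (at x)"
        by (rule DERIV_chain2[OF uk(1)[OF k]]) (auto intro!: derivative_eq_intros)
      from DERIV_minus[OF this] show ?thesis by (simp add: wk_even[OF k])
    qed
  qed (use uk[OF k] in auto)
  then show ?thesis by (metis minus_minus)
qed

text \<open>The difference vanishes at 0, and its derivative is the soliton remainder times
  \<open>- 4 * k^2\<close>, hence at most \<open>64 * k^2 * exp (- k)\<close> in size. The distance
  from 0 within the period is at most 1/2.\<close>

lemma uk_profile:
  assumes k: "k \<ge> 1" and x: "x \<in> TT"
  shows "\<bar>uk k x - 4 * k * (2 * x - tanh (k * x))\<bar> \<le> 32 * (k\<^sup>2 * exp (- k))"
proof -
  have k0: "k > 0" using k by simp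
  define f where "f x = uk k x - 4 * k * (2 * x - tanh (k * x))" for x
  define f' where "f' x = - 4 * k\<^sup>2 * (cnS k (k * x) - sech2 (k * x))" for x
  have D: "(f has_real_derivative f' x) (at x)" for x
  proof -
    have t: "((\<lambda>x. tanh (k * x)) has_real_derivative sech2 (k * x) * k) (at x)"
      by (rule DERIV_chain2[OF DERIV_tanh']) (auto intro!: derivative_eq_intros)
    have two: "((\<lambda>x. 2 * x) has_real_derivative 2) (at x)" by (auto intro!: derivative_eq_intros)
    have "(f has_real_derivative wk k x - 4 * k * (2 - sech2 (k * x) * k)) (at x)"
      unfolding f_def
      by (rule DERIV_diff[OF uk(1)[OF k0] DERIV_cmult[OF DERIV_diff[OF two t]]])
    moreover have "wk k x - 4 * k * (2 - sech2 (k * x) * k) = f' x"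
      by (simp add: f'_def wk_def power2_eq_square algebra_simps)
    ultimately show ?thesis by simp
  qed
  have b: "\<bar>f' z\<bar> \<le> 64 * (k\<^sup>2 * exp (- k))" if "z \<in> TT" for z
  proof -
    define d where "d = cnS k (k * z) - sech2 (k * z)"
    have d: "0 \<le> d" "d \<le> 16 * exp (- k)" using cnS_remainder[OF k that] by (auto simp: d_def)
    have "4 * k\<^sup>2 * d \<le> 4 * k\<^sup>2 * (16 * exp (- k))" using d by (intro mult_left_mono) auto
    then show ?thesis unfolding f'_def d_def[symmetric] using d(1) by (simp add: abs_mult)
  qed
  have "\<bar>f x - f 0\<bar> \<le> 64 * (k\<^sup>2 * exp (- k)) * \<bar>x - 0\<bar>"
    by (rule field_differentiable_bound[of TT f f' "64 * (k\<^sup>2 * exp (- k))" x 0, unfolded real_norm_def])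
       (use D b x in \<open>auto intro: DERIV_subset simp: TT_def\<close>)
  also have "\<dots> \<le> 64 * (k\<^sup>2 * exp (- k)) * (1/2)"
    using x by (intro mult_left_mono) (auto simp: TT_iff)
  finally show ?thesis using uk(2)[OF k0] by (simp add: f_def mult_ac)
qed

text \<open>Replacing \<open>tanh (k * x)\<close> by the sign of \<open>x\<close> turns the square
  of the profile into the sawtooth square \<open>p x = 16 * k^2 * (1 - 2 * \<bar>x\<bar>)^2\<close>,
  whose integral is \<open>16/3 * k^2\<close>. The replacement matters only near 0, in a layer of
  width about \<open>1 / k\<close>.\<close>

lemma uk_square_asymp:
  assumes k: "k \<ge> 1"
  shows "\<bar>(LINT x|mT. (uk k x)\<^sup>2) - 16/3 * k\<^sup>2\<bar> \<le> 20000 * k"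
proof -
  have k0: "k > 0" using k by simp
  define t where "t x = tanh (k * x)" for x
  define u0 where "u0 x = 4 * k * (2 * x - t x)" for x
  define p where "p x = 16 * k\<^sup>2 * (4 * x\<^sup>2 - 4 * \<bar>x\<bar> + 1)" for x
  have cu: "continuous_on A (uk k)" for A
    using uk(1)[OF k0] by (intro continuous_at_imp_continuous_on ballI DERIV_isCont)
  have kk: "k\<^sup>2 * exp (- k) \<le> 4"
  proof -
    have "(k/2 * exp (- (k/2)))\<^sup>2 \<le> 1" using exp_decay[of "k/2"] k0 by (intro power_le_one) auto
    then show ?thesis by (simp add: power_mult_distrib power_divide exp_double[symmetric])
  qed
  have int_p: "(LINT x|mT. p x) = 16/3 * k\<^sup>2"
  proof -
    define F where "F x = 16 * k\<^sup>2 * (4/3 * x ^ 3 - 2 * x * \<bar>x\<bar> + x)" for x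
    have "((\<lambda>x::real. x * \<bar>x\<bar>) has_real_derivative 2 * \<bar>x\<bar>) (at x)" for x
    proof (cases "x = 0")
      case True
      have "((\<lambda>h::real. \<bar>h\<bar>) \<longlongrightarrow> 0) (at 0)" by (rule tendsto_eq_intros refl)+ simp
      then have "((\<lambda>h::real. (h * \<bar>h\<bar>) / h) \<longlongrightarrow> 0) (at 0)"
        by (rule Lim_transform_eventually) (auto simp: eventually_at_filter)
      then show ?thesis unfolding True DERIV_def by simp
    next
      case False
      have sq: "((\<lambda>x. c * x\<^sup>2) has_real_derivative c * (2 * x)) (at x)" for c
        by (auto intro!: derivative_eq_intros)
      show ?thesis
      proof (cases "x > 0")
        case True
        have "((\<lambda>x. x * \<bar>x\<bar>) has_real_derivative 1 * (2 * x)) (at x)"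
          by (rule has_field_derivative_transform_within_open[OF sq[of 1], where S = "{0<..}"])
            (use True in \<open>auto simp: power2_eq_square\<close>)
        then show ?thesis using True by simp
      next
        case neg: False
        have "((\<lambda>x. x * \<bar>x\<bar>) has_real_derivative - 1 * (2 * x)) (at x)"
          by (rule has_field_derivative_transform_within_open[OF sq[of "- 1"], where S = "{..<0}"])
            (use False neg in \<open>auto simp: power2_eq_square\<close>)
        then show ?thesis using neg by simp
      qed
    qed
    note dabs = this
    have "(F has_real_derivative p x) (at x)" for x
    proof -
      have "(F has_real_derivative 16 * k\<^sup>2 * (4/3 * (3 * x\<^sup>2) - 2 * (2 * \<bar>x\<bar>) + 1)) (at x)"
        unfolding F_def mult.assoc
        by (rule DERIV_cmult DERIV_add DERIV_diff DERIV_ident dabs DERIV_pow[of 3, simplified])+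
      then show ?thesis by (simp add: p_def)
    qed
    then have "(LINT x|mT. p x) = F (1/2) - F (-1/2)"
      by (rule integral_mT_FTC') (unfold p_def, intro continuous_intros)
    then show ?thesis by (simp add: F_def power3_eq_cube)
  qed
  have bound: "\<bar>(uk k x)\<^sup>2 - p x\<bar> \<le> 32 * 4 * (16 * k + 32 * 4) + 16 * k\<^sup>2 * (4 / k + sech2 (k * x))" if x: "x \<in> TT" for x
  proof -
    define e where "e = uk k x - u0 x"
    have e: "\<bar>e\<bar> \<le> 32 * 4" using uk_profile[OF k x] kk by (simp add: e_def u0_def t_def)
    have "\<bar>2 * x - t x\<bar> \<le> 2"
      using x abs_tanh_le_1[of "k * x"] unfolding t_def TT_iff abs_le_iff by linarith
    then have "4 * k * \<bar>2 * x - t x\<bar> \<le> 4 * k * 2" using k0 by (intro mult_left_mono) auto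
    then have u0: "\<bar>u0 x\<bar> \<le> 8 * k" using k0 by (simp add: u0_def abs_mult)
    have "\<bar>e\<bar> * \<bar>2 * u0 x + e\<bar> \<le> (32 * 4) * (16 * k + 32 * 4)"
      using e u0 by (intro mult_mono) auto
    moreover have "(uk k x)\<^sup>2 - (u0 x)\<^sup>2 = e * (2 * u0 x + e)" by (simp add: e_def power2_eq_square algebra_simps)
    ultimately have 1: "\<bar>(uk k x)\<^sup>2 - (u0 x)\<^sup>2\<bar> \<le> 32 * 4 * (16 * k + 32 * 4)" by (simp add: abs_mult)
    have tx: "\<bar>x\<bar> * tanh (k * \<bar>x\<bar>) = x * t x" by (cases "x \<ge> 0") (auto simp: t_def)
    define y where "y = k * \<bar>x\<bar>"
    have y: "y \<ge> 0" using k0 by (simp add: y_def)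
    have "1 - tanh y \<le> 2 * exp (- 2 * y)"
    proof -
      have "1 - tanh y = 2 * exp (- 2 * y) / (1 + exp (- 2 * y))"
        unfolding tanh_real_altdef by (simp add: field_simps add_pos_pos[THEN less_imp_neq, symmetric])
      also have "\<dots> \<le> 2 * exp (- 2 * y) / 1" by (intro divide_left_mono) (auto intro: add_pos_pos)
      finally show ?thesis by simp
    qed
    \<comment> \<open>\<open>y * (1 - tanh y)\<close> stays bounded by 1, so
      \<open>\<bar>x\<bar> - x * t x\<close> is at most \<open>1 / k\<close> uniformly, including
      near 0 where \<open>tanh\<close> is far from the sign.\<close>
    then have "y * (1 - tanh y) \<le> y * (2 * exp (- 2 * y))" using y by (intro mult_left_mono)
    also have "\<dots> \<le> 1" using exp_decay[of "2 * y"] by simp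
    finally have "k * (\<bar>x\<bar> * (1 - tanh y)) \<le> 1" by (simp add: y_def mult.assoc)
    then have "\<bar>x\<bar> * (1 - tanh y) \<le> 1 / k" using k0 by (simp add: pos_le_divide_eq mult.commute)
    moreover have "0 \<le> \<bar>x\<bar> * (1 - tanh y)" using tanh_real_lt_1[of y] by simp
    moreover have "\<bar>x\<bar> * (1 - tanh y) = \<bar>x\<bar> - x * t x" unfolding y_def tx[symmetric] by (simp add: right_diff_distrib)
    ultimately have d: "0 \<le> \<bar>x\<bar> - x * t x" "\<bar>x\<bar> - x * t x \<le> 1 / k" by auto
    have eq: "(u0 x)\<^sup>2 - p x = 16 * k\<^sup>2 * (4 * (\<bar>x\<bar> - x * t x) - sech2 (k * x))"
      by (simp add: u0_def p_def sech2_tanh t_def power2_eq_square algebra_simps)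
    have "\<bar>4 * (\<bar>x\<bar> - x * t x) - sech2 (k * x)\<bar> \<le> 4 / k + sech2 (k * x)"
      using d sech2_pos[of "k * x"] unfolding abs_le_iff by simp
    then have "16 * k\<^sup>2 * \<bar>4 * (\<bar>x\<bar> - x * t x) - sech2 (k * x)\<bar> \<le> 16 * k\<^sup>2 * (4 / k + sech2 (k * x))"
      by (intro mult_left_mono) auto
    then have "\<bar>(u0 x)\<^sup>2 - p x\<bar> \<le> 16 * k\<^sup>2 * (4 / k + sech2 (k * x))" unfolding eq by (simp add: abs_mult)
    then show ?thesis using 1 by linarith
  qed
  have i: "integrable mT (\<lambda>x. (uk k x)\<^sup>2)" "integrable mT p"
    unfolding p_def by (intro continuous_integrable_mT continuous_intros cu)+
  have isx: "integrable mT (\<lambda>x. sech2 (k * x))" using integral_sech2_le(2)[OF k0, of 1] by simp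
  have eq: "(LINT x|mT. (uk k x)\<^sup>2) - 16/3 * k\<^sup>2 = (LINT x|mT. (uk k x)\<^sup>2 - p x)"
    unfolding int_p[symmetric] using i by simp
  have "\<bar>(LINT x|mT. (uk k x)\<^sup>2) - 16/3 * k\<^sup>2\<bar> \<le> (LINT x|mT. 32 * 4 * (16 * k + 32 * 4) + 16 * k\<^sup>2 * (4 / k + sech2 (k * x)))"
    unfolding eq by (rule integral_abs_bound_integral) (use bound i isx in \<open>auto simp: space_mT\<close>)
  also have "\<dots> = 32 * 4 * (16 * k + 32 * 4) + 16 * k\<^sup>2 * (4 / k + (LINT x|mT. sech2 (k * x)))"
    using isx by (simp add: mT.prob_space)
  also have "\<dots> \<le> 32 * 4 * (16 * k + 32 * 4) + 16 * k\<^sup>2 * (4 / k + 2 / k)"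
    using integral_sech2_le(1)[OF k0] by (intro add_left_mono mult_left_mono) auto
  also have "16 * k\<^sup>2 * (4 / k + 2 / k) = 96 * k" using k0 by (simp add: power2_eq_square)
  also have "32 * 4 * (16 * k + 32 * 4) + 96 * k \<le> 20000 * k" using k by simp
  finally show ?thesis .
qed

section \<open>The constrained maximization problem\<close>

text \<open>The dictionary between the two problems: a member of \<open>H2_per\<close> yields an
  admissible pair, and conversely the mean-zero condition lets every admissible \<open>v\<close> be
  integrated to a periodic competitor. The energy is \<open>- R_fun\<close>, so the inequality is
  reversed.\<close>

lemma constrained_max_iff:
  assumes u: "per1 u" "\<And>x. (u has_real_derivative w x) (at x)" "H1 w h"
  shows "is_constrained_max E u \<longleftrightarrow>
    admissible E w h \<and> (\<forall>v g. admissible E v g \<longrightarrow> energy w h \<le> energy v g)"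
proof -
  note F = H2_functionals[OF u]
  have "is_constrained_max E u \<longleftrightarrow> admissible E w h \<and> (\<forall>v\<in>H2_per. E_fun v = E \<longrightarrow> R_fun v \<le> R_fun u)"
    unfolding is_constrained_max_def admissible_def using F u(3) by auto
  also have "(\<forall>v\<in>H2_per. E_fun v = E \<longrightarrow> R_fun v \<le> R_fun u) \<longleftrightarrow> (\<forall>v g. admissible E v g \<longrightarrow> energy w h \<le> energy v g)"
  proof (intro iffI allI impI ballI)
    fix v g assume *: "\<forall>v\<in>H2_per. E_fun v = E \<longrightarrow> R_fun v \<le> R_fun u" and v: "admissible E v g"
    have vH: "H1 v g" "(LINT x|mT. v x) = 0" "(LINT x|mT. (v x)\<^sup>2) = 2 * E" using v by (auto simp: admissible_def)
    obtain U where U: "\<And>x. (U has_real_derivative v x) (at x)"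
      using continuous_antiderivative[OF H1_continuous[OF vH(1)]] by blast
    have "per1 U" by (rule per1_antiderivative[OF U H1_continuous[OF vH(1)] H1D(1)[OF vH(1)] vH(2)])
    note G = H2_functionals[OF this U vH(1)]
    have "E_fun U = E" using G(2) vH(3) by simp
    then have "R_fun U \<le> R_fun u" using * G(1) by blast
    then show "energy w h \<le> energy v g" using G(3) F(3) by (simp add: energy_def)
  next
    fix U assume *: "\<forall>v g. admissible E v g \<longrightarrow> energy w h \<le> energy v g" and U: "U \<in> H2_per" "E_fun U = E"
    obtain v g where v: "per1 U" "\<And>x. (U has_real_derivative v x) (at x)" "H1 v g"
      using U(1) unfolding H2_per_iff by blast
    note G = H2_functionals[OF v]
    have "admissible E v g" using G(2,5) U(2) v(3) by (simp add: admissible_def)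
    then have "energy w h \<le> energy v g" using * by blast
    then show "R_fun U \<le> R_fun u" using G(3) F(3) by (simp add: energy_def)
  qed
  finally show ?thesis .
qed

lemma uk_functionals:
  assumes k: "k > 0"
  shows "K_fun (uk k) = 1/2 * (LINT x|mT. (uk k x)\<^sup>2)" "E_fun (uk k) = Ek k" "R_fun (uk k) = - energy (wk k) (wk' k)"
    "uk k \<in> H2_per_odd"
  using H2_functionals[OF per1_uk[OF k] uk(1)[OF k] H1_wk[OF k]] uk_odd[OF k]
  by (auto simp: Ek_def energy_def H2_per_odd_def)

text \<open>A minimizer exists and is a translate of some \<open>wk k\<close>. Translation changes
  neither constraint nor energy, so \<open>wk k\<close> is itself a minimizer.\<close>

lemma uk_exists_max:
  assumes "E > 0" obtains k where "k > 0" "Ek k = E" "is_constrained_max E (uk k)"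
proof -
  obtain w h where w: "admissible E w h" "\<And>v g. admissible E v g \<Longrightarrow> energy w h \<le> energy v g"
    using minimizer_exists[OF assms] by blast
  obtain k a where k: "k > 0" "w = (\<lambda>x. wk k (x - a))"
    "\<forall>p. (\<forall>x. w (x + p) = w x) \<longrightarrow> p \<in> \<int>" "energy w h = energy (wk k) (wk' k)" "admissible E (wk k) (wk' k)"
    by (rule minimizer_classification[OF assms w], assumption, rule that)
  have "Ek k = E" using k(5) by (simp add: admissible_def Ek_def)
  moreover have "is_constrained_max E (uk k)"
    unfolding constrained_max_iff[OF per1_uk[OF k(1)] uk(1)[OF k(1)] H1_wk[OF k(1)]] using k(4,5) w(2) by simp
  ultimately show thesis using that k(1) by blast
qed

text \<open>Oddness of \<open>u\<close> makes \<open>w\<close> even; combined with evenness of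
  \<open>wk k\<close>, this makes \<open>2 * a\<close> a period of \<open>w\<close>, hence an
  integer. If it were odd, \<open>w 0\<close> would equal \<open>wk k (1/2)\<close>, which is
  positive by \<open>pos\<close>, against the negative slope of \<open>u\<close> at 0. So
  \<open>a\<close> is an integer and the translation is trivial.\<close>

lemma odd_maximizer_imp_uk:
  assumes E: "E > 0" and u: "odd_maximizer E u"
    and pos: "\<And>k. k > 0 \<Longrightarrow> Ek k = E \<Longrightarrow> wk k (1/2) > 0"
  obtains k where "k > 0" "Ek k = E" "u = uk k"
proof -
  obtain D where D: "D < 0" "(u has_real_derivative D) (at 0)" using u by (auto simp: odd_maximizer_def)
  have uo: "u (- x) = - u x" for x using u by (auto simp: odd_maximizer_def H2_per_odd_def)
  have "u \<in> H2_per" using u by (auto simp: odd_maximizer_def H2_per_odd_def)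
  then obtain w h where w: "per1 u" "\<And>x. (u has_real_derivative w x) (at x)" "H1 w h"
    unfolding H2_per_iff by blast
  have mx: "admissible E w h" "\<And>v g. admissible E v g \<Longrightarrow> energy w h \<le> energy v g"
    using u constrained_max_iff[OF w, of E] by (auto simp: odd_maximizer_def)
  obtain k a where k: "k > 0" "w = (\<lambda>x. wk k (x - a))"
    "\<forall>p. (\<forall>x. w (x + p) = w x) \<longrightarrow> p \<in> \<int>" "energy w h = energy (wk k) (wk' k)" "admissible E (wk k) (wk' k)"
    by (rule minimizer_classification[OF E mx], assumption, rule that)
  have Ek: "Ek k = E" using k(5) by (simp add: admissible_def Ek_def)
  have we: "w (- x) = w x" for x
  proof -
    have "((\<lambda>x. u (- x)) has_real_derivative w (- x) * - 1) (at x)"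
      by (rule DERIV_chain2[OF w(2)]) (auto intro!: derivative_eq_intros)
    moreover have "((\<lambda>x. - u x) has_real_derivative - w x) (at x)" by (rule DERIV_minus[OF w(2)])
    ultimately show ?thesis unfolding uo using DERIV_unique by fastforce
  qed
  have "w (x + 2 * a) = w x" for x
  proof -
    have "w (x + 2 * a) = wk k (x + a)" unfolding k(2) by (simp add: algebra_simps)
    also have "\<dots> = wk k (- x - a)" using wk_even[OF k(1), of "x + a"] by (simp add: minus_add_distrib)
    also have "\<dots> = w (- x)" unfolding k(2) by simp
    finally show ?thesis using we by simp
  qed
  then have "2 * a \<in> \<int>" using k(3) by blast
  then obtain n :: int where n: "2 * a = of_int n" by (elim Ints_cases)
  have w0: "w 0 < 0" using DERIV_unique[OF D(2) w(2)] D(1) by simp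
  note per = per1_wk[OF k(1)]
  have "even n"
  proof (rule ccontr)
    assume "odd n"
    then obtain m where "n = 2 * m + 1" by (elim oddE)
    then have a: "a = 1/2 + of_int m" using n by simp
    have "w 0 = wk k (1/2 + of_int m)" unfolding k(2) using wk_even[OF k(1), of a] by (simp add: a)
    then show False using w0 pos[OF k(1) Ek] per1_add_int[OF per, of "1/2" m] by simp
  qed
  then obtain m where "n = 2 * m" by (elim evenE)
  then have a: "a = of_int m" using n by simp
  have "w = wk k" unfolding k(2) a using per1_add_int[OF per, of _ "- m"] by auto
  have "u = uk k"
  proof (rule DERIV_eq_imp_eq[where a = 0])
    show "(u has_real_derivative wk k x) (at x)" for x using w(2)[of x] \<open>w = wk k\<close> by simp
    show "(uk k has_real_derivative wk k x) (at x)" for x by (rule uk(1)[OF k(1)])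
    show "u 0 = uk k 0" using uo[of 0] uk(2)[OF k(1)] by simp
  qed
  then show thesis using that k(1) Ek by blast
qed

text \<open>Midway between two solitons \<open>cnS k (k / 2)\<close> is of order
  \<open>exp (- k)\<close>, so the constant \<open>8 * k\<close> prevails over
  \<open>4 * k^2\<close> times it.\<close>

lemma wk_half_pos: "\<forall>\<^sub>F k in at_top. wk k (1/2) > 0"
proof -
  have "((\<lambda>k::real. k * (4 * exp (- k) + 8 * exp k / (exp (2 * k) - 1))) \<longlongrightarrow> 0) at_top" by real_asymp
  from order_tendstoD(2)[OF this, of 2]
  have "\<forall>\<^sub>F k::real in at_top. k * (4 * exp (- k) + 8 * exp k / (exp (2 * k) - 1)) < 2" by simp
  then show ?thesis using eventually_gt_at_top[of 0]
  proof eventually_elim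
    case (elim k)
    have "cnS k (k / 2) \<le> 4 * exp (- k) + 8 * exp k / (exp (2 * k) - 1)"
      using cnS_le[OF elim(2), of "k / 2"] sech2_exp_bound[of "k / 2"] elim(2) by simp
    then have "k * cnS k (k / 2) \<le> k * (4 * exp (- k) + 8 * exp k / (exp (2 * k) - 1))" using elim(2) by (intro mult_left_mono) auto
    from le_less_trans[OF this elim(1)] have "4 * k * (k * cnS k (k / 2)) < 4 * k * 2"
      using elim(2) by (intro mult_strict_left_mono) auto
    then show ?case by (simp add: wk_def power2_eq_square)
  qed
qed

lemma bigo_going_to:
  fixes f g :: "real \<Rightarrow> real"
  assumes "\<And>x. x \<in> A \<Longrightarrow> \<bar>f x\<bar> \<le> C * \<bar>g x\<bar>"
  shows "f \<in> O[k going_to F within A](g)"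
proof (rule bigoI[where c = C])
  show "\<forall>\<^sub>F x in k going_to F within A. norm (f x) \<le> C * norm (g x)"
    unfolding going_to_within_def eventually_inf_principal using assms by (intro always_eventually) simp
qed

theorem theorem1:
  shows "\<exists>\<E>\<^sub>0>0. (\<forall>\<E>\<ge>\<E>\<^sub>0. \<exists>!u. odd_maximizer \<E> u) \<and>
    (\<exists>(ustar :: real \<Rightarrow> real \<Rightarrow> real) (k :: real \<Rightarrow> real).
       (\<forall>\<E>\<ge>\<E>\<^sub>0. odd_maximizer \<E> (ustar \<E>) \<and> k \<E> > 0) \<and>
       filterlim k at_top at_top \<and>
       bigo_Linf (k going_to at_top within {\<E>\<^sub>0..})
         (\<lambda>\<E> x. ustar \<E> x - 4 * k \<E> * (2 * x - tanh (k \<E> * x)))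
         (\<lambda>\<E>. (k \<E>)\<^sup>2 * exp (- k \<E>)) \<and>
       (\<lambda>\<E>. K_fun (ustar \<E>) - 8/3 * (k \<E>)\<^sup>2)
         \<in> O[k going_to at_top within {\<E>\<^sub>0..}](\<lambda>\<E>. k \<E>) \<and>
       (\<lambda>\<E>. E_fun (ustar \<E>) - 32/3 * (k \<E>) ^ 3)
         \<in> O[k going_to at_top within {\<E>\<^sub>0..}](\<lambda>\<E>. (k \<E>)\<^sup>2) \<and>
       (\<lambda>\<E>. R_fun (ustar \<E>) - 256/5 * (k \<E>) ^ 5)
         \<in> O[k going_to at_top within {\<E>\<^sub>0..}](\<lambda>\<E>. (k \<E>) ^ 4))"
proof -
  obtain K1 where K1: "K1 \<ge> 1" "\<And>k l. K1 \<le> k \<Longrightarrow> k < l \<Longrightarrow> Ek k < Ek l"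
    using Ek_eventually_strict_mono by blast
  obtain K2 where K2: "\<And>k. k \<ge> K2 \<Longrightarrow> wk k (1/2) > 0"
    using wk_half_pos by (auto simp: eventually_at_top_linorder)
  \<comment> \<open>The 3 guarantees \<open>k > 2\<close>, where
    \<open>8 * k - 4 * k^2 * cnS k 0\<close> is negative because
    \<open>cnS k 0 >= 1\<close>.\<close>
  define K where "K = max (max K1 K2) 3"
  have K: "K \<ge> K1" "K \<ge> K2" "K \<ge> 3" by (auto simp: K_def)
  define B where "B k = 1/2 * (4 * k\<^sup>2 + 24 * k)\<^sup>2" for k :: real
  \<comment> \<open>By \<open>Ek_le\<close> every parameter up to \<open>K\<close> has energy at
    most \<open>B K\<close>, so energies from \<open>E0\<close> on are attained only in the range
    where \<open>Ek\<close> is strictly increasing.\<close>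
  define E0 where "E0 = B K + 1"
  have E0: "E0 > 0" by (simp add: E0_def B_def add_nonneg_pos)
  have large: "k > K" if "k > 0" "Ek k = E" "E \<ge> E0" for k E
  proof (rule ccontr)
    assume "\<not> k > K"
    then have "Ek k \<le> B K" using Ek_le[OF that(1), of K] by (simp add: B_def)
    then show False using that by (simp add: E0_def)
  qed
  have inj: "k = l" if "k > 0" "l > 0" "Ek k = E" "Ek l = E" "E \<ge> E0" for k l E
    using K1(2)[of k l] K1(2)[of l k] large[OF that(1,3,5)] large[OF that(2,4,5)] K that by (cases k l rule: linorder_cases) auto
  \<comment> \<open>Existence of a minimizer supplies such a \<open>k\<close>. Beyond
    \<open>E0\<close> the choice is unambiguous by \<open>inj\<close>, and this turns the
    description of odd maximizers into uniqueness.\<close>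
  define kf where "kf E = (SOME k. k > 0 \<and> Ek k = E \<and> is_constrained_max E (uk k))" for E
  have kf: "kf E > 0" "Ek (kf E) = E" "is_constrained_max E (uk (kf E))" if "E \<ge> E0" for E
  proof -
    have "E > 0" using that E0 by simp
    then have "\<exists>k. k > 0 \<and> Ek k = E \<and> is_constrained_max E (uk k)" using uk_exists_max[of E] by metis
    then have "kf E > 0 \<and> Ek (kf E) = E \<and> is_constrained_max E (uk (kf E))" unfolding kf_def by (rule someI_ex)
    then show "kf E > 0" "Ek (kf E) = E" "is_constrained_max E (uk (kf E))" by auto
  qed
  have kfK: "kf E > K" if "E \<ge> E0" for E using large kf that by blast
  have kf1: "kf E \<ge> 1" if "E \<ge> E0" for E using kfK[OF that] K by simp
  have max: "odd_maximizer E (uk (kf E))" if E: "E \<ge> E0" for E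
    unfolding odd_maximizer_def
  proof (intro conjI exI[of _ "wk (kf E) 0"])
    show "wk (kf E) 0 < 0"
    proof -
      define k where "k = kf E"
      have k: "k > 2" using kfK[OF E] K by (simp add: k_def)
      have "4 * k\<^sup>2 * 1 \<le> 4 * k\<^sup>2 * cnS k 0" using cnS_ge[of k] k by (intro mult_left_mono) auto
      moreover have "k * 2 < k * k" using k by (intro mult_strict_left_mono) auto
      ultimately show ?thesis unfolding k_def[symmetric] wk_def by (simp add: power2_eq_square)
    qed
    show "(uk (kf E) has_real_derivative wk (kf E) 0) (at 0)" by (rule uk(1)[OF kf(1)[OF E]])
    show "uk (kf E) \<in> H2_per_odd" by (rule uk_functionals(4)[OF kf(1)[OF E]])
    show "is_constrained_max E (uk (kf E))" by (rule kf(3)[OF E])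
  qed
  have uniq: "u = uk (kf E)" if E: "E \<ge> E0" and u: "odd_maximizer E u" for E u
  proof -
    have "E > 0" using E E0 by simp
    then obtain k where k: "k > 0" "Ek k = E" "u = uk k"
    proof (rule odd_maximizer_imp_uk[OF _ u])
      show "wk k (1/2) > 0" if "k > 0" "Ek k = E" for k
        using K2[of k] large[OF that E] K by simp
    qed
    then show ?thesis using inj[OF k(1) kf(1)[OF E] k(2) kf(2)[OF E] E] by simp
  qed
  have top: "filterlim kf at_top at_top"
    unfolding filterlim_at_top
  proof
    fix Z :: real
    show "\<forall>\<^sub>F E in at_top. Z \<le> kf E"
      using eventually_ge_at_top[of E0] eventually_gt_at_top[of "B Z"]
    proof eventually_elim
      case (elim E)
      show ?case
      proof (rule ccontr)
        assume "\<not> Z \<le> kf E"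
        then have "Ek (kf E) \<le> B Z" using Ek_le[OF kf(1)[OF elim(1)], of Z] by (simp add: B_def)
        then show False using kf(2)[OF elim(1)] elim(2) by simp
      qed
    qed
  qed
  have Linf: "bigo_Linf (kf going_to at_top within {E0..})
      (\<lambda>E x. uk (kf E) x - 4 * kf E * (2 * x - tanh (kf E * x))) (\<lambda>E. (kf E)\<^sup>2 * exp (- kf E))"
    unfolding bigo_Linf_def going_to_within_def eventually_inf_principal
  proof (intro exI[of _ 32] always_eventually allI impI AE_I2)
    fix E x assume "E \<in> {E0..}" "x \<in> Tcircle"
    then show "\<bar>uk (kf E) x - 4 * kf E * (2 * x - tanh (kf E * x))\<bar> \<le> 32 * \<bar>(kf E)\<^sup>2 * exp (- kf E)\<bar>"
      using uk_profile[OF kf1[of E], of x] by (simp add: TT_def)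
  qed
  have KK: "(\<lambda>E. K_fun (uk (kf E)) - 8/3 * (kf E)\<^sup>2) \<in> O[kf going_to at_top within {E0..}](\<lambda>E. kf E)"
  proof (rule bigo_going_to[where C = 10000])
    fix E assume "E \<in> {E0..}"
    then have E: "E \<ge> E0" by simp
    show "\<bar>K_fun (uk (kf E)) - 8/3 * (kf E)\<^sup>2\<bar> \<le> 10000 * \<bar>kf E\<bar>"
      using uk_square_asymp[OF kf1[OF E]] kf(1)[OF E] unfolding uk_functionals(1)[OF kf(1)[OF E]] abs_le_iff by simp
  qed
  obtain C1 where C1: "\<And>k. k \<ge> 1 \<Longrightarrow> \<bar>Ek k - 32/3 * k ^ 3\<bar> \<le> C1 * k\<^sup>2" using Ek_asymp by blast
  have EE: "(\<lambda>E. E_fun (uk (kf E)) - 32/3 * (kf E) ^ 3) \<in> O[kf going_to at_top within {E0..}](\<lambda>E. (kf E)\<^sup>2)"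
    by (rule bigo_going_to[where C = C1]) (use C1 kf1 uk_functionals(2) kf(1) in auto)
  obtain C2 where C2: "\<And>k. k \<ge> 1 \<Longrightarrow> \<bar>- energy (wk k) (wk' k) - 256/5 * k ^ 5\<bar> \<le> C2 * k ^ 4" using energy_asymp by blast
  have RR: "(\<lambda>E. R_fun (uk (kf E)) - 256/5 * (kf E) ^ 5) \<in> O[kf going_to at_top within {E0..}](\<lambda>E. (kf E) ^ 4)"
  proof (rule bigo_going_to[where C = C2])
    fix E assume "E \<in> {E0..}"
    then have E: "E \<ge> E0" by simp
    show "\<bar>R_fun (uk (kf E)) - 256/5 * (kf E) ^ 5\<bar> \<le> C2 * \<bar>(kf E) ^ 4\<bar>"
      using C2[OF kf1[OF E]] unfolding uk_functionals(3)[OF kf(1)[OF E]] by simp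
  qed
  show ?thesis
  proof (intro exI[of _ E0] conjI E0 allI impI exI[of _ "\<lambda>E. uk (kf E)"] exI[of _ kf] top Linf KK EE RR)
    show "\<exists>!u. odd_maximizer E u" if "E \<ge> E0" for E
      by (rule ex1I[of _ "uk (kf E)"]) (use max uniq that in auto)
  qed (use max kf(1) in auto)
qed

end
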